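(* Let $(X,d,m)$ be an $\mathsf{RQCD}$ space, i.e. an infinitesimally Hilbertian geodesic Monge space satisfying $\mathsf{QCD}(Q,K,N)$ for some $Q\ge1$, $K\in\mathbb R$, $N\in(1,\infty)$. Then $(\mathsf{Ch},W^{1,2})$ is a regular strongly local Dirichlet form on $L^2(m)$, and for all $x,y\in X$ $$d(x,y)=\sup\{f(x)-f(y): f\in W^{1,2}_{\mathrm{loc}}\cap\mathcal C(X),\ |\mathrm Df|_w^2\le1\ m\text{-a.e.}\}=\sup\{f(x)-f(y): f\in W^{1,2}\cap\mathcal C_c(X),\ |\mathrm Df|_w^2\le1\ m\text{-a.e.}\}.$$
   Context: A metric measure space $(X,d,m)$ is a complete separable metric space $(X,d)$ with an atomless Borel measure $m$ which is finite on bounded sets and has full topological support. It is geodesic if any two points are joined by a constant-speed geodesic. $\mathscr P_2(X)$ is the set of Borel probability measures with finite second moment, with the $L^2$-Wasserstein distance $W_2$; $\mathscr P^m_c(X)$ is the set of compactly supported Borel probability measures absolutely continuous w.r.t. $m$. Let $I=[0,1]$, let $\mathrm{Geo}(X,d)$ be the set of constant-speed geodesics $\gamma:I\to X$, i.e. $d(\gamma_s,\gamma_t)=|s-t|\,d(\gamma_0,\gamma_1)$, and let $\mathrm{ev}_t(\gamma)=\gamma_t$. $\mathrm{OptGeo}(\mu_0,\mu_1)$ is the set of Borel probability measures $\pi$ on $\mathcal C(I;X)$ concentrated on $\mathrm{Geo}(X,d)$ with $(\mathrm{ev}_i)_\sharp\pi=\mu_i$, $i=0,1$, and $W_2(\mu_0,\mu_1)^2=\int\int_I|\dot\gamma|_t^2\,dt\,d\pi(\gamma)$.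 Monge space: for every $\mu_0,\mu_1\in\mathscr P_2(X)$ with $\mu_0\ll m$: (a) there is a unique $\pi\in\mathrm{OptGeo}(\mu_0,\mu_1)$; (b) $\pi=T_\sharp\mu_0$ for some map $T:X\to\mathrm{Geo}(X,d)$; (c) $\mu_t:=(\mathrm{ev}_t)_\sharp\pi\ll m$ for all $t\in[0,1)$. Write $\rho_t=d\mu_t/dm$. Distortion coefficients: for $K\in\mathbb R$, $N\in(1,\infty)$, $t\in(0,1)$, $\theta\ge0$, put $\tau^{(t)}_{K,N}(\theta)=t^{1/N}\big(\sigma^{(t)}_{K,N-1}(\theta)\big)^{1-1/N}$, where, with $\kappa=K/(N-1)$, $\sigma^{(t)}_{K,N-1}(\theta)=\sin(t\theta\sqrt{\kappa})/\sin(\theta\sqrt{\kappa})$ if $K>0$ and $0<\theta<\pi/\sqrt\kappa$, $=+\infty$ if $K>0$ and $\theta\ge\pi/\sqrt\kappa$, $=t$ if $K=0$ or $\theta=0$, and $=\sinh(t\theta\sqrt{-\kappa})/\sinh(\theta\sqrt{-\kappa})$ if $K<0$ and $\theta>0$. A geodesic Monge space satisfies $\mathsf{QCD}(Q,K,N)$ if for every $\mu_0,\mu_1\in\mathscr P^m_c(X)$, with $\pi$ the unique element of $\mathrm{OptGeo}(\mu_0,\mu_1)$, $$\rho_t^{-1/N}(\gamma_t)\ge Q^{-1/N}\Big(\tau^{(1-t)}_{K,N}(d(\gamma_0,\gamma_1))\,\rho_0^{-1/N}(\gamma_0)+\tau^{(t)}_{K,N}(d(\gamma_0,\gamma_1))\,\rho_1^{-1/N}(\gamma_1)\Big)$$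 for every $t\in(0,1)$ and $\pi$-a.e. $\gamma$. Cheeger energy: for Lipschitz $f$ the slope is $|\mathrm Df|(x)=\limsup_{y\to x}|f(y)-f(x)|/d(x,y)$ ($0$ if $x$ is isolated). $\mathrm{Lip}_{bs}(d)$ is the space of Lipschitz functions with bounded support. $\mathsf{Ch}(f)=\inf\{\liminf_n\int_X|\mathrm Df_n|^2\,dm: f_n\in\mathrm{Lip}_{bs}(d),\ f_n\to f\text{ in }L^2(m)\}$ ($\inf\varnothing=+\infty$), and $W^{1,2}=\{f\in L^2(m):\mathsf{Ch}(f)<\infty\}$. For $f\in W^{1,2}$, $|\mathrm Df|_w\in L^2(m)$ is the weak minimal upper gradient: the element of minimal $L^2(m)$-norm among all weak $L^2(m)$-limits of $|\mathrm Df_n|$ with $f_n\in\mathrm{Lip}_{bs}(d)$, $f_n\to f$ in $L^2(m)$; one has $\mathsf{Ch}(f)=\int|\mathrm Df|_w^2\,dm$. The space is infinitesimally Hilbertian if $\mathsf{Ch}$ is a quadratic functional; $\mathsf{Ch}(\cdot,\cdot)$ then denotes the bilinear form obtained by polarization. $\mathcal C_c(X)$, $\mathcal C_0(X)$: continuous functions with compact support, resp. vanishing at infinity. A Dirichlet form $(\mathcal E,\mathcal F)$ on $L^2(m)$ is regular if $\mathcal F\cap\mathcal C_0(X)$ is dense in $\mathcal F$ for $(\mathcal E(\cdot)+\|\cdot\|_{L^2}^2)^{1/2}$ and uniformly dense in $\mathcal C_0(X)$; it is strongly local if $\mathcal E(f,g)=0$ whenever $f,g\in\mathcal F$ have compact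 support and $f$ is constant on a neighbourhood of $\mathrm{supp}\,g$. $W^{1,2}_{\mathrm{loc}}$ is the space of ($m$-classes of) measurable functions $f$ such that for each relatively compact open $G\subset X$ there is $f_G\in W^{1,2}$ with $f=f_G$ $m$-a.e. on $G$; by locality $|\mathrm Df|_w$ extends to $W^{1,2}_{\mathrm{loc}}$ via $|\mathrm Df|_w=|\mathrm Df_G|_w$ $m$-a.e. on $G$. *)

theory Defs
  imports "HOL-Probability.Probability"
begin

text \<open>
  The metric space \<open>(X, d)\<close> is a type of class \<open>polish_space\<close> (complete, separable metric space)
  with its \<open>dist\<close>. Elements of \<open>L\<^sup>2(m)\<close>, of \<open>W\<^sup>1\<^sup>,\<^sup>2\<close> and so on are represented by Borel functions;
  all notions below are invariant under \<open>m\<close>-a.e. modification, except where continuity of the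
  representative is required explicitly.
\<close>

section \<open>Metric measure spaces\<close>

definition atomless :: "'a measure \<Rightarrow> bool" where
  "atomless m \<longleftrightarrow> (\<forall>A\<in>sets m. 0 < emeasure m A \<longrightarrow>
     (\<exists>B\<in>sets m. B \<subseteq> A \<and> 0 < emeasure m B \<and> emeasure m B < emeasure m A))"

definition measure_support :: "'a::topological_space measure \<Rightarrow> 'a set" where
  "measure_support m = {x. \<forall>U. open U \<longrightarrow> x \<in> U \<longrightarrow> 0 < emeasure m U}"

definition metric_measure_space :: "'a::polish_space measure \<Rightarrow> bool" where
  "metric_measure_space m \<longleftrightarrow>
     sets m = sets borel \<and>
     atomless m \<and>
     (\<forall>B\<in>sets borel. bounded B \<longrightarrow> emeasure m B < \<infinity>) \<and>
     measure_support m = UNIV"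

section \<open>Curves and geodesics\<close>

typedef unit_interval = "{0..1::real}"
  by (rule exI[of _ 0]) simp

instantiation unit_interval :: metric_space
begin

definition dist_unit_interval :: "unit_interval \<Rightarrow> unit_interval \<Rightarrow> real" where
  "dist_unit_interval s t = \<bar>Rep_unit_interval s - Rep_unit_interval t\<bar>"

definition uniformity_unit_interval :: "(unit_interval \<times> unit_interval) filter" where
  "uniformity_unit_interval = (INF e\<in>{0<..}. principal {(s, t). dist s t < e})"

definition open_unit_interval :: "unit_interval set \<Rightarrow> bool" where
  "open_unit_interval U \<longleftrightarrow> (\<forall>s\<in>U. \<forall>\<^sub>F (s', t) in uniformity. s' = s \<longrightarrow> t \<in> U)"

instance
  by standard
     (auto simp: dist_unit_interval_def uniformity_unit_interval_def open_unit_interval_def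
       Rep_unit_interval_inject)

end

text \<open>
  \<open>C(I; X)\<close> with the sup metric. The interval is compact, so the boundedness built into \<open>bcontfun\<close>
  is automatic.
\<close>

type_synonym 'a curve = "(unit_interval, 'a) bcontfun"

definition ev :: "real \<Rightarrow> 'a::metric_space curve \<Rightarrow> 'a" where
  "ev t \<gamma> = apply_bcontfun \<gamma> (Abs_unit_interval t)"

definition Geo :: "'a::metric_space curve set" where
  "Geo = {\<gamma>. \<forall>s\<in>{0..1}. \<forall>t\<in>{0..1}. dist (ev s \<gamma>) (ev t \<gamma>) = \<bar>s - t\<bar> * dist (ev 0 \<gamma>) (ev 1 \<gamma>)}"

definition geodesic_space :: "'a::metric_space itself \<Rightarrow> bool" where
  "geodesic_space _ \<longleftrightarrow> (\<forall>x y :: 'a. \<exists>\<gamma>\<in>Geo. ev 0 \<gamma> = x \<and> ev 1 \<gamma> = y)"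

definition metric_speed :: "'a::metric_space curve \<Rightarrow> real \<Rightarrow> real" where
  "metric_speed \<gamma> t = Lim (at t within {0..1}) (\<lambda>s. dist (ev s \<gamma>) (ev t \<gamma>) / \<bar>s - t\<bar>)"

section \<open>Optimal transport\<close>

definition ennreal_powr :: "ennreal \<Rightarrow> real \<Rightarrow> ennreal" where
  "ennreal_powr x p =
     (if p = 0 then 1
      else if x = 0 then (if p < 0 then \<infinity> else 0)
      else if x = \<infinity> then (if p < 0 then 0 else \<infinity>)
      else ennreal (enn2real x powr p))"

definition borel_prob :: "'a::topological_space measure \<Rightarrow> bool" where
  "borel_prob \<mu> \<longleftrightarrow> prob_space \<mu> \<and> sets \<mu> = sets borel"

definition P2 :: "'a::polish_space measure set" where
  "P2 = {\<mu>. borel_prob \<mu> \<and> (\<exists>x0. (\<integral>\<^sup>+x. ennreal ((dist x x0)\<^sup>2) \<partial>\<mu>) < \<infinity>)}"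

definition Pcm :: "'a::polish_space measure \<Rightarrow> 'a measure set" where
  "Pcm m = {\<mu>. borel_prob \<mu> \<and> compact (measure_support \<mu>) \<and> absolutely_continuous m \<mu>}"

definition couplings :: "'a::polish_space measure \<Rightarrow> 'a measure \<Rightarrow> ('a \<times> 'a) measure set" where
  "couplings \<mu> \<nu> = {\<eta>. borel_prob \<eta> \<and> distr \<eta> borel fst = \<mu> \<and> distr \<eta> borel snd = \<nu>}"

definition W2 :: "'a::polish_space measure \<Rightarrow> 'a measure \<Rightarrow> ennreal" where
  "W2 \<mu> \<nu> =
     ennreal_powr (INF \<eta>\<in>couplings \<mu> \<nu>. \<integral>\<^sup>+z. ennreal ((dist (fst z) (snd z))\<^sup>2) \<partial>\<eta>) (1 / 2)"

definition OptGeo :: "'a::polish_space measure \<Rightarrow> 'a measure \<Rightarrow> 'a curve measure set" where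
  "OptGeo \<mu>0 \<mu>1 =
     {\<pi>. borel_prob \<pi> \<and> (AE \<gamma> in \<pi>. \<gamma> \<in> Geo) \<and>
         distr \<pi> borel (ev 0) = \<mu>0 \<and> distr \<pi> borel (ev 1) = \<mu>1 \<and>
         (W2 \<mu>0 \<mu>1)\<^sup>2 = (\<integral>\<^sup>+\<gamma>. (\<integral>\<^sup>+t\<in>{0..1}. ennreal ((metric_speed \<gamma> t)\<^sup>2) \<partial>lborel) \<partial>\<pi>)}"

definition monge_space :: "'a::polish_space measure \<Rightarrow> bool" where
  "monge_space m \<longleftrightarrow> metric_measure_space m \<and>
     (\<forall>\<mu>0\<in>P2. \<forall>\<mu>1\<in>P2. absolutely_continuous m \<mu>0 \<longrightarrow>
        (\<exists>!\<pi>. \<pi> \<in> OptGeo \<mu>0 \<mu>1) \<and>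
        (\<forall>\<pi>\<in>OptGeo \<mu>0 \<mu>1.
           (\<exists>T\<in>borel_measurable borel. range T \<subseteq> Geo \<and> \<pi> = distr \<mu>0 borel T) \<and>
           (\<forall>t\<in>{0..<1}. absolutely_continuous m (distr \<pi> borel (ev t)))))"

section \<open>Distortion coefficients and the quasi curvature-dimension condition\<close>

definition sigma_coeff :: "real \<Rightarrow> real \<Rightarrow> real \<Rightarrow> real \<Rightarrow> ennreal" where
  "sigma_coeff K N' t \<theta> =
     (if K = 0 \<or> \<theta> = 0 then ennreal t
      else if K > 0 then
        (if \<theta> < pi / sqrt (K / N')
         then ennreal (sin (t * \<theta> * sqrt (K / N')) / sin (\<theta> * sqrt (K / N')))
         else \<infinity>)
      else ennreal (sinh (t * \<theta> * sqrt (- (K / N'))) / sinh (\<theta> * sqrt (- (K / N')))))"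

definition tau_coeff :: "real \<Rightarrow> real \<Rightarrow> real \<Rightarrow> real \<Rightarrow> ennreal" where
  "tau_coeff K N t \<theta> =
     ennreal (t powr (1 / N)) * ennreal_powr (sigma_coeff K (N - 1) t \<theta>) (1 - 1 / N)"

text \<open>
  The inequality is read in \<open>[0, \<infinity>]\<close>; it forces \<open>d(\<gamma>\<^sub>0, \<gamma>\<^sub>1) < \<pi> / sqrt \<kappa>\<close> for \<open>\<pi>\<close>-a.e. \<open>\<gamma>\<close> if \<open>K > 0\<close>.
  The exceptional null set may depend on \<open>t\<close>, as the densities are only defined \<open>m\<close>-a.e.
\<close>

definition QCD :: "real \<Rightarrow> real \<Rightarrow> real \<Rightarrow> 'a::polish_space measure \<Rightarrow> bool" where
  "QCD Q K N m \<longleftrightarrow>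
     (\<forall>\<mu>0\<in>Pcm m. \<forall>\<mu>1\<in>Pcm m. \<forall>\<pi>\<in>OptGeo \<mu>0 \<mu>1. \<forall>t\<in>{0<..<1}.
        let \<rho> = (\<lambda>s. RN_deriv m (distr \<pi> borel (ev s))) in
        AE \<gamma> in \<pi>.
          ennreal_powr (\<rho> t (ev t \<gamma>)) (- 1 / N) \<ge>
          ennreal (Q powr (- 1 / N)) *
            (tau_coeff K N (1 - t) (dist (ev 0 \<gamma>) (ev 1 \<gamma>)) *
               ennreal_powr (\<rho> 0 (ev 0 \<gamma>)) (- 1 / N) +
             tau_coeff K N t (dist (ev 0 \<gamma>) (ev 1 \<gamma>)) *
               ennreal_powr (\<rho> 1 (ev 1 \<gamma>)) (- 1 / N)))"

section \<open>Cheeger energy\<close>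

text \<open>Isolated points: \<open>at x = bot\<close>, where the \<open>ennreal\<close>-valued \<open>Limsup\<close> is \<open>0\<close>.\<close>

definition slope :: "('a::metric_space \<Rightarrow> real) \<Rightarrow> 'a \<Rightarrow> real" where
  "slope f x = enn2real (Limsup (at x) (\<lambda>y. ennreal (\<bar>f y - f x\<bar> / dist x y)))"

definition Lip_bs :: "('a::metric_space \<Rightarrow> real) set" where
  "Lip_bs = {f. (\<exists>L. L-lipschitz_on UNIV f) \<and> bounded {x. f x \<noteq> 0}}"

definition L2 :: "'a measure \<Rightarrow> ('a \<Rightarrow> real) set" where
  "L2 m = {f \<in> borel_measurable m. integrable m (\<lambda>x. (f x)\<^sup>2)}"

definition L2_conv :: "'a measure \<Rightarrow> (nat \<Rightarrow> 'a \<Rightarrow> real) \<Rightarrow> ('a \<Rightarrow> real) \<Rightarrow> bool" where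
  "L2_conv m F f \<longleftrightarrow> (\<forall>n. F n \<in> L2 m) \<and> f \<in> L2 m \<and>
     (\<lambda>n. \<integral>x. (F n x - f x)\<^sup>2 \<partial>m) \<longlonglongrightarrow> 0"

definition L2_weak_conv :: "'a measure \<Rightarrow> (nat \<Rightarrow> 'a \<Rightarrow> real) \<Rightarrow> ('a \<Rightarrow> real) \<Rightarrow> bool" where
  "L2_weak_conv m F f \<longleftrightarrow> (\<forall>n. F n \<in> L2 m) \<and> f \<in> L2 m \<and>
     (\<forall>h\<in>L2 m. (\<lambda>n. \<integral>x. F n x * h x \<partial>m) \<longlonglongrightarrow> (\<integral>x. f x * h x \<partial>m))"

definition Ch :: "'a::metric_space measure \<Rightarrow> ('a \<Rightarrow> real) \<Rightarrow> ennreal" where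
  "Ch m f = Inf {liminf (\<lambda>n. \<integral>\<^sup>+x. ennreal ((slope (F n) x)\<^sup>2) \<partial>m) | F.
                   (\<forall>n. F n \<in> Lip_bs) \<and> L2_conv m F f}"

definition W12 :: "'a::metric_space measure \<Rightarrow> ('a \<Rightarrow> real) set" where
  "W12 m = {f \<in> L2 m. Ch m f < \<infinity>}"

definition relaxed_slopes :: "'a::metric_space measure \<Rightarrow> ('a \<Rightarrow> real) \<Rightarrow> ('a \<Rightarrow> real) set" where
  "relaxed_slopes m f =
     {g. \<exists>F. (\<forall>n. F n \<in> Lip_bs) \<and> L2_conv m F f \<and> L2_weak_conv m (\<lambda>n. slope (F n)) g}"

text \<open>The choice is unique up to \<open>m\<close>-a.e. equality.\<close>

definition weak_grad :: "'a::metric_space measure \<Rightarrow> ('a \<Rightarrow> real) \<Rightarrow> 'a \<Rightarrow> real" where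
  "weak_grad m f = (SOME g. g \<in> relaxed_slopes m f \<and>
     (\<forall>g'\<in>relaxed_slopes m f. (\<integral>x. (g x)\<^sup>2 \<partial>m) \<le> (\<integral>x. (g' x)\<^sup>2 \<partial>m)))"

definition infinitesimally_Hilbertian :: "'a::metric_space measure \<Rightarrow> bool" where
  "infinitesimally_Hilbertian m \<longleftrightarrow> (\<forall>f\<in>W12 m. \<forall>g\<in>W12 m.
     Ch m (\<lambda>x. f x + g x) + Ch m (\<lambda>x. f x - g x) = 2 * Ch m f + 2 * Ch m g)"

definition Ch_form :: "'a::metric_space measure \<Rightarrow> ('a \<Rightarrow> real) \<Rightarrow> ('a \<Rightarrow> real) \<Rightarrow> real" where
  "Ch_form m f g =
     (enn2real (Ch m (\<lambda>x. f x + g x)) - enn2real (Ch m (\<lambda>x. f x - g x))) / 4"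

definition RQCD :: "'a::polish_space measure \<Rightarrow> bool" where
  "RQCD m \<longleftrightarrow> monge_space m \<and> geodesic_space TYPE('a) \<and> infinitesimally_Hilbertian m \<and>
     (\<exists>Q K N. 1 \<le> Q \<and> 1 < N \<and> QCD Q K N m)"

section \<open>Dirichlet forms\<close>

text \<open>
  A densely defined, symmetric, nonnegative, closed bilinear form with the Markov property.
  The second and third conjuncts make the domain and the form well defined on \<open>m\<close>-classes.
\<close>

definition dirichlet_form ::
  "'a measure \<Rightarrow> (('a \<Rightarrow> real) \<Rightarrow> ('a \<Rightarrow> real) \<Rightarrow> real) \<Rightarrow> ('a \<Rightarrow> real) set \<Rightarrow> bool" where
  "dirichlet_form m E F \<longleftrightarrow>
     F \<subseteq> L2 m \<and>
     (\<forall>f\<in>F. \<forall>g\<in>borel_measurable m. (AE x in m. f x = g x) \<longrightarrow> g \<in> F) \<and>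
     (\<forall>f\<in>F. \<forall>f'\<in>F. \<forall>g\<in>F. (AE x in m. f x = f' x) \<longrightarrow> E f g = E f' g) \<and>
     (\<lambda>x. 0) \<in> F \<and>
     (\<forall>f\<in>F. \<forall>g\<in>F. (\<lambda>x. f x + g x) \<in> F) \<and>
     (\<forall>c. \<forall>f\<in>F. (\<lambda>x. c * f x) \<in> F) \<and>
     (\<forall>f\<in>L2 m. \<exists>u. (\<forall>n. u n \<in> F) \<and> L2_conv m u f) \<and>
     (\<forall>f\<in>F. \<forall>g\<in>F. \<forall>h\<in>F. E (\<lambda>x. f x + g x) h = E f h + E g h) \<and>
     (\<forall>c. \<forall>f\<in>F. \<forall>g\<in>F. E (\<lambda>x. c * f x) g = c * E f g) \<and>
     (\<forall>f\<in>F. \<forall>g\<in>F. E f g = E g f) \<and>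
     (\<forall>f\<in>F. 0 \<le> E f f) \<and>
     (\<forall>u. (\<forall>n. u n \<in> F) \<and>
        (\<forall>e>0. \<exists>n0. \<forall>i\<ge>n0. \<forall>j\<ge>n0.
           E (\<lambda>x. u i x - u j x) (\<lambda>x. u i x - u j x) + (\<integral>x. (u i x - u j x)\<^sup>2 \<partial>m) < e) \<longrightarrow>
        (\<exists>f\<in>F. (\<lambda>n. E (\<lambda>x. u n x - f x) (\<lambda>x. u n x - f x) + (\<integral>x. (u n x - f x)\<^sup>2 \<partial>m))
                  \<longlonglongrightarrow> 0)) \<and>
     (\<forall>f\<in>F. (\<lambda>x. min (max (f x) 0) 1) \<in> F \<and>
        E (\<lambda>x. min (max (f x) 0) 1) (\<lambda>x. min (max (f x) 0) 1) \<le> E f f)"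

definition C0 :: "('a::topological_space \<Rightarrow> real) set" where
  "C0 = {f. continuous_on UNIV f \<and> (\<forall>e>0. \<exists>C. compact C \<and> (\<forall>x. x \<notin> C \<longrightarrow> \<bar>f x\<bar> < e))}"

definition Cc :: "('a::topological_space \<Rightarrow> real) set" where
  "Cc = {f. continuous_on UNIV f \<and> compact (closure {x. f x \<noteq> 0})}"

definition regular_form ::
  "'a::topological_space measure \<Rightarrow> (('a \<Rightarrow> real) \<Rightarrow> ('a \<Rightarrow> real) \<Rightarrow> real) \<Rightarrow>
     ('a \<Rightarrow> real) set \<Rightarrow> bool" where
  "regular_form m E F \<longleftrightarrow>
     (\<forall>f\<in>F. \<forall>e>0. \<exists>g\<in>F \<inter> C0.
        sqrt (E (\<lambda>x. f x - g x) (\<lambda>x. f x - g x) + (\<integral>x. (f x - g x)\<^sup>2 \<partial>m)) < e) \<and>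
     (\<forall>f\<in>C0. \<forall>e>0. \<exists>g\<in>F \<inter> C0. \<forall>x. \<bar>f x - g x\<bar> < e)"

text \<open>The support of an \<open>m\<close>-class: the complement of the largest open set where \<open>f = 0\<close> \<open>m\<close>-a.e.\<close>

definition ess_support :: "'a::topological_space measure \<Rightarrow> ('a \<Rightarrow> real) \<Rightarrow> 'a set" where
  "ess_support m f = - \<Union>{U. open U \<and> (AE x in m. x \<in> U \<longrightarrow> f x = 0)}"

definition strongly_local_form ::
  "'a::topological_space measure \<Rightarrow> (('a \<Rightarrow> real) \<Rightarrow> ('a \<Rightarrow> real) \<Rightarrow> real) \<Rightarrow>
     ('a \<Rightarrow> real) set \<Rightarrow> bool" where
  "strongly_local_form m E F \<longleftrightarrow>
     (\<forall>f\<in>F. \<forall>g\<in>F. compact (ess_support m f) \<and> compact (ess_support m g) \<and>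
        (\<exists>U c. open U \<and> ess_support m g \<subseteq> U \<and> (AE x in m. x \<in> U \<longrightarrow> f x = c)) \<longrightarrow>
        E f g = 0)"

section \<open>Local Sobolev space\<close>

definition W12_loc :: "'a::metric_space measure \<Rightarrow> ('a \<Rightarrow> real) set" where
  "W12_loc m = {f \<in> borel_measurable m. \<forall>G. open G \<and> compact (closure G) \<longrightarrow>
     (\<exists>fG\<in>W12 m. AE x in m. x \<in> G \<longrightarrow> f x = fG x)}"

definition weak_grad_loc :: "'a::metric_space measure \<Rightarrow> ('a \<Rightarrow> real) \<Rightarrow> 'a \<Rightarrow> real" where
  "weak_grad_loc m f = (SOME g. g \<in> borel_measurable m \<and>
     (\<forall>G. \<forall>fG\<in>W12 m. open G \<and> compact (closure G) \<and> (AE x in m. x \<in> G \<longrightarrow> f x = fG x) \<longrightarrow>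
        (AE x in m. x \<in> G \<longrightarrow> g x = weak_grad m fG x)))"

end

theory Submission
  imports Defs
begin

text \<open>
  The curvature condition enters only through optimal geodesic plans between normalised restrictions
  of \<open>m\<close> to compact sets: it bounds the densities of their intermediate marginals. Moving a small set
  towards a fixed one for a short time then bounds the measure of small balls from below, so that bounded
  sets are totally bounded and \<open>X\<close> is proper. The same bounds show that these plans are test plans, along
  which increments of Lipschitz functions are controlled by their slopes integrated against an \<open>L\<^sup>2(m)\<close>
  density; this passes to relaxed slopes, and shrinking the compact sets to points shows that a
  continuous function with weak gradient at most \<open>1\<close> is \<open>1\<close>-Lipschitz. Conversely the truncated distance
  functions have slope at most \<open>1\<close> and, by properness, compact support.

  Strong density of Lipschitz functions follows from the parallelogram identity and lower
  semicontinuity of the Cheeger energy, strong locality from reflecting approximating functions at the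
  level \<open>c\<close>, and the locality of the weak gradient from gluing relaxed slopes along cutoff functions.
\<close>

section \<open>Square integrable functions\<close>

text \<open>The \<open>QCD\<close> inequality bounds the power -1/N of the intermediate density
  below by a sum of two nonnegative terms, and each term is used on its own. Keeping the term of the
  target bounds the density at time t by a constant that sees only t, the distances involved and the
  mass of the target set; this is why a lower bound for the measure of balls can be uniform in the
  ball that is moved. Keeping the term of the source gives a bound that survives as t tends to 0.
  Together they cover all times, the endpoints being the uniform measures themselves. Of the
  distortion coefficients only a lower bound c t at bounded distances enters. The density constants
  blow up when the compact sets shrink to points, and this does no harm: for fixed sets the slopes
  converge weakly against one fixed density h, and the limit sees only the bound 1 on the weak
  gradient and the total mass 1 of h. The constants have disappeared before the sets shrink.\<close>

abbreviation sqnorm :: "'a measure \<Rightarrow> ('a \<Rightarrow> real) \<Rightarrow> real" where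
  "sqnorm m f \<equiv> \<integral>x. (f x)\<^sup>2 \<partial>m"

lemma L2_measurable [measurable_dest]: "f \<in> L2 m \<Longrightarrow> f \<in> borel_measurable m"
  and L2_integrable: "f \<in> L2 m \<Longrightarrow> integrable m (\<lambda>x. (f x)\<^sup>2)"
  by (auto simp: L2_def)

lemma L2_bound:
  assumes "g \<in> L2 m" "f \<in> borel_measurable m" "AE x in m. \<bar>f x\<bar> \<le> \<bar>g x\<bar>"
  shows "f \<in> L2 m"
proof -
  have "AE x in m. norm ((f x)\<^sup>2) \<le> norm ((g x)\<^sup>2)"
    using assms(3) by eventually_elim (simp add: abs_le_square_iff[symmetric])
  then have "integrable m (\<lambda>x. (f x)\<^sup>2)"
    using assms by (intro Bochner_Integration.integrable_bound[OF L2_integrable[OF assms(1)]]) auto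
  then show ?thesis using assms by (auto simp: L2_def)
qed

lemma L2_mult_integrable:
  assumes "f \<in> L2 m" "g \<in> L2 m"
  shows "integrable m (\<lambda>x. f x * g x)"
proof (rule Bochner_Integration.integrable_bound)
  show "integrable m (\<lambda>x. (f x)\<^sup>2 + (g x)\<^sup>2)"
    using assms by (intro Bochner_Integration.integrable_add L2_integrable)
  show "(\<lambda>x. f x * g x) \<in> borel_measurable m"
    using assms by (auto simp: L2_def)
  have "\<bar>a * b\<bar> \<le> a\<^sup>2 + b\<^sup>2" for a b :: real
  proof -
    have "0 \<le> (\<bar>a\<bar> - \<bar>b\<bar>)\<^sup>2" "0 \<le> \<bar>a\<bar> * \<bar>b\<bar>" by auto
    then have "0 \<le> a\<^sup>2 + b\<^sup>2 - 2 * (\<bar>a\<bar> * \<bar>b\<bar>)" "0 \<le> \<bar>a\<bar> * \<bar>b\<bar>"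
      by (auto simp: power2_diff)
    then show ?thesis unfolding abs_mult by linarith
  qed
  then show "AE x in m. norm (f x * g x) \<le> norm ((f x)\<^sup>2 + (g x)\<^sup>2)"
    by (auto simp: abs_mult)
qed

lemma L2_zero [simp]: "(\<lambda>x. 0) \<in> L2 m"
  by (simp add: L2_def)

lemma L2_cmult: "f \<in> L2 m \<Longrightarrow> (\<lambda>x. c * f x) \<in> L2 m"
  by (auto simp: L2_def power_mult_distrib)

lemma L2_add:
  assumes "f \<in> L2 m" "g \<in> L2 m"
  shows "(\<lambda>x. f x + g x) \<in> L2 m"
proof -
  have "integrable m (\<lambda>x. (f x)\<^sup>2 + (g x)\<^sup>2 + 2 * (f x * g x))"
    using assms L2_mult_integrable[OF assms]
    by (intro Bochner_Integration.integrable_add L2_integrable integrable_mult_right)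
  then show ?thesis
    using assms by (auto simp: L2_def power2_sum mult.assoc)
qed

lemma L2_diff:
  assumes "f \<in> L2 m" "g \<in> L2 m"
  shows "(\<lambda>x. f x - g x) \<in> L2 m"
  using L2_add[OF assms(1) L2_cmult[OF assms(2), of "-1"]] by simp

lemma sqnorm_cong_AE:
  assumes "AE x in m. f x = g x" "f \<in> borel_measurable m" "g \<in> borel_measurable m"
  shows "sqnorm m f = sqnorm m g"
  using assms by (intro integral_cong_AE) auto

lemma sqnorm_cmult: "sqnorm m (\<lambda>x. c * f x) = c\<^sup>2 * sqnorm m f"
  by (simp add: power_mult_distrib)

text \<open>Expanding with free coefficients a and b serves the parallelogram law, the discriminant
  argument for Cauchy-Schwarz and the variational inequality behind Mazur's lemma alike.\<close>

lemma sqnorm_lincomb: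
  assumes "f \<in> L2 m" "g \<in> L2 m"
  shows "sqnorm m (\<lambda>x. a * f x + b * g x) =
    a\<^sup>2 * sqnorm m f + 2 * a * b * (\<integral>x. f x * g x \<partial>m) + b\<^sup>2 * sqnorm m g"
proof -
  have "sqnorm m (\<lambda>x. a * f x + b * g x) =
      (\<integral>x. a\<^sup>2 * (f x)\<^sup>2 + (2 * a * b) * (f x * g x) + b\<^sup>2 * (g x)\<^sup>2 \<partial>m)"
    by (intro arg_cong[of _ _ "integral\<^sup>L m"] ext) (simp add: power2_sum power_mult_distrib algebra_simps)
  also have "\<dots> = a\<^sup>2 * sqnorm m f + 2 * a * b * (\<integral>x. f x * g x \<partial>m) + b\<^sup>2 * sqnorm m g"
    using L2_integrable[OF assms(1)] L2_integrable[OF assms(2)] L2_mult_integrable[OF assms]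
    by (simp del: power_mult_distrib)
  finally show ?thesis .
qed

lemma sqnorm_add:
  assumes "f \<in> L2 m" "g \<in> L2 m"
  shows "sqnorm m (\<lambda>x. f x + g x) = sqnorm m f + 2 * (\<integral>x. f x * g x \<partial>m) + sqnorm m g"
  using sqnorm_lincomb[OF assms, of 1 1] by simp

lemma sqnorm_diff:
  assumes "f \<in> L2 m" "g \<in> L2 m"
  shows "sqnorm m (\<lambda>x. f x - g x) = sqnorm m f - 2 * (\<integral>x. f x * g x \<partial>m) + sqnorm m g"
  using sqnorm_lincomb[OF assms, of 1 "-1"] by simp

lemma sqnorm_parallelogram:
  assumes "f \<in> L2 m" "g \<in> L2 m"
  shows "sqnorm m (\<lambda>x. f x + g x) + sqnorm m (\<lambda>x. f x - g x) = 2 * sqnorm m f + 2 * sqnorm m g"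
  using sqnorm_add[OF assms] sqnorm_diff[OF assms] by simp

lemma sqnorm_add_le:
  assumes "f \<in> L2 m" "g \<in> L2 m"
  shows "sqnorm m (\<lambda>x. f x + g x) \<le> 2 * sqnorm m f + 2 * sqnorm m g"
proof -
  have "0 \<le> sqnorm m (\<lambda>x. f x - g x)" by simp
  then show ?thesis using sqnorm_parallelogram[OF assms] by linarith
qed

lemma sqnorm_triangle_le:
  assumes "f \<in> L2 m" "g \<in> L2 m" "h \<in> L2 m"
  shows "sqnorm m (\<lambda>x. f x - h x) \<le> 2 * sqnorm m (\<lambda>x. f x - g x) + 2 * sqnorm m (\<lambda>x. g x - h x)"
  using sqnorm_add_le[OF L2_diff[OF assms(1,2)] L2_diff[OF assms(2,3)]] by simp

lemma sqnorm_mono: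
  assumes "g \<in> L2 m" "f \<in> borel_measurable m" "AE x in m. \<bar>f x\<bar> \<le> \<bar>g x\<bar>"
  shows "sqnorm m f \<le> sqnorm m g"
proof -
  have "AE x in m. (f x)\<^sup>2 \<le> (g x)\<^sup>2"
    using assms(3) by eventually_elim (simp add: abs_le_square_iff[symmetric])
  then show ?thesis
    using L2_bound[OF assms] assms(1) by (intro integral_mono_AE) (auto dest: L2_integrable)
qed

text \<open>The quadratic form in (a, b) given by the squared norm of a f + b g is nonnegative. If g
  has norm 0, the form is affine in b at a = 1, which forces the inner product to vanish; otherwise
  it is evaluated at a = <g, g> and b = -<f, g>.\<close>

lemma Cauchy_Schwarz_L2:
  assumes "f \<in> L2 m" "g \<in> L2 m"
  shows "(\<integral>x. f x * g x \<partial>m)\<^sup>2 \<le> sqnorm m f * sqnorm m g"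
proof -
  let ?A = "sqnorm m f" and ?B = "\<integral>x. f x * g x \<partial>m" and ?C = "sqnorm m g"
  have q: "0 \<le> a\<^sup>2 * ?A + 2 * a * b * ?B + b\<^sup>2 * ?C" for a b
    unfolding sqnorm_lincomb[OF assms, symmetric] by simp
  show ?thesis
  proof (cases "?C = 0")
    case True
    have "?B = 0"
    proof (rule ccontr)
      assume "?B \<noteq> 0"
      \<comment> \<open>With a = 1 and this b the form takes the value -1.\<close>
      then have "2 * 1 * (- (?A + 1) / (2 * ?B)) * ?B = - (?A + 1)" by (simp add: field_simps)
      then show False
        using q[of 1 "- (?A + 1) / (2 * ?B)"] True by simp
    qed
    then show ?thesis using True by simp
  next
    case False
    have C: "0 < ?C" using False by (simp add: order.strict_iff_order)
    have "0 \<le> ?C * (?C * ?A - ?B\<^sup>2)"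
      using q[of ?C "- ?B"] by (simp add: algebra_simps power2_eq_square)
    then show ?thesis
      using C by (simp add: zero_le_mult_iff mult.commute)
  qed
qed

lemma Cauchy_Schwarz_L2_abs:
  assumes "f \<in> L2 m" "g \<in> L2 m"
  shows "\<bar>\<integral>x. f x * g x \<partial>m\<bar> \<le> sqrt (sqnorm m f) * sqrt (sqnorm m g)"
  using real_sqrt_le_mono[OF Cauchy_Schwarz_L2[OF assms]] by (simp add: real_sqrt_mult)

lemma L2_convD:
  assumes "L2_conv m F f"
  shows "F n \<in> L2 m" "f \<in> L2 m" "(\<lambda>n. sqnorm m (\<lambda>x. F n x - f x)) \<longlonglongrightarrow> 0"
  using assms by (auto simp: L2_conv_def)

lemma L2_conv_const: "f \<in> L2 m \<Longrightarrow> L2_conv m (\<lambda>_. f) f"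
  by (simp add: L2_conv_def)

lemma L2_conv_cong_AE:
  assumes "L2_conv m F f" "AE x in m. f x = g x" "g \<in> borel_measurable m"
  shows "L2_conv m F g"
proof -
  have g: "g \<in> L2 m"
    using assms by (intro L2_bound[OF L2_convD(2)[OF assms(1)]]) auto
  have "sqnorm m (\<lambda>x. F n x - f x) = sqnorm m (\<lambda>x. F n x - g x)" for n
    using assms(2) L2_convD[OF assms(1)] g by (intro sqnorm_cong_AE) (auto dest: L2_measurable)
  then show ?thesis using assms(1) g by (simp add: L2_conv_def)
qed

lemma L2_conv_cmult:
  assumes "L2_conv m F f"
  shows "L2_conv m (\<lambda>n x. c * F n x) (\<lambda>x. c * f x)"
proof -
  have "(\<lambda>n. c\<^sup>2 * sqnorm m (\<lambda>x. F n x - f x)) \<longlonglongrightarrow> c\<^sup>2 * 0"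
    by (intro tendsto_mult tendsto_const L2_convD(3)[OF assms])
  then show ?thesis
    using L2_convD(1,2)[OF assms]
    by (simp add: L2_conv_def L2_cmult right_diff_distrib[symmetric] power_mult_distrib)
qed

lemma L2_conv_add:
  assumes "L2_conv m F f" "L2_conv m G g"
  shows "L2_conv m (\<lambda>n x. F n x + G n x) (\<lambda>x. f x + g x)"
  unfolding L2_conv_def
proof (intro conjI allI)
  note F = L2_convD[OF assms(1)] and G = L2_convD[OF assms(2)]
  show "(\<lambda>x. F n x + G n x) \<in> L2 m" for n using F G by (intro L2_add)
  show "(\<lambda>x. f x + g x) \<in> L2 m" using F G by (intro L2_add)
  show "(\<lambda>n. sqnorm m (\<lambda>x. F n x + G n x - (f x + g x))) \<longlonglongrightarrow> 0"
  proof (rule tendsto_sandwich[OF _ _ tendsto_const])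
    show "(\<lambda>n. 2 * sqnorm m (\<lambda>x. F n x - f x) + 2 * sqnorm m (\<lambda>x. G n x - g x)) \<longlonglongrightarrow> 0"
      by (rule tendsto_eq_intros refl F(3) G(3))+ simp
    have "sqnorm m (\<lambda>x. F n x + G n x - (f x + g x)) \<le>
       2 * sqnorm m (\<lambda>x. F n x - f x) + 2 * sqnorm m (\<lambda>x. G n x - g x)" for n
      using sqnorm_add_le[OF L2_diff[OF F(1,2)] L2_diff[OF G(1,2)]]
      by (simp add: algebra_simps)
    then show "\<forall>\<^sub>F n in sequentially. sqnorm m (\<lambda>x. F n x + G n x - (f x + g x)) \<le>
       2 * sqnorm m (\<lambda>x. F n x - f x) + 2 * sqnorm m (\<lambda>x. G n x - g x)"
      by simp
  qed (auto)
qed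

lemma L2_conv_diff:
  assumes "L2_conv m F f" "L2_conv m G g"
  shows "L2_conv m (\<lambda>n x. F n x - G n x) (\<lambda>x. f x - g x)"
  using L2_conv_add[OF assms(1) L2_conv_cmult[OF assms(2), of "-1"]] by simp

lemma L2_conv_bounded_mult:
  assumes "L2_conv m F f" "b \<in> borel_measurable m" "\<And>x. \<bar>b x\<bar> \<le> B"
  shows "L2_conv m (\<lambda>n x. b x * F n x) (\<lambda>x. b x * f x)"
proof -
  note F = L2_convD[OF assms(1)]
  have bd: "(\<lambda>x. b x * g x) \<in> L2 m \<and> sqnorm m (\<lambda>x. b x * g x) \<le> B\<^sup>2 * sqnorm m g"
    if g: "g \<in> L2 m" for g
  proof -
    have le: "\<bar>b x * g x\<bar> \<le> \<bar>B * g x\<bar>" for x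
    proof -
      have "\<bar>b x\<bar> \<le> \<bar>B\<bar>" using assms(3)[of x] by linarith
      then show ?thesis by (simp add: abs_mult mult_right_mono)
    qed
    have m: "(\<lambda>x. b x * g x) \<in> borel_measurable m"
      using assms(2) g by (auto dest: L2_measurable)
    show ?thesis
      using L2_bound[OF L2_cmult[OF g, of B] m] sqnorm_mono[OF L2_cmult[OF g, of B] m] le
      by (simp add: power_mult_distrib)
  qed
  show ?thesis
    unfolding L2_conv_def
  proof (intro conjI allI)
    show "(\<lambda>x. b x * F n x) \<in> L2 m" "(\<lambda>x. b x * f x) \<in> L2 m" for n using bd F by auto
    show "(\<lambda>n. sqnorm m (\<lambda>x. b x * F n x - b x * f x)) \<longlonglongrightarrow> 0"
    proof (rule tendsto_sandwich[OF _ _ tendsto_const])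
      show "(\<lambda>n. B\<^sup>2 * sqnorm m (\<lambda>x. F n x - f x)) \<longlonglongrightarrow> 0"
        by (rule tendsto_eq_intros refl F(3))+ simp
      show "\<forall>\<^sub>F n in sequentially. sqnorm m (\<lambda>x. b x * F n x - b x * f x) \<le> B\<^sup>2 * sqnorm m (\<lambda>x. F n x - f x)"
        using bd[OF L2_diff[OF F(1,2)]] by (simp add: right_diff_distrib)
    qed auto
  qed
qed

lemma L2_conv_inner:
  assumes "L2_conv m F f" "L2_conv m G g"
  shows "(\<lambda>n. \<integral>x. F n x * G n x \<partial>m) \<longlonglongrightarrow> (\<integral>x. f x * g x \<partial>m)"
proof -
  note F = L2_convD[OF assms(1)] and G = L2_convD[OF assms(2)]
  let ?a = "\<lambda>n. sqrt (sqnorm m (\<lambda>x. F n x - f x))" and ?b = "\<lambda>n. sqrt (sqnorm m (\<lambda>x. G n x - g x))"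
  let ?r = "\<lambda>n. ?a n * ?b n + ?a n * sqrt (sqnorm m g) + sqrt (sqnorm m f) * ?b n"
  have a: "?a \<longlonglongrightarrow> 0" using tendsto_real_sqrt[OF F(3)] by simp
  have b: "?b \<longlonglongrightarrow> 0" using tendsto_real_sqrt[OF G(3)] by simp
  have "?r \<longlonglongrightarrow> 0 * 0 + 0 * sqrt (sqnorm m g) + sqrt (sqnorm m f) * 0"
    by (intro tendsto_intros a b)
  then have r: "?r \<longlonglongrightarrow> 0" by simp
  have "\<bar>(\<integral>x. F n x * G n x \<partial>m) - (\<integral>x. f x * g x \<partial>m)\<bar> \<le> ?r n" for n
  proof -
    have d: "(\<lambda>x. F n x - f x) \<in> L2 m" "(\<lambda>x. G n x - g x) \<in> L2 m"
      using F G by (auto intro: L2_diff)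
    have "(\<integral>x. F n x * G n x \<partial>m) - (\<integral>x. f x * g x \<partial>m) = (\<integral>x. F n x * G n x - f x * g x \<partial>m)"
      using F G by (intro Bochner_Integration.integral_diff[symmetric] L2_mult_integrable)
    also have "\<dots> = (\<integral>x. (F n x - f x) * (G n x - g x) + (F n x - f x) * g x + f x * (G n x - g x) \<partial>m)"
      by (intro arg_cong[of _ _ "integral\<^sup>L m"] ext) (simp add: algebra_simps)
    also have "\<dots> = (\<integral>x. (F n x - f x) * (G n x - g x) \<partial>m) + (\<integral>x. (F n x - f x) * g x \<partial>m)
        + (\<integral>x. f x * (G n x - g x) \<partial>m)"
      using L2_mult_integrable[OF d] L2_mult_integrable[OF d(1) G(2)] L2_mult_integrable[OF F(2) d(2)]
      by (simp del: right_diff_distrib left_diff_distrib)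
    finally show ?thesis
      using Cauchy_Schwarz_L2_abs[OF d] Cauchy_Schwarz_L2_abs[OF d(1) G(2)]
        Cauchy_Schwarz_L2_abs[OF F(2) d(2)] by linarith
  qed
  then have "(\<lambda>n. (\<integral>x. F n x * G n x \<partial>m) - (\<integral>x. f x * g x \<partial>m)) \<longlonglongrightarrow> 0"
    by (intro Lim_null_comparison[OF _ r]) auto
  then show ?thesis by (simp add: LIM_zero_iff)
qed

lemma L2_conv_sqnorm:
  assumes "L2_conv m F f"
  shows "(\<lambda>n. sqnorm m (F n)) \<longlonglongrightarrow> sqnorm m f"
  using L2_conv_inner[OF assms assms] by (simp add: power2_eq_square)

lemma L2_conv_imp_weak:
  assumes "L2_conv m F f"
  shows "L2_weak_conv m F f"
  unfolding L2_weak_conv_def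
  using L2_convD[OF assms] L2_conv_inner[OF assms L2_conv_const] by blast

lemma L2_conv_subseq:
  assumes "L2_conv m F f" "strict_mono r"
  shows "L2_conv m (\<lambda>n. F (r n)) f"
  using L2_convD[OF assms(1)] LIMSEQ_subseq_LIMSEQ[OF L2_convD(3)[OF assms(1)] assms(2)]
  by (auto simp: L2_conv_def comp_def)

text \<open>Passes from epsilon statements to sequences once and for all. \<open>P\<close> carries
  whatever else the approximant must satisfy and sees the tolerance, which is 1/(n+1) for the n-th
  member, so that energies can be controlled along with distances.\<close>

lemma L2_approx_sequence:
  assumes f: "f \<in> L2 m"
    and ex: "\<And>e::real. e > 0 \<Longrightarrow> \<exists>h\<in>L2 m. sqnorm m (\<lambda>x. h x - f x) < e \<and> P e h"
  obtains h where "L2_conv m h f" "\<And>n. P (inverse (real (Suc n))) (h n)"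
proof -
  have "\<forall>n::nat. \<exists>h. h \<in> L2 m \<and> sqnorm m (\<lambda>x. h x - f x) < inverse (real (Suc n)) \<and> P (inverse (real (Suc n))) h"
  proof
    fix n :: nat
    have "0 < inverse (real (Suc n))" by simp
    from ex[OF this] show "\<exists>h. h \<in> L2 m \<and> sqnorm m (\<lambda>x. h x - f x) < inverse (real (Suc n)) \<and> P (inverse (real (Suc n))) h"
      by blast
  qed
  from choice[OF this] obtain h where h: "\<forall>n. h n \<in> L2 m \<and> sqnorm m (\<lambda>x. h n x - f x) < inverse (real (Suc n)) \<and>
      P (inverse (real (Suc n))) (h n)" by blast
  have "(\<lambda>n. sqnorm m (\<lambda>x. h n x - f x)) \<longlonglongrightarrow> 0"
    by (rule tendsto_sandwich[OF _ _ tendsto_const LIMSEQ_inverse_real_of_nat])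
      (use h in \<open>auto intro!: always_eventually less_imp_le\<close>)
  then have "L2_conv m h f" using h f by (simp add: L2_conv_def)
  then show thesis using that h by blast
qed

section \<open>Dominated convergence, completeness and Mazur's lemma\<close>

lemma nn_integral_sq:
  "f \<in> L2 m \<Longrightarrow> (\<integral>\<^sup>+x. ennreal ((f x)\<^sup>2) \<partial>m) = ennreal (sqnorm m f)"
  by (intro nn_integral_eq_integral L2_integrable) auto

lemma L2_dominated_convergence:
  assumes "\<And>n. F n \<in> borel_measurable m" "f \<in> borel_measurable m" "g \<in> L2 m"
    and "AE x in m. (\<lambda>n. F n x) \<longlonglongrightarrow> f x" "\<And>n. AE x in m. \<bar>F n x\<bar> \<le> \<bar>g x\<bar>"
  shows "L2_conv m F f"
proof -
  have F: "F n \<in> L2 m" for n by (rule L2_bound[OF assms(3,1,5)])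
  have "AE x in m. \<forall>n. \<bar>F n x\<bar> \<le> \<bar>g x\<bar>" using assms(5) by (simp add: AE_all_countable)
  then have fg: "AE x in m. \<bar>f x\<bar> \<le> \<bar>g x\<bar>"
    using assms(4)
  proof eventually_elim
    case (elim x)
    then show ?case by (intro tendsto_upperbound[OF tendsto_rabs[OF elim(2)]]) auto
  qed
  have f: "f \<in> L2 m" by (rule L2_bound[OF assms(3,2) fg])
  have "(\<lambda>n. sqnorm m (\<lambda>x. F n x - f x)) \<longlonglongrightarrow> integral\<^sup>L m (\<lambda>x. 0)"
  proof (rule integral_dominated_convergence)
    \<comment> \<open>Both \<open>F n\<close> and its limit are dominated by g, so their difference
      is dominated by 2 g.\<close>
    show "integrable m (\<lambda>x. (2 * g x)\<^sup>2)"
      by (rule L2_integrable[OF L2_cmult[OF assms(3)]])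
    show "AE x in m. (\<lambda>n. (F n x - f x)\<^sup>2) \<longlonglongrightarrow> 0"
      using assms(4)
    proof eventually_elim
      case (elim x)
      have "(\<lambda>n. (F n x - f x)\<^sup>2) \<longlonglongrightarrow> (f x - f x)\<^sup>2" by (intro tendsto_intros elim)
      then show ?case by simp
    qed
    show "AE x in m. norm ((F n x - f x)\<^sup>2) \<le> (2 * g x)\<^sup>2" for n
      using assms(5)[of n] fg
    proof eventually_elim
      case (elim x)
      then have "\<bar>F n x - f x\<bar> \<le> \<bar>2 * g x\<bar>" by linarith
      then show ?case by (simp only: abs_le_square_iff) simp
    qed
  qed (use assms in auto)
  then show ?thesis using F f by (simp add: L2_conv_def)
qed

text \<open>The Riesz-Fischer argument. Along a subsequence whose successive squared distances are
  at most 4^-k, the squares weighted by 2^k still have a finite total integral, which gives a.e.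
  absolute convergence of the telescoping series; Fatou's lemma then compares the full sequence with
  the pointwise limit.\<close>

lemma L2_complete:
  assumes u: "\<And>n. u n \<in> L2 m"
    and C: "\<And>e::real. e > 0 \<Longrightarrow> \<exists>n0. \<forall>i\<ge>n0. \<forall>j\<ge>n0. sqnorm m (\<lambda>x. u i x - u j x) < e"
  obtains f where "L2_conv m u f"
proof -
  have "\<forall>k. \<exists>n0. \<forall>i\<ge>n0. \<forall>j\<ge>n0. sqnorm m (\<lambda>x. u i x - u j x) < (1/4)^k"
    by (intro allI C) simp
  then obtain N where N: "\<And>k i j. i \<ge> N k \<Longrightarrow> j \<ge> N k \<Longrightarrow> sqnorm m (\<lambda>x. u i x - u j x) < (1/4)^k"
    by metis
  \<comment> \<open>Partial sums make \<open>r\<close> monotone with \<open>N k \<le> r k\<close>,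
    and the summand \<open>k\<close> makes it unbounded.\<close>
  define r where "r k = (\<Sum>i\<le>k. N i) + k" for k
  have r: "N k \<le> r k" "r k \<ge> k" for k
    by (auto simp: r_def intro!: trans_le_add1 member_le_sum)
  have r_mono: "r k \<le> r l" if "k \<le> l" for k l
    unfolding r_def using that by (intro add_mono sum_mono2) auto
  define \<Delta> where "\<Delta> k x = u (r (Suc k)) x - u (r k) x" for k x
  have \<Delta>L2: "\<Delta> k \<in> L2 m" for k unfolding \<Delta>_def by (intro L2_diff u)
  have \<Delta>: "sqnorm m (\<Delta> k) \<le> (1/4)^k" for k
    unfolding \<Delta>_def using N[of k "r (Suc k)" "r k"] r(1)[of k] r_mono[of k "Suc k"] by force
  have "(\<integral>\<^sup>+x. (\<Sum>k. ennreal (2^k * (\<Delta> k x)\<^sup>2)) \<partial>m) = (\<Sum>k. \<integral>\<^sup>+x. ennreal (2^k * (\<Delta> k x)\<^sup>2) \<partial>m)"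
    using \<Delta>L2 by (intro nn_integral_suminf) (auto dest: L2_measurable)
  also have "\<dots> = (\<Sum>k. ennreal (2^k * sqnorm m (\<Delta> k)))"
  proof (intro suminf_cong)
    fix k
    show "(\<integral>\<^sup>+x. ennreal (2^k * (\<Delta> k x)\<^sup>2) \<partial>m) = ennreal (2^k * sqnorm m (\<Delta> k))"
      using L2_integrable[OF \<Delta>L2[of k]] by (subst nn_integral_eq_integral) auto
  qed
  also have "\<dots> \<le> (\<Sum>k. ennreal ((1/2)^k))"
  proof (intro suminf_le ennreal_leI)
    show "2 ^ k * sqnorm m (\<Delta> k) \<le> (1/2)^k" for k
      using mult_left_mono[OF \<Delta>[of k], of "2^k"] by (simp add: power_divide[symmetric] power_mult_distrib[symmetric])
  qed auto
  also have "\<dots> < \<infinity>"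
    by (subst suminf_ennreal2) (auto simp: summable_geometric)
  finally have "AE x in m. (\<Sum>k. ennreal (2^k * (\<Delta> k x)\<^sup>2)) \<noteq> \<infinity>"
    using \<Delta>L2 by (intro nn_integral_PInf_AE) (auto dest: L2_measurable)
  then have conv: "AE x in m. convergent (\<lambda>k. u (r k) x)"
  proof eventually_elim
    case (elim x)
    have s: "summable (\<lambda>k. 2^k * (\<Delta> k x)\<^sup>2)"
      using elim by (intro summable_suminf_not_top) auto
    have "summable (\<lambda>k. (2^k * (\<Delta> k x)\<^sup>2 + (1/2)^k))"
      by (intro summable_add s) (simp add: summable_geometric)
    then have "summable (\<lambda>k. \<Delta> k x)"
    proof (rule summable_comparison_test'[where N=0])
      fix k :: nat
      \<comment> \<open>The arithmetic-geometric mean inequality for 2^k \<Delta>^2 and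
        2^-k.\<close>
      have "2 * \<bar>\<Delta> k x\<bar> \<le> 2^k * (\<Delta> k x)\<^sup>2 + (1/2)^k"
      proof -
        have "0 \<le> (2^k * \<bar>\<Delta> k x\<bar> - 1)\<^sup>2" by simp
        also have "\<dots> = 2^k * (2^k * (\<Delta> k x)\<^sup>2 + (1/2)^k - 2 * \<bar>\<Delta> k x\<bar>)"
          by (simp add: power2_diff power_mult_distrib algebra_simps power2_eq_square power_divide)
        finally have "0 \<le> 2^k * (2^k * (\<Delta> k x)\<^sup>2 + (1/2)^k - 2 * \<bar>\<Delta> k x\<bar>)" .
        moreover have "(0::real) < 2^k" by simp
        ultimately show ?thesis by (metis diff_ge_0_iff_ge zero_le_mult_iff not_le)
      qed
      then show "norm (\<Delta> k x) \<le> 2^k * (\<Delta> k x)\<^sup>2 + (1/2)^k" by simp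
    qed
    then have "convergent (\<lambda>n. \<Sum>k<n. \<Delta> k x)" by (simp add: summable_iff_convergent)
    moreover have "(\<Sum>k<n. \<Delta> k x) = u (r n) x - u (r 0) x" for n
      unfolding \<Delta>_def by (rule sum_lessThan_telescope)
    ultimately have "convergent (\<lambda>n. u (r n) x - u (r 0) x)" by simp
    then have "convergent (\<lambda>n. (u (r n) x - u (r 0) x) + u (r 0) x)"
      by (intro convergent_add convergent_const)
    then show ?case by simp
  qed
  define f where "f x = lim (\<lambda>k. u (r k) x)" for x
  have fm: "f \<in> borel_measurable m"
    unfolding f_def using u by (intro borel_measurable_lim_metric) (auto dest: L2_measurable)
  have lim: "AE x in m. (\<lambda>k. u (r k) x) \<longlonglongrightarrow> f x"
    using conv by eventually_elim (simp add: f_def convergent_LIMSEQ_iff)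
  have Fatou: "(\<integral>\<^sup>+x. ennreal ((u n x - f x)\<^sup>2) \<partial>m) \<le> ennreal e"
    if le: "\<And>k. k \<ge> k0 \<Longrightarrow> sqnorm m (\<lambda>x. u n x - u (r k) x) \<le> e" for n k0 e
  proof -
    have "(\<integral>\<^sup>+x. ennreal ((u n x - f x)\<^sup>2) \<partial>m) =
        (\<integral>\<^sup>+x. liminf (\<lambda>k. ennreal ((u n x - u (r k) x)\<^sup>2)) \<partial>m)"
    proof (rule nn_integral_cong_AE)
      show "AE x in m. ennreal ((u n x - f x)\<^sup>2) = liminf (\<lambda>k. ennreal ((u n x - u (r k) x)\<^sup>2))"
        using lim
      proof eventually_elim
        case (elim x)
        have "(\<lambda>k. ennreal ((u n x - u (r k) x)\<^sup>2)) \<longlonglongrightarrow> ennreal ((u n x - f x)\<^sup>2)"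
          by (intro tendsto_intros elim)
        then show ?case by (intro lim_imp_Liminf[symmetric]) auto
      qed
    qed
    also have "\<dots> \<le> liminf (\<lambda>k. \<integral>\<^sup>+x. ennreal ((u n x - u (r k) x)\<^sup>2) \<partial>m)"
      using u by (intro nn_integral_liminf) (auto dest: L2_measurable)
    also have "\<dots> \<le> ennreal e"
    proof (rule Liminf_le)
      show "\<forall>\<^sub>F k in sequentially. (\<integral>\<^sup>+x. ennreal ((u n x - u (r k) x)\<^sup>2) \<partial>m) \<le> ennreal e"
        using eventually_ge_at_top[of k0]
        by eventually_elim (subst nn_integral_sq[OF L2_diff[OF u u]], simp add: le ennreal_leI)
    qed simp
    finally show ?thesis .
  qed
  \<comment> \<open>Square integrability of the limit is not known yet; the bound 1 = (1/4)^0 past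
    \<open>N 0\<close> supplies it for the difference.\<close>
  have diffL2: "(\<lambda>x. u n x - f x) \<in> L2 m" if "n \<ge> N 0" for n
  proof -
    have "(\<integral>\<^sup>+x. ennreal ((u n x - f x)\<^sup>2) \<partial>m) \<le> ennreal 1"
    proof (rule Fatou[of 0])
      show "sqnorm m (\<lambda>x. u n x - u (r k) x) \<le> 1" for k
        using N[of 0 n "r k"] that r(1)[of 0] r_mono[of 0 k] by force
    qed
    then have "(\<integral>\<^sup>+x. ennreal ((u n x - f x)\<^sup>2) \<partial>m) < \<infinity>" by (auto simp: le_less_trans)
    then show ?thesis
      using u[of n] fm by (auto simp: L2_def intro!: integrableI_bounded)
  qed
  have f: "f \<in> L2 m"
    using L2_diff[OF u[of "N 0"] diffL2[of "N 0"]] by simp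
  have "(\<lambda>n. sqnorm m (\<lambda>x. u n x - f x)) \<longlonglongrightarrow> 0"
  proof (rule LIMSEQ_I)
    fix e :: real assume "e > 0"
    then obtain n0 where n0: "\<And>i j. i \<ge> n0 \<Longrightarrow> j \<ge> n0 \<Longrightarrow> sqnorm m (\<lambda>x. u i x - u j x) < e/2"
      using C[of "e/2"] by auto
    have le: "sqnorm m (\<lambda>x. u n x - f x) \<le> e/2" if "n \<ge> n0" for n
    proof -
      have "ennreal (sqnorm m (\<lambda>x. u n x - f x)) \<le> ennreal (e/2)"
        unfolding nn_integral_sq[OF L2_diff[OF u f], symmetric]
      proof (rule Fatou[of n0])
        show "sqnorm m (\<lambda>x. u n x - u (r k) x) \<le> e/2" if "k \<ge> n0" for k
          using n0[of n "r k"] \<open>n \<ge> n0\<close> that r(2)[of k] by force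
      qed
      then show ?thesis using \<open>e > 0\<close> by (simp add: ennreal_le_iff)
    qed
    have "norm (sqnorm m (\<lambda>x. u n x - f x) - 0) < e" if "n \<ge> n0" for n
      using le[OF that] \<open>e > 0\<close> by simp
    then show "\<exists>no. \<forall>n\<ge>no. norm (sqnorm m (\<lambda>x. u n x - f x) - 0) < e" by blast
  qed
  then have "L2_conv m u f" using u f by (simp add: L2_conv_def)
  then show thesis by (rule that)
qed

text \<open>A minimising sequence for the distance from \<open>q\<close> to \<open>A\<close> is Cauchy by the parallelogram law;
  its limit \<open>w\<close> satisfies \<open>\<langle>v - w, w - q\<rangle> \<ge> 0\<close> for \<open>v \<in> A\<close>, which forces \<open>w = q\<close>
  in the weak limit.\<close>

lemma Mazur_L2:
  assumes A: "A \<subseteq> L2 m"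
    and conv: "\<And>u v s. u \<in> A \<Longrightarrow> v \<in> A \<Longrightarrow> 0 \<le> s \<Longrightarrow> s \<le> 1 \<Longrightarrow> (\<lambda>x. (1 - s) * u x + s * v x) \<in> A"
    and weak: "L2_weak_conv m b q" and bA: "\<And>n. n \<ge> n0 \<Longrightarrow> b n \<in> A"
    and e: "(e::real) > 0"
  obtains u where "u \<in> A" "sqnorm m (\<lambda>x. u x - q x) < e"
proof -
  have q: "q \<in> L2 m" and bL: "b n \<in> L2 m" for n using weak by (auto simp: L2_weak_conv_def)
  define D where "D u = sqnorm m (\<lambda>x. u x - q x)" for u
  define d where "d = Inf (D ` A)"
  have bdd: "bdd_below (D ` A)" by (rule bdd_belowI[of _ 0]) (auto simp: D_def)
  have ne: "A \<noteq> {}" using bA by auto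
  have dle: "d \<le> D u" if "u \<in> A" for u unfolding d_def using that bdd by (intro cInf_lower) auto
  have "\<forall>n. \<exists>u\<in>A. D u < d + 1 / Suc n"
  proof
    fix n :: nat
    show "\<exists>u\<in>A. D u < d + 1 / Suc n"
      using cInf_lessD[of "D ` A" "d + 1 / Suc n"] ne by (auto simp: d_def)
  qed
  then obtain w where w: "\<And>n. w n \<in> A" "\<And>n. D (w n) < d + 1 / Suc n" by metis
  have wL: "w n \<in> L2 m" for n using w A by auto
  have wq: "(\<lambda>x. w n x - q x) \<in> L2 m" for n by (intro L2_diff wL q)
  have cau: "sqnorm m (\<lambda>x. w i x - w j x) < 2 / Suc i + 2 / Suc j" for i j
  proof -
    have mid: "(\<lambda>x. (1 - 1/2) * w i x + (1/2) * w j x) \<in> A" by (intro conv w) auto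
    have "4 * d \<le> 4 * D (\<lambda>x. (1 - 1/2) * w i x + (1/2) * w j x)" using dle[OF mid] by simp
    also have "\<dots> = sqnorm m (\<lambda>x. 2 * (((1 - 1/2) * w i x + (1/2) * w j x) - q x))"
      unfolding D_def sqnorm_cmult[of m 2 "\<lambda>x. ((1 - 1/2) * w i x + (1/2) * w j x) - q x"] by simp
    also have "\<dots> = sqnorm m (\<lambda>x. (w i x - q x) + (w j x - q x))"
      by (intro arg_cong[of _ _ "integral\<^sup>L m"] ext arg_cong[of _ _ "\<lambda>t. t\<^sup>2"]) (simp add: field_simps)
    also have "\<dots> = 2 * D (w i) + 2 * D (w j) - sqnorm m (\<lambda>x. (w i x - q x) - (w j x - q x))"
      using sqnorm_parallelogram[OF wq[of i] wq[of j]] by (simp add: D_def)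
    finally have X: "4 * d \<le> 2 * D (w i) + 2 * D (w j) - sqnorm m (\<lambda>x. (w i x - q x) - (w j x - q x))" .
    have "sqnorm m (\<lambda>x. (w i x - q x) - (w j x - q x)) < 2 / Suc i + 2 / Suc j"
    proof -
      have "2 / real (Suc k) = 2 * (1 / real (Suc k))" for k by simp
      then show ?thesis using w(2)[of i] w(2)[of j] X by simp
    qed
    then show ?thesis by simp
  qed
  have small: "\<exists>n0. \<forall>n\<ge>n0. 2 / real (Suc n) < t" if "t > 0" for t
  proof -
    have "(\<lambda>n. 2 * inverse (real (Suc n))) \<longlonglongrightarrow> 2 * 0"
      by (intro tendsto_mult tendsto_const LIMSEQ_inverse_real_of_nat)
    then have "\<forall>\<^sub>F n in sequentially. 2 * inverse (real (Suc n)) < t"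
      using that by (intro order_tendstoD) auto
    then show ?thesis by (simp add: eventually_sequentially divide_inverse)
  qed
  obtain W where W: "L2_conv m w W"
  proof (rule L2_complete[OF wL])
    fix t :: real assume "t > 0"
    then obtain n0 where "\<forall>n\<ge>n0. 2 / real (Suc n) < t/2" using small[of "t/2"] by auto
    then show "\<exists>n0. \<forall>i\<ge>n0. \<forall>j\<ge>n0. sqnorm m (\<lambda>x. w i x - w j x) < t"
      using cau by (intro exI[of _ n0]) (smt (verit) field_sum_of_halves)
  qed
  have WL: "W \<in> L2 m" using L2_convD[OF W] by simp
  have Wq: "L2_conv m (\<lambda>n x. w n x - q x) (\<lambda>x. W x - q x)"
    by (intro L2_conv_diff W L2_conv_const q)
  have DW: "D W \<le> d"
  proof (rule LIMSEQ_le)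
    show "(\<lambda>n. D (w n)) \<longlonglongrightarrow> D W" unfolding D_def by (rule L2_conv_sqnorm[OF Wq])
    have "(\<lambda>n. d + inverse (real (Suc n))) \<longlonglongrightarrow> d + 0"
      by (intro tendsto_add tendsto_const LIMSEQ_inverse_real_of_nat)
    then show "(\<lambda>n. d + inverse (real (Suc n))) \<longlonglongrightarrow> d" by simp
    show "\<exists>N. \<forall>n\<ge>N. D (w n) \<le> d + inverse (real (Suc n))"
      using w(2) by (intro exI[of _ 0]) (auto simp: divide_inverse intro: less_imp_le)
  qed
  have WqL: "(\<lambda>x. W x - q x) \<in> L2 m" by (intro L2_diff WL q)
  have var: "0 \<le> (\<integral>x. (W x - q x) * (v x - W x) \<partial>m)" if v: "v \<in> A" for v
  proof (rule ccontr)
    let ?B = "\<integral>x. (W x - q x) * (v x - W x) \<partial>m"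
    assume "\<not> 0 \<le> ?B"
    then have B: "?B < 0" by simp
    have vL: "v \<in> L2 m" using v A by auto
    have vW: "(\<lambda>x. v x - W x) \<in> L2 m" by (intro L2_diff vL WL)
    have ineq: "d \<le> D W + 2 * s * ?B + s\<^sup>2 * sqnorm m (\<lambda>x. v x - W x)"
      if s: "0 \<le> s" "s \<le> 1" for s
    proof -
      \<comment> \<open>\<open>W\<close> need not lie in \<open>A\<close>, so minimality is applied
        to the combinations of \<open>w n\<close> with \<open>v\<close> and carried over to the
        limit.\<close>
      have lim: "L2_conv m (\<lambda>n x. ((1 - s) * w n x + s * v x) - q x) (\<lambda>x. ((1 - s) * W x + s * v x) - q x)"
        by (intro L2_conv_diff L2_conv_add L2_conv_cmult W L2_conv_const vL q)
      have "d \<le> D (\<lambda>x. (1 - s) * W x + s * v x)"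
        unfolding D_def
      proof (rule LIMSEQ_le_const[OF L2_conv_sqnorm[OF lim]])
        show "\<exists>N. \<forall>n\<ge>N. d \<le> sqnorm m (\<lambda>x. ((1 - s) * w n x + s * v x) - q x)"
          using dle[OF conv[OF w(1) v s]] by (auto simp: D_def)
      qed
      also have "\<dots> = sqnorm m (\<lambda>x. 1 * (W x - q x) + s * (v x - W x))"
        unfolding D_def by (simp add: algebra_simps)
      also have "\<dots> = D W + 2 * s * ?B + s\<^sup>2 * sqnorm m (\<lambda>x. v x - W x)"
        by (subst sqnorm_lincomb[OF WqL vW]) (simp add: D_def)
      finally show ?thesis .
    qed
    define V where "V = sqnorm m (\<lambda>x. v x - W x)"
    have V: "0 \<le> V" unfolding V_def by simp
    \<comment> \<open>Chosen so that \<open>s * V \<le> - ?B\<close>: the first-order gain then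
      outweighs the quadratic term.\<close>
    define s where "s = min 1 (- ?B / (V + 1))"
    have s: "0 < s" "s \<le> 1" unfolding s_def using B V by (auto simp: divide_neg_pos)
    have "s * V \<le> s * (V + 1)" using s by simp
    also have "\<dots> \<le> - ?B / (V + 1) * (V + 1)" unfolding s_def using V by (intro mult_right_mono) auto
    also have "\<dots> = - ?B" using V by simp
    finally have "s * V \<le> - ?B" .
    then have "0 \<le> s * (- ?B - s * V)" using s by simp
    moreover have "0 \<le> 2 * s * ?B + s\<^sup>2 * V" using ineq[of s] s DW by (simp add: V_def)
    ultimately have "0 \<le> s * ?B" by (simp add: power2_eq_square algebra_simps)
    then show False using s B by (simp add: zero_le_mult_iff)
  qed
  \<comment> \<open>The variational inequality is tested with \<open>v = b n\<close>; weak
    convergence against the fixed function W - q turns it into \<open>0 \<le> - D W\<close>.\<close>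
  have lim0: "(\<lambda>n. (\<integral>x. b n x * (W x - q x) \<partial>m) - (\<integral>x. W x * (W x - q x) \<partial>m)) \<longlonglongrightarrow>
      (\<integral>x. q x * (W x - q x) \<partial>m) - (\<integral>x. W x * (W x - q x) \<partial>m)"
    using weak WqL by (intro tendsto_intros) (auto simp: L2_weak_conv_def)
  have "0 \<le> (\<integral>x. q x * (W x - q x) \<partial>m) - (\<integral>x. W x * (W x - q x) \<partial>m)"
  proof (rule LIMSEQ_le_const[OF lim0])
    have "0 \<le> (\<integral>x. b n x * (W x - q x) \<partial>m) - (\<integral>x. W x * (W x - q x) \<partial>m)" if "n \<ge> n0" for n
    proof -
      have "0 \<le> (\<integral>x. (W x - q x) * (b n x - W x) \<partial>m)" by (rule var[OF bA[OF that]])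
      also have "\<dots> = (\<integral>x. b n x * (W x - q x) - W x * (W x - q x) \<partial>m)"
        by (intro arg_cong[of _ _ "integral\<^sup>L m"] ext) (simp add: algebra_simps)
      also have "\<dots> = (\<integral>x. b n x * (W x - q x) \<partial>m) - (\<integral>x. W x * (W x - q x) \<partial>m)"
        using bL WL WqL by (intro Bochner_Integration.integral_diff L2_mult_integrable)
      finally show ?thesis .
    qed
    then show "\<exists>N. \<forall>n\<ge>N. 0 \<le> (\<integral>x. b n x * (W x - q x) \<partial>m) - (\<integral>x. W x * (W x - q x) \<partial>m)" by blast
  qed
  also have "\<dots> = (\<integral>x. q x * (W x - q x) - W x * (W x - q x) \<partial>m)"
    using q WL WqL by (intro Bochner_Integration.integral_diff[symmetric] L2_mult_integrable)
  also have "\<dots> = (\<integral>x. - (W x - q x)\<^sup>2 \<partial>m)"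
    by (intro arg_cong[of _ _ "integral\<^sup>L m"] ext) (simp add: algebra_simps power2_eq_square)
  finally have "D W \<le> 0" by (simp add: D_def)
  moreover have "(\<lambda>n. D (w n)) \<longlonglongrightarrow> D W" unfolding D_def by (rule L2_conv_sqnorm[OF Wq])
  moreover have "D W < e" using \<open>D W \<le> 0\<close> e by linarith
  ultimately have "\<forall>\<^sub>F n in sequentially. D (w n) < e" by (intro order_tendstoD(2))
  then obtain n where "D (w n) < e" by (auto simp: eventually_sequentially)
  then show thesis using that[of "w n"] w(1) by (simp add: D_def)
qed

section \<open>The slope of a Lipschitz function\<close>

lemma slope_nonneg [simp]: "0 \<le> slope f x"
  by (simp add: slope_def)

lemma Limsup_quotient_le:
  fixes f :: "'a::metric_space \<Rightarrow> real"
  assumes "\<forall>\<^sub>F y in at x. \<bar>f y - f x\<bar> \<le> C * dist x y"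
  shows "Limsup (at x) (\<lambda>y. ennreal (\<bar>f y - f x\<bar> / dist x y)) \<le> ennreal C"
proof (rule Limsup_bounded)
  show "\<forall>\<^sub>F y in at x. ennreal (\<bar>f y - f x\<bar> / dist x y) \<le> ennreal C"
    using assms eventually_neq_at_within[of x x UNIV]
    by eventually_elim (auto intro!: ennreal_leI simp: divide_le_eq)
qed

lemma slope_le:
  fixes f :: "'a::metric_space \<Rightarrow> real"
  assumes "\<forall>\<^sub>F y in at x. \<bar>f y - f x\<bar> \<le> C * dist x y" "0 \<le> C"
  shows "slope f x \<le> C"
  using enn2real_mono[OF Limsup_quotient_le[OF assms(1)]] assms(2) by (simp add: slope_def)

lemma slope_leI:
  fixes f :: "'a::metric_space \<Rightarrow> real"
  assumes "\<And>e. e > 0 \<Longrightarrow> \<forall>\<^sub>F y in at x. \<bar>f y - f x\<bar> \<le> (C + e) * dist x y" "0 \<le> C"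
  shows "slope f x \<le> C"
proof (rule field_le_epsilon)
  fix e :: real assume "e > 0"
  then show "slope f x \<le> C + e" using assms(2) by (intro slope_le[OF assms(1)]) auto
qed

lemma slope_eq_0:
  fixes f :: "'a::metric_space \<Rightarrow> real"
  assumes "\<forall>\<^sub>F y in at x. f y = f x"
  shows "slope f x = 0"
proof -
  have "slope f x \<le> 0"
    using assms by (intro slope_le) (auto elim: eventually_mono)
  then show ?thesis using slope_nonneg[of f x] by linarith
qed

lemma slope_eq_0_open:
  fixes f :: "'a::metric_space \<Rightarrow> real"
  assumes "open U" "x \<in> U" "\<And>y. y \<in> U \<Longrightarrow> f y = c"
  shows "slope f x = 0"
proof (rule slope_eq_0)
  show "\<forall>\<^sub>F y in at x. f y = f x"
    unfolding eventually_at_topological using assms by (intro exI[of _ U]) auto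
qed

lemma lipschitz_onD_real:
  fixes f :: "'a::metric_space \<Rightarrow> real"
  assumes "L-lipschitz_on UNIV f"
  shows "\<bar>f y - f x\<bar> \<le> L * dist x y"
  using lipschitz_onD[OF assms, of y x] by (simp add: dist_real_def dist_commute)

lemma lipschitz_onI_real:
  fixes f :: "'a::metric_space \<Rightarrow> real"
  assumes "\<And>x y. \<bar>f x - f y\<bar> \<le> L * dist x y" "0 \<le> L"
  shows "L-lipschitz_on UNIV f"
proof (rule lipschitz_onI)
  show "dist (f x) (f y) \<le> L * dist x y" for x y
    using assms(1)[of x y] by (simp add: dist_real_def dist_commute)
qed (rule assms)

lemma slope_le_lipschitz:
  fixes f :: "'a::metric_space \<Rightarrow> real"
  assumes "L-lipschitz_on UNIV f"
  shows "slope f x \<le> L"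
  by (intro slope_le always_eventually allI lipschitz_onD_real[OF assms] lipschitz_on_nonneg[OF assms])

text \<open>\<open>enn2real\<close> sends an infinite upper limit to 0, in which case a small
  \<open>slope\<close> would say nothing about difference quotients; the Lipschitz bound excludes
  this.\<close>

lemma slope_less_imp_eventually:
  fixes f :: "'a::metric_space \<Rightarrow> real"
  assumes "L-lipschitz_on UNIV f" "slope f x < a"
  shows "\<forall>\<^sub>F y in at x. \<bar>f y - f x\<bar> \<le> a * dist x y"
proof -
  let ?l = "Limsup (at x) (\<lambda>y. ennreal (\<bar>f y - f x\<bar> / dist x y))"
  have "?l \<le> ennreal L"
    by (intro Limsup_quotient_le always_eventually allI lipschitz_onD_real[OF assms(1)])
  then have "?l < top" by (auto simp: le_less_trans)
  then have "?l = ennreal (slope f x)" by (simp add: slope_def)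
  also have "\<dots> < ennreal a" using assms(2) by (simp add: ennreal_less_iff)
  finally have "\<forall>\<^sub>F y in at x. ennreal (\<bar>f y - f x\<bar> / dist x y) < ennreal a"
    by (rule Limsup_lessD)
  then show ?thesis
    using eventually_neq_at_within[of x x UNIV]
    by eventually_elim (auto simp: ennreal_less_iff divide_less_eq)
qed

lemma slope_comparison:
  fixes f h :: "'a::metric_space \<Rightarrow> real"
  assumes "L-lipschitz_on UNIV f" "\<And>y. \<bar>h y - h x\<bar> \<le> C * \<bar>f y - f x\<bar>" "0 \<le> C"
  shows "slope h x \<le> C * slope f x"
proof (rule slope_leI)
  fix e :: real assume "e > 0"
  \<comment> \<open>The summand 1 keeps the quotient meaningful for \<open>C = 0\<close> and still
    gives \<open>C * d \<le> e\<close>.\<close>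
  define d where "d = e / (C + 1)"
  have d: "d > 0" "C * d \<le> e" using \<open>e > 0\<close> assms(3) by (auto simp: d_def field_simps)
  have "\<forall>\<^sub>F y in at x. \<bar>f y - f x\<bar> \<le> (slope f x + d) * dist x y"
    using d by (intro slope_less_imp_eventually[OF assms(1)]) auto
  then show "\<forall>\<^sub>F y in at x. \<bar>h y - h x\<bar> \<le> (C * slope f x + e) * dist x y"
  proof eventually_elim
    case (elim y)
    have "\<bar>h y - h x\<bar> \<le> C * \<bar>f y - f x\<bar>" by (rule assms)
    also have "\<dots> \<le> C * ((slope f x + d) * dist x y)" by (intro mult_left_mono elim assms)
    also have "\<dots> = (C * slope f x + C * d) * dist x y" by (simp add: algebra_simps)
    also have "\<dots> \<le> (C * slope f x + e) * dist x y" using d by (intro mult_right_mono) auto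
    finally show ?case .
  qed
qed (use assms in auto)

text \<open>A Leibniz rule for interpolations, with the increment grouped so that the increment of
  \<eta> multiplies only a - b. When a and b approximate functions that agree where \<eta> varies,
  this last term is negligible, and that is what makes gluing possible.\<close>

lemma slope_cut_le:
  fixes a b \<eta> :: "'a::metric_space \<Rightarrow> real"
  assumes a: "La-lipschitz_on UNIV a" and b: "Lb-lipschitz_on UNIV b" and \<eta>: "L-lipschitz_on UNIV \<eta>"
    and 01: "0 \<le> \<eta> x" "\<eta> x \<le> 1"
  shows "slope (\<lambda>y. \<eta> y * a y + (1 - \<eta> y) * b y) x \<le>
    \<eta> x * slope a x + (1 - \<eta> x) * slope b x + slope \<eta> x * \<bar>a x - b x\<bar>"
    (is "slope ?k x \<le> ?C")
proof (rule slope_leI)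
  show C: "0 \<le> ?C" using 01 by auto
  fix e :: real assume "e > 0"
  \<comment> \<open>Replacing every slope by itself plus d, and |a x - b x| by itself plus d,
    changes the bound by d (S - 1) + d^2, which is at most d S \<le> e/2 because d \<le> 1.\<close>
  define S where "S = 2 + slope \<eta> x + \<bar>a x - b x\<bar>"
  have S: "S \<ge> 2" unfolding S_def using slope_nonneg[of \<eta> x] by linarith
  define d where "d = min 1 (e / (2 * S))"
  have d: "d > 0" "d \<le> 1" unfolding d_def using \<open>e > 0\<close> S by auto
  have "d * S \<le> e / (2 * S) * S" unfolding d_def using S by (intro mult_right_mono) auto
  then have "d * S \<le> e / 2" using S by simp
  moreover have "d * d \<le> d" using d by (simp add: mult_left_le)
  ultimately have "d * S - d + d * d \<le> e" using \<open>e > 0\<close> by linarith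
  moreover have "\<eta> x * (slope a x + d) + (1 - \<eta> x) * (slope b x + d) + (slope \<eta> x + d) * (\<bar>a x - b x\<bar> + d) =
      ?C + (d * S - d + d * d)"
    unfolding S_def by algebra
  ultimately have dC: "\<eta> x * (slope a x + d) + (1 - \<eta> x) * (slope b x + d) + (slope \<eta> x + d) * (\<bar>a x - b x\<bar> + d) \<le> ?C + e"
    by linarith
  have "continuous_on UNIV (\<lambda>y. \<bar>a y - b y\<bar>)"
    using lipschitz_on_continuous_on[OF a] lipschitz_on_continuous_on[OF b] by (intro continuous_intros)
  then have "((\<lambda>y. \<bar>a y - b y\<bar>) \<longlongrightarrow> \<bar>a x - b x\<bar>) (at x)" by (simp add: continuous_on_def)
  from order_tendstoD(2)[OF this, of "\<bar>a x - b x\<bar> + d"]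
  have "\<forall>\<^sub>F y in at x. \<bar>a y - b y\<bar> < \<bar>a x - b x\<bar> + d" using d by simp
  moreover have "\<forall>\<^sub>F y in at x. \<bar>a y - a x\<bar> \<le> (slope a x + d) * dist x y"
    "\<forall>\<^sub>F y in at x. \<bar>b y - b x\<bar> \<le> (slope b x + d) * dist x y"
    "\<forall>\<^sub>F y in at x. \<bar>\<eta> y - \<eta> x\<bar> \<le> (slope \<eta> x + d) * dist x y"
    using d(1) by (intro slope_less_imp_eventually[OF a] slope_less_imp_eventually[OF b]
        slope_less_imp_eventually[OF \<eta>], simp)+
  ultimately show "\<forall>\<^sub>F y in at x. \<bar>?k y - ?k x\<bar> \<le> (?C + e) * dist x y"
  proof eventually_elim
    case (elim y)
    have "?k y - ?k x = \<eta> x * (a y - a x) + (1 - \<eta> x) * (b y - b x) + (\<eta> y - \<eta> x) * (a y - b y)"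
      by (simp add: algebra_simps)
    also have "\<bar>\<dots>\<bar> \<le> \<bar>\<eta> x * (a y - a x)\<bar> + \<bar>(1 - \<eta> x) * (b y - b x)\<bar> + \<bar>(\<eta> y - \<eta> x) * (a y - b y)\<bar>"
      by linarith
    also have "\<dots> = \<eta> x * \<bar>a y - a x\<bar> + (1 - \<eta> x) * \<bar>b y - b x\<bar> + \<bar>\<eta> y - \<eta> x\<bar> * \<bar>a y - b y\<bar>"
      using 01 by (simp add: abs_mult)
    also have "\<dots> \<le> \<eta> x * ((slope a x + d) * dist x y) + (1 - \<eta> x) * ((slope b x + d) * dist x y)
        + ((slope \<eta> x + d) * dist x y) * (\<bar>a x - b x\<bar> + d)"
      using elim 01 d by (intro add_mono mult_left_mono mult_mono) auto
    also have "\<dots> = (\<eta> x * (slope a x + d) + (1 - \<eta> x) * (slope b x + d) + (slope \<eta> x + d) * (\<bar>a x - b x\<bar> + d)) * dist x y"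
      by (simp add: algebra_simps)
    also have "\<dots> \<le> (?C + e) * dist x y" by (intro mult_right_mono dC) auto
    finally show ?case .
  qed
qed

text \<open>Interpolation with a constant cutoff, whose slope is 0.\<close>

lemma slope_convex_le:
  fixes a b :: "'a::metric_space \<Rightarrow> real"
  assumes "La-lipschitz_on UNIV a" "Lb-lipschitz_on UNIV b" "0 \<le> s" "s \<le> 1"
  shows "slope (\<lambda>y. (1 - s) * a y + s * b y) x \<le> (1 - s) * slope a x + s * slope b x"
proof -
  have "0-lipschitz_on UNIV (\<lambda>y::'a. 1 - s)" by (rule lipschitz_intros)
  from slope_cut_le[OF assms(1,2) this, of x] show ?thesis
    using assms slope_eq_0[of "\<lambda>y::'a. 1 - s" x] by simp
qed

text \<open>The upper limit is the infimum over n of suprema over punctured balls of radius 1/(n+1).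
  For fixed y the quotient is continuous in x away from y, so each superlevel set of such a supremum
  is a union of open sets.\<close>

lemma borel_measurable_slope:
  fixes f :: "'a::metric_space \<Rightarrow> real"
  assumes f: "continuous_on UNIV f"
  shows "slope f \<in> borel_measurable borel"
proof -
  define G where "G n x = (SUP y\<in>ball x (1 / Suc n) - {x}. ennreal (\<bar>f y - f x\<bar> / dist x y))" for n x
  have "{x. a < G n x} \<in> sets borel" for n a
  proof -
    have "open {x. x \<in> ball y (1 / Suc n) - {y} \<and> a < ennreal (\<bar>f y - f x\<bar> / dist x y)}" for y
    proof -
      have "continuous_on (ball y (1 / Suc n) - {y}) (\<lambda>x. ennreal (\<bar>f y - f x\<bar> / dist x y))"
        by (intro continuous_on_ennreal continuous_intros continuous_on_subset[OF f]) auto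
      then have "open ((\<lambda>x. ennreal (\<bar>f y - f x\<bar> / dist x y)) -` {a<..} \<inter> (ball y (1 / Suc n) - {y}))"
        by (subst Int_commute) (intro continuous_open_preimage, auto)
      then show ?thesis by (simp add: vimage_def Int_def conj_commute)
    qed
    moreover have "{x. a < G n x} =
        (\<Union>y. {x. x \<in> ball y (1 / Suc n) - {y} \<and> a < ennreal (\<bar>f y - f x\<bar> / dist x y)})"
      by (auto simp: G_def less_SUP_iff dist_commute)
    ultimately show ?thesis by (auto intro!: borel_open open_UN)
  qed
  then have G: "G n \<in> borel_measurable borel" for n
    by (intro borel_measurableI_greater) auto
  have "Limsup (at x) (\<lambda>y. ennreal (\<bar>f y - f x\<bar> / dist x y)) = (INF n. G n x)" (is "?l = _") for x
  proof (rule antisym)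
    show "?l \<le> (INF n. G n x)"
    proof (rule INF_greatest)
      fix n
      have "\<forall>\<^sub>F y in at x. y \<in> ball x (1 / Suc n) - {x}"
        unfolding eventually_at by (intro exI[of _ "1 / Suc n"]) (auto simp: dist_commute)
      then show "?l \<le> G n x"
        unfolding G_def by (intro Limsup_bounded) (auto elim!: eventually_mono intro: SUP_upper)
    qed
    show "(INF n. G n x) \<le> ?l"
      unfolding Limsup_def
    proof (rule INF_greatest)
      fix P assume "P \<in> {P. eventually P (at x)}"
      then obtain d where d: "d > 0" "\<And>y. y \<noteq> x \<Longrightarrow> dist y x < d \<Longrightarrow> P y"
        by (auto simp: eventually_at)
      obtain n where n: "1 / Suc n < d" using d(1) nat_approx_posE by blast
      have "G n x \<le> (SUP y\<in>Collect P. ennreal (\<bar>f y - f x\<bar> / dist x y))"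
        unfolding G_def using d n by (intro SUP_subset_mono) (auto simp: dist_commute)
      then show "(INF n. G n x) \<le> (SUP y\<in>Collect P. ennreal (\<bar>f y - f x\<bar> / dist x y))"
        by (rule INF_lower2[OF UNIV_I])
    qed
  qed
  then have "slope f = (\<lambda>x. enn2real (INF n. G n x))" by (auto simp: slope_def)
  also have "\<dots> \<in> borel_measurable borel" using G by measurable
  finally show ?thesis .
qed

lemma slope_diff_const: "slope (\<lambda>y. c - f y) x = slope f x"
proof -
  have "\<bar>(c - f y) - (c - f x)\<bar> = \<bar>f y - f x\<bar>" for y by linarith
  then show ?thesis unfolding slope_def by presburger
qed

section \<open>Lipschitz functions with bounded support\<close>

lemma Lip_bsE:
  assumes "f \<in> Lip_bs"
  obtains L where "L-lipschitz_on UNIV f" "bounded {x. f x \<noteq> 0}"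
  using assms by (auto simp: Lip_bs_def)

lemma Lip_bs_continuous: "f \<in> Lip_bs \<Longrightarrow> continuous_on UNIV f"
  by (auto simp: Lip_bs_def intro: lipschitz_on_continuous_on)

lemma borel_measurable_slope_Lip_bs: "f \<in> Lip_bs \<Longrightarrow> slope f \<in> borel_measurable borel"
  by (intro borel_measurable_slope Lip_bs_continuous)

lemma Lip_bs_bounded:
  fixes f :: "'a::metric_space \<Rightarrow> real"
  assumes "f \<in> Lip_bs"
  obtains B where "\<And>x. \<bar>f x\<bar> \<le> B" "B \<ge> 0"
proof -
  obtain L where L: "L-lipschitz_on UNIV f" and b: "bounded {x. f x \<noteq> 0}"
    using assms by (rule Lip_bsE)
  obtain c r where r: "\<And>x. f x \<noteq> 0 \<Longrightarrow> dist c x \<le> r"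
    using b by (auto simp: bounded_def)
  have L0: "L \<ge> 0" using L by (rule lipschitz_on_nonneg)
  have "\<bar>f x\<bar> \<le> \<bar>f c\<bar> + L * \<bar>r\<bar>" for x
  proof (cases "f x = 0")
    case True then show ?thesis using L0 by simp
  next
    case False
    have "\<bar>f x - f c\<bar> \<le> L * dist c x" by (rule lipschitz_onD_real[OF L])
    also have "\<dots> \<le> L * \<bar>r\<bar>" using r[OF False] L0 by (intro mult_left_mono) auto
    finally show ?thesis by linarith
  qed
  then show thesis using that[of "\<bar>f c\<bar> + L * \<bar>r\<bar>"] L0 by auto
qed

lemma Lip_bs_zero: "(\<lambda>x. 0) \<in> Lip_bs"
  by (auto simp: Lip_bs_def intro!: exI[of _ 0] lipschitz_intros)

lemma Lip_bs_comp:
  fixes f :: "'a::metric_space \<Rightarrow> real"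
  assumes "f \<in> Lip_bs" "\<And>x y. \<bar>h y - h x\<bar> \<le> C * \<bar>f y - f x\<bar>" "0 \<le> C" "\<And>x. f x = 0 \<Longrightarrow> h x = 0"
  shows "h \<in> Lip_bs"
proof -
  obtain L where L: "L-lipschitz_on UNIV f" and b: "bounded {x. f x \<noteq> 0}"
    using assms(1) by (rule Lip_bsE)
  have "(C * L)-lipschitz_on UNIV h"
  proof (rule lipschitz_onI_real)
    fix y x
    have "\<bar>h y - h x\<bar> \<le> C * \<bar>f y - f x\<bar>" by (rule assms)
    also have "\<dots> \<le> C * (L * dist x y)" by (intro mult_left_mono lipschitz_onD_real[OF L] assms)
    finally show "\<bar>h y - h x\<bar> \<le> C * L * dist y x" by (simp add: mult.assoc dist_commute)
  qed (use lipschitz_on_nonneg[OF L] assms in auto)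
  moreover have "bounded {x. h x \<noteq> 0}" using b by (rule bounded_subset) (use assms in auto)
  ultimately show ?thesis by (auto simp: Lip_bs_def)
qed

lemma Lip_bs_cmult: "f \<in> Lip_bs \<Longrightarrow> (\<lambda>x. c * f x) \<in> Lip_bs"
proof (rule Lip_bs_comp)
  show "\<bar>c * f y - c * f x\<bar> \<le> \<bar>c\<bar> * \<bar>f y - f x\<bar>" for x y
    by (simp flip: abs_mult right_diff_distrib)
qed auto

lemma Lip_bs_add:
  assumes "f \<in> Lip_bs" "g \<in> Lip_bs"
  shows "(\<lambda>x. f x + g x) \<in> Lip_bs"
proof -
  obtain L M where "L-lipschitz_on UNIV f" "M-lipschitz_on UNIV g" and b: "bounded {x. f x \<noteq> 0}" "bounded {x. g x \<noteq> 0}"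
    using assms by (auto simp: Lip_bs_def)
  then have "(L + M)-lipschitz_on UNIV (\<lambda>x. f x + g x)" by (intro lipschitz_intros)
  moreover have "bounded {x. f x + g x \<noteq> 0}"
    by (rule bounded_subset[of "{x. f x \<noteq> 0} \<union> {x. g x \<noteq> 0}"]) (use b in auto)
  ultimately show ?thesis by (auto simp: Lip_bs_def)
qed

lemma Lip_bs_bounded_mult:
  fixes f \<eta> :: "'a::metric_space \<Rightarrow> real"
  assumes f: "f \<in> Lip_bs" and \<eta>: "L-lipschitz_on UNIV \<eta>" "\<And>x. \<bar>\<eta> x\<bar> \<le> B"
  shows "(\<lambda>x. \<eta> x * f x) \<in> Lip_bs"
proof -
  obtain M where M: "M-lipschitz_on UNIV f" and b: "bounded {x. f x \<noteq> 0}"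
    using f by (rule Lip_bsE)
  obtain A where A: "\<And>x. \<bar>f x\<bar> \<le> A" "A \<ge> 0" using f by (rule Lip_bs_bounded) blast
  have L0: "L \<ge> 0" "M \<ge> 0" using \<eta> M lipschitz_on_nonneg by auto
  have B0: "B \<ge> 0" using \<eta>(2)[of undefined] by linarith
  have "(B * M + A * L)-lipschitz_on UNIV (\<lambda>x. \<eta> x * f x)"
  proof (rule lipschitz_onI_real)
    fix y x
    have "\<eta> y * f y - \<eta> x * f x = \<eta> y * (f y - f x) + f x * (\<eta> y - \<eta> x)" by (simp add: algebra_simps)
    also have "\<bar>\<dots>\<bar> \<le> \<bar>\<eta> y\<bar> * \<bar>f y - f x\<bar> + \<bar>f x\<bar> * \<bar>\<eta> y - \<eta> x\<bar>"
      by (simp add: abs_mult[symmetric] abs_triangle_ineq)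
    also have "\<dots> \<le> B * (M * dist x y) + A * (L * dist x y)"
      using A \<eta> L0 B0 lipschitz_onD_real[OF M] lipschitz_onD_real[OF \<eta>(1)] by (intro add_mono mult_mono) auto
    finally show "\<bar>\<eta> y * f y - \<eta> x * f x\<bar> \<le> (B * M + A * L) * dist y x"
      by (simp add: algebra_simps dist_commute)
  qed (use A B0 L0 in auto)
  moreover have "bounded {x. \<eta> x * f x \<noteq> 0}" using b by (rule bounded_subset) auto
  ultimately show ?thesis by (auto simp: Lip_bs_def)
qed

lemma Lip_bs_cut:
  fixes a b \<eta> :: "'a::metric_space \<Rightarrow> real"
  assumes "a \<in> Lip_bs" "b \<in> Lip_bs" "L-lipschitz_on UNIV \<eta>" "\<And>x. 0 \<le> \<eta> x" "\<And>x. \<eta> x \<le> 1"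
  shows "(\<lambda>x. \<eta> x * a x + (1 - \<eta> x) * b x) \<in> Lip_bs"
proof -
  have "L-lipschitz_on UNIV (\<lambda>x. 1 - \<eta> x)"
    using lipschitz_on_diff[OF lipschitz_on_constant[of UNIV 1] assms(3)] by simp
  then show ?thesis
    using assms by (intro Lip_bs_add Lip_bs_bounded_mult[where B=1] assms) auto
qed

lemma slope_eq_0_outside:
  fixes f :: "'a::metric_space \<Rightarrow> real"
  assumes "closed F" "x \<notin> F" "\<And>y. y \<notin> F \<Longrightarrow> f y = c"
  shows "slope f x = 0"
proof (rule slope_eq_0_open)
  show "open (- F)" "x \<in> - F" using assms by auto
qed (use assms(3) in auto)

text \<open>The setting for the calculus of the Cheeger energy: finiteness on bounded sets puts
  Lipschitz functions with bounded support, and their slopes, into \<open>L2 m\<close>, and makes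
  \<open>m\<close> \<sigma>-finite.\<close>

locale boundedly_finite =
  fixes m :: "'a::polish_space measure"
  assumes sets_m [measurable_cong, simp]: "sets m = sets borel"
    and emeasure_bounded: "B \<in> sets borel \<Longrightarrow> bounded B \<Longrightarrow> emeasure m B < \<infinity>"
begin

lemma space_m [simp]: "space m = UNIV"
  using sets_eq_imp_space_eq[OF sets_m] by simp

lemma measurable_m [simp]: "borel_measurable m = borel_measurable borel"
  by (rule measurable_cong_sets) auto

lemma L2_borel: "f \<in> L2 m \<Longrightarrow> f \<in> borel_measurable borel"
  using L2_measurable[of f m] by simp

lemma L2_bounded_support:
  assumes "f \<in> borel_measurable borel" "\<And>x. \<bar>f x\<bar> \<le> B" "bounded {x. f x \<noteq> 0}"
  shows "f \<in> L2 m"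
proof -
  let ?S = "closure {x. f x \<noteq> 0}"
  have "emeasure m ?S < \<infinity>" using assms by (intro emeasure_bounded) auto
  then have "indicator ?S \<in> L2 m"
    by (auto simp: L2_def power2_eq_square indicator_inter_arith[symmetric] intro!: integrable_real_indicator)
  then have "(\<lambda>x. B * indicator ?S x) \<in> L2 m" by (rule L2_cmult)
  then show ?thesis
  proof (rule L2_bound)
    have "\<bar>f x\<bar> \<le> \<bar>B * indicator ?S x\<bar>" for x
    proof (cases "f x = 0")
      case False
      then have "x \<in> ?S" using closure_subset[of "{x. f x \<noteq> 0}"] by auto
      then show ?thesis using assms(2)[of x] by (simp add: abs_mult)
    qed simp
    then show "AE x in m. \<bar>f x\<bar> \<le> \<bar>B * indicator ?S x\<bar>" by simp
  qed (use assms in auto)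
qed

lemma Lip_bs_L2:
  assumes "f \<in> Lip_bs"
  shows "f \<in> L2 m"
proof -
  obtain B where "\<And>x. \<bar>f x\<bar> \<le> B" using assms by (rule Lip_bs_bounded) blast
  then show ?thesis
    using assms borel_measurable_continuous_onI[OF Lip_bs_continuous[OF assms]]
    by (intro L2_bounded_support) (auto simp: Lip_bs_def)
qed

lemma slope_L2:
  assumes "f \<in> Lip_bs"
  shows "slope f \<in> L2 m"
proof -
  obtain L where L: "L-lipschitz_on UNIV f" and b: "bounded {x. f x \<noteq> 0}"
    using assms by (rule Lip_bsE)
  have f0: "f y = 0" if "y \<notin> closure {x. f x \<noteq> 0}" for y
    using that closure_subset[of "{x. f x \<noteq> 0}"] by auto
  have "slope f x = 0" if "x \<notin> closure {x. f x \<noteq> 0}" for x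
    by (rule slope_eq_0_outside[OF closed_closure that f0])
  then have "{x. slope f x \<noteq> 0} \<subseteq> closure {x. f x \<noteq> 0}" by blast
  then have "bounded {x. slope f x \<noteq> 0}" using b by (meson bounded_closure bounded_subset)
  then show ?thesis
    using slope_le_lipschitz[OF L] borel_measurable_slope_Lip_bs[OF assms]
    by (intro L2_bounded_support[where B = L]) auto
qed

lemma nn_integral_slope:
  "f \<in> Lip_bs \<Longrightarrow> (\<integral>\<^sup>+x. ennreal ((slope f x)\<^sup>2) \<partial>m) = ennreal (sqnorm m (slope f))"
  by (intro nn_integral_sq slope_L2)

lemma sigma_finite: "sigma_finite_measure m"
proof
  obtain x0 :: 'a where True by simp
  show "\<exists>A. countable A \<and> A \<subseteq> sets m \<and> \<Union> A = space m \<and> (\<forall>a\<in>A. emeasure m a \<noteq> \<infinity>)"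
  proof (intro exI[of _ "range (\<lambda>n::nat. ball x0 n)"] conjI ballI)
    show "\<Union> (range (\<lambda>n::nat. ball x0 n)) = space m"
      using reals_Archimedean2 by auto
    show "emeasure m a \<noteq> \<infinity>" if "a \<in> range (\<lambda>n::nat. ball x0 n)" for a
      using that emeasure_bounded[of a] by auto
  qed auto
qed

text \<open>Inner regularity by compact sets holds for finite Borel measures on Polish spaces;
  \<open>m\<close> is made finite by restricting it to a ball that still meets B in positive
  mass.\<close>

lemma compact_subset_positive:
  assumes "B \<in> sets borel" "emeasure m B > 0"
  obtains K where "compact K" "K \<subseteq> B" "emeasure m K > 0"
proof -
  obtain x0 :: 'a where True by simp
  have "\<exists>n::nat. emeasure m (B \<inter> ball x0 n) > 0"
  proof (rule ccontr)
    assume "\<not> ?thesis"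
    then have "emeasure m (\<Union>n::nat. B \<inter> ball x0 n) = 0"
      using assms by (intro emeasure_UN_eq_0) auto
    also have "(\<Union>n::nat. B \<inter> ball x0 n) = B" using reals_Archimedean2 by auto
    finally show False using assms by simp
  qed
  then obtain n :: nat where n: "emeasure m (B \<inter> ball x0 n) > 0" by blast
  define \<mu> where "\<mu> = density m (indicator (ball x0 n))"
  have \<mu>: "emeasure \<mu> A = emeasure m (ball x0 n \<inter> A)" if "A \<in> sets borel" for A
    unfolding \<mu>_def using that by (intro emeasure_restricted) auto
  have "emeasure \<mu> B = (SUP K\<in>{K. K \<subseteq> B \<and> compact K}. emeasure \<mu> K)"
    using assms \<mu>[of UNIV] emeasure_bounded[of "ball x0 n"]
    by (intro inner_regular) (auto simp: \<mu>_def)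
  moreover have "emeasure \<mu> B > 0" using \<mu>[of B] n assms by (simp add: Int_commute)
  ultimately obtain K where K: "K \<subseteq> B" "compact K" "emeasure \<mu> K > 0"
    by (auto simp: less_SUP_iff)
  have "emeasure \<mu> K \<le> emeasure m K"
    using \<mu>[of K] K by (auto intro!: emeasure_mono simp: borel_closed compact_imp_closed)
  then show thesis using that[of K] K by auto
qed

end

section \<open>Cutoff functions\<close>

text \<open>\<open>Suc n\<close> is the Lipschitz constant and the reciprocal of the width of the
  transition layer. As \<open>infdist\<close> to the empty set is 0, the cutoff of the empty set is
  constantly 1; hence the assumptions \<open>K \<noteq> {}\<close> below.\<close>

definition cutoff :: "'a::metric_space set \<Rightarrow> nat \<Rightarrow> 'a \<Rightarrow> real" where
  "cutoff K n x = max 0 (1 - real (Suc n) * infdist x K)"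

lemma cutoff_bounds: "0 \<le> cutoff K n x" "cutoff K n x \<le> 1"
  by (auto simp: cutoff_def infdist_nonneg)

lemma cutoff_eq_1: "x \<in> K \<Longrightarrow> cutoff K n x = 1"
  by (simp add: cutoff_def)

lemma cutoff_eq_0: "infdist x K \<ge> 1 / real (Suc n) \<Longrightarrow> cutoff K n x = 0"
  by (simp add: cutoff_def field_simps)

lemma cutoff_lipschitz: "(real (Suc n))-lipschitz_on UNIV (cutoff K n)"
proof (rule lipschitz_onI_real)
  fix x y :: 'a
  have "\<bar>cutoff K n x - cutoff K n y\<bar> \<le> \<bar>real (Suc n) * infdist x K - real (Suc n) * infdist y K\<bar>"
    unfolding cutoff_def by linarith
  also have "\<dots> = real (Suc n) * \<bar>infdist x K - infdist y K\<bar>"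
    by (simp add: abs_mult flip: right_diff_distrib)
  also have "\<dots> \<le> real (Suc n) * dist x y" by (intro mult_left_mono infdist_triangle_abs) auto
  finally show "\<bar>cutoff K n x - cutoff K n y\<bar> \<le> real (Suc n) * dist x y" .
qed auto

lemma cutoff_measurable [measurable]: "cutoff K n \<in> borel_measurable borel"
  by (intro borel_measurable_continuous_onI lipschitz_on_continuous_on[OF cutoff_lipschitz])

lemma cutoff_tendsto:
  assumes "closed K" "K \<noteq> {}"
  shows "(\<lambda>n. cutoff K n x) \<longlonglongrightarrow> indicator K x"
proof (cases "x \<in> K")
  case True
  then show ?thesis by (simp add: cutoff_eq_1)
next
  case False
  then have "infdist x K > 0" using assms in_closed_iff_infdist_zero[of K x] infdist_nonneg[of x K] by linarith
  then obtain N where N: "1 / real (Suc N) < infdist x K" using nat_approx_posE by blast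
  have "cutoff K n x = indicator K x" if "n \<ge> N" for n
  proof -
    have "1 / real (Suc n) \<le> 1 / real (Suc N)" using that by (simp add: field_simps)
    then show ?thesis using N False by (simp add: cutoff_eq_0)
  qed
  then show ?thesis by (intro tendsto_eventually) (auto simp: eventually_sequentially)
qed

lemma infdist_le_subset_open:
  fixes K :: "'a::metric_space set"
  assumes "compact K" "K \<noteq> {}" "open G" "K \<subseteq> G"
  obtains N where "\<And>n x. n \<ge> N \<Longrightarrow> infdist x K \<le> 1 / real (Suc n) \<Longrightarrow> x \<in> G"
proof -
  obtain e where e: "e > 0" "(\<Union>x\<in>K. cball x e) \<subseteq> G"
    using compact_subset_open_imp_cball_epsilon_subset[OF assms(1,3,4)] by auto
  obtain N where N: "1 / real (Suc N) < e" using nat_approx_posE[OF e(1)] by blast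
  show thesis
  proof (rule that)
    fix n x assume "n \<ge> N" and n: "infdist x K \<le> 1 / real (Suc n)"
    have "1 / real (Suc n) \<le> 1 / real (Suc N)" using \<open>n \<ge> N\<close> by (simp add: field_simps)
    then have "infdist x K < e" using n N by linarith
    then obtain k where k: "k \<in> K" "dist x k < e"
      using assms(2) by (auto simp: infdist_notempty cINF_less_iff)
    then have "x \<in> cball k e" using k by (simp add: dist_commute)
    then have "x \<in> (\<Union>x\<in>K. cball x e)" using k by blast
    then show "x \<in> G" using e by blast
  qed
qed

lemma bounded_infdist_le:
  fixes K :: "'a::metric_space set"
  assumes "bounded K" "K \<noteq> {}"
  shows "bounded {x. infdist x K \<le> r}"
proof -
  obtain c R where R: "\<And>k. k \<in> K \<Longrightarrow> dist c k \<le> R" using assms by (auto simp: bounded_def)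
  have "dist c x \<le> R + r + 1" if "infdist x K \<le> r" for x
  proof -
    have "infdist x K < r + 1" using that by simp
    then have "\<exists>k\<in>K. dist x k < r + 1"
      using assms by (simp add: infdist_notempty cINF_less_iff)
    then obtain k where k: "k \<in> K" "dist x k < r + 1" by blast
    then show ?thesis using R[OF k(1)] dist_triangle[of c x k] by (simp add: dist_commute)
  qed
  then show ?thesis by (auto simp: bounded_def)
qed

lemma cutoff_Lip_bs:
  fixes K :: "'a::metric_space set"
  assumes "bounded K" "K \<noteq> {}"
  shows "cutoff K n \<in> Lip_bs"
proof -
  have "{x. cutoff K n x \<noteq> 0} \<subseteq> {x. infdist x K \<le> 1}"
  proof safe
    fix x assume "cutoff K n x \<noteq> 0"
    then have "infdist x K < 1 / real (Suc n)" using cutoff_eq_0[of n x K] by linarith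
    also have "\<dots> \<le> 1" by simp
    finally show "infdist x K \<le> 1" by simp
  qed
  then have "bounded {x. cutoff K n x \<noteq> 0}" by (rule bounded_subset[OF bounded_infdist_le[OF assms]])
  then show ?thesis using cutoff_lipschitz[of n K] unfolding Lip_bs_def by blast
qed

lemma slope_add_le:
  fixes a b :: "'a::metric_space \<Rightarrow> real"
  assumes a: "La-lipschitz_on UNIV a" and b: "Lb-lipschitz_on UNIV b"
  shows "slope (\<lambda>y. a y + b y) x \<le> slope a x + slope b x"
proof (rule slope_leI)
  fix e :: real assume "e > 0"
  have "\<forall>\<^sub>F y in at x. \<bar>a y - a x\<bar> \<le> (slope a x + e / 2) * dist x y"
    using \<open>e > 0\<close> by (intro slope_less_imp_eventually[OF a]) simp
  moreover have "\<forall>\<^sub>F y in at x. \<bar>b y - b x\<bar> \<le> (slope b x + e / 2) * dist x y"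
    using \<open>e > 0\<close> by (intro slope_less_imp_eventually[OF b]) simp
  ultimately show "\<forall>\<^sub>F y in at x. \<bar>a y + b y - (a x + b x)\<bar> \<le> (slope a x + slope b x + e) * dist x y"
  proof eventually_elim
    case (elim y)
    have "(slope a x + slope b x + e) * dist x y =
        (slope a x + e / 2) * dist x y + (slope b x + e / 2) * dist x y"
      by (simp add: field_simps)
    then show ?case using elim by linarith
  qed
qed simp

section \<open>The Cheeger energy\<close>

context boundedly_finite
begin

text \<open>Keeps the arithmetic of energies in the reals. An infinite energy is sent to 0, so a
  bound on \<open>Chr\<close> is informative only together with membership in
  \<open>W12 m\<close>.\<close>

abbreviation Chr :: "('a \<Rightarrow> real) \<Rightarrow> real" where
  "Chr f \<equiv> enn2real (Ch m f)"

text \<open>A liminf below a is below a infinitely often, and this meets the eventual closeness in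
  L^2, so a single Lipschitz function has both properties. With the converse \<open>Ch_le\<close>,
  the infimum over sequences becomes an epsilon criterion.\<close>

lemma Ch_approx:
  assumes "Ch m f < a" "(e::real) > 0"
  obtains h where "h \<in> Lip_bs" "sqnorm m (\<lambda>x. h x - f x) < e" "ennreal (sqnorm m (slope h)) < a" "f \<in> L2 m"
proof -
  obtain F where F: "\<And>n. F n \<in> Lip_bs" "L2_conv m F f"
    "liminf (\<lambda>n. \<integral>\<^sup>+x. ennreal ((slope (F n) x)\<^sup>2) \<partial>m) < a"
    using assms(1) unfolding Ch_def by (subst (asm) Inf_less_iff) blast
  then have l: "liminf (\<lambda>n. ennreal (sqnorm m (slope (F n)))) < a" by (simp add: nn_integral_slope)
  have ev: "\<forall>\<^sub>F n in sequentially. sqnorm m (\<lambda>x. F n x - f x) < e"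
    using L2_convD(3)[OF F(2)] assms(2) by (rule order_tendstoD)
  have fr: "\<exists>\<^sub>F n in sequentially. ennreal (sqnorm m (slope (F n))) < a"
  proof (rule ccontr)
    assume "\<not> ?thesis"
    then have "\<forall>\<^sub>F n in sequentially. a \<le> ennreal (sqnorm m (slope (F n)))"
      by (simp add: not_frequently not_less)
    then have "a \<le> liminf (\<lambda>n. ennreal (sqnorm m (slope (F n))))" by (rule Liminf_bounded)
    then show False using l by simp
  qed
  from frequently_eventually_frequently[OF fr ev] obtain n where "ennreal (sqnorm m (slope (F n))) < a" "sqnorm m (\<lambda>x. F n x - f x) < e"
    by (auto dest: frequently_ex)
  then show thesis using that[of "F n"] F L2_convD(2)[OF F(2)] by blast
qed

lemma Ch_le:
  assumes f: "f \<in> L2 m"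
    and h: "\<And>e::real. e > 0 \<Longrightarrow> \<exists>h\<in>Lip_bs. sqnorm m (\<lambda>x. h x - f x) < e \<and> ennreal (sqnorm m (slope h)) \<le> a"
  shows "Ch m f \<le> a"
proof -
  have ex: "\<exists>h\<in>L2 m. sqnorm m (\<lambda>x. h x - f x) < e \<and> (h \<in> Lip_bs \<and> ennreal (sqnorm m (slope h)) \<le> a)"
    if "e > 0" for e :: real
    using h[OF that] Lip_bs_L2 by blast
  obtain F where "L2_conv m F f" "\<And>n. F n \<in> Lip_bs \<and> ennreal (sqnorm m (slope (F n))) \<le> a"
    by (rule L2_approx_sequence[OF f ex]) (assumption | rule that)+
  then have F: "\<And>n. F n \<in> Lip_bs" "L2_conv m F f" "\<And>n. ennreal (sqnorm m (slope (F n))) \<le> a" by auto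
  have "Ch m f \<le> liminf (\<lambda>n. \<integral>\<^sup>+x. ennreal ((slope (F n) x)\<^sup>2) \<partial>m)"
    unfolding Ch_def using F(1,2) by (intro Inf_lower) blast
  also have "\<dots> = liminf (\<lambda>n. ennreal (sqnorm m (slope (F n))))" using F(1) by (simp add: nn_integral_slope)
  also have "\<dots> \<le> a" using F(3) by (intro Liminf_le) auto
  finally show ?thesis .
qed

lemma W12_iff: "f \<in> W12 m \<longleftrightarrow> Ch m f < \<infinity>"
  using Ch_approx[of f \<infinity> 1] by (auto simp: W12_def)

lemma W12_L2: "f \<in> W12 m \<Longrightarrow> f \<in> L2 m"
  by (simp add: W12_def)

lemma Ch_eq_Chr: "f \<in> W12 m \<Longrightarrow> Ch m f = ennreal (Chr f)"
  by (simp add: W12_iff)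

lemma W12_approx:
  assumes "f \<in> W12 m" "e > 0"
  obtains h where "h \<in> Lip_bs" "sqnorm m (\<lambda>x. h x - f x) < e" "sqnorm m (slope h) < Chr f + e"
proof -
  have "Ch m f < ennreal (Chr f + e)"
    using assms by (subst Ch_eq_Chr) (auto simp: ennreal_less_iff)
  then obtain h where "h \<in> Lip_bs" "sqnorm m (\<lambda>x. h x - f x) < e" "ennreal (sqnorm m (slope h)) < ennreal (Chr f + e)"
    using assms(2) by (rule Ch_approx)
  then show thesis using that[of h] by (simp add: ennreal_less_iff)
qed

lemma W12_I:
  assumes f: "f \<in> L2 m"
    and h: "\<And>e. e > 0 \<Longrightarrow> \<exists>h\<in>Lip_bs. sqnorm m (\<lambda>x. h x - f x) < e \<and> sqnorm m (slope h) \<le> a + e"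
  shows "f \<in> W12 m" "Chr f \<le> a"
proof -
  \<comment> \<open>\<open>a\<close> carries no sign a priori; nonnegativity of a + d is needed to
    read \<open>ennreal (a + d)\<close> back as a + d.\<close>
  have a: "a + d \<ge> 0" if d: "d > 0" for d
  proof -
    obtain h where "sqnorm m (slope h) \<le> a + d" using h[OF d] by blast
    moreover have "sqnorm m (slope h) \<ge> 0" by simp
    ultimately show ?thesis by linarith
  qed
  have Ch: "Ch m f \<le> ennreal (a + d)" if d: "d > 0" for d
  proof (rule Ch_le[OF f])
    fix e :: real assume "e > 0"
    then obtain h where h: "h \<in> Lip_bs" "sqnorm m (\<lambda>x. h x - f x) < min d e" "sqnorm m (slope h) \<le> a + min d e"
      using h[of "min d e"] d by auto
    then have "sqnorm m (slope h) \<le> a + d" by linarith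
    then show "\<exists>h\<in>Lip_bs. sqnorm m (\<lambda>x. h x - f x) < e \<and> ennreal (sqnorm m (slope h)) \<le> ennreal (a + d)"
      using h by (intro bexI[of _ h]) (auto intro: ennreal_leI)
  qed
  show "f \<in> W12 m" using Ch[of 1] by (auto simp: W12_iff le_less_trans)
  show "Chr f \<le> a"
  proof (rule field_le_epsilon)
    fix d :: real assume "d > 0"
    then show "Chr f \<le> a + d" using enn2real_mono[OF Ch[of d]] a[of d] by simp
  qed
qed

lemma W12_I_seq:
  assumes "L2_conv m h f" "\<And>n. h n \<in> Lip_bs" "\<And>n. sqnorm m (slope (h n)) \<le> b n" "b \<longlonglongrightarrow> a"
  shows "f \<in> W12 m" "Chr f \<le> a"
proof -
  have f: "f \<in> L2 m" using L2_convD[OF assms(1)] by blast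
  have *: "\<exists>h\<in>Lip_bs. sqnorm m (\<lambda>x. h x - f x) < e \<and> sqnorm m (slope h) \<le> a + e" if "e > 0" for e
  proof -
    have "\<forall>\<^sub>F n in sequentially. sqnorm m (\<lambda>x. h n x - f x) < e"
      using L2_convD(3)[OF assms(1)] that by (rule order_tendstoD)
    moreover have "\<forall>\<^sub>F n in sequentially. b n < a + e"
      using that by (intro order_tendstoD[OF assms(4)]) simp
    ultimately have "\<forall>\<^sub>F n in sequentially. sqnorm m (\<lambda>x. h n x - f x) < e \<and> b n < a + e"
      by (rule eventually_conj)
    then obtain n where "sqnorm m (\<lambda>x. h n x - f x) < e" "b n < a + e"
      by (auto simp: eventually_sequentially)
    then show ?thesis using assms(2,3)[of n] by (intro bexI[of _ "h n"]) auto
  qed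
  show "f \<in> W12 m" "Chr f \<le> a" using W12_I[OF f *] by auto
qed

lemma Ch_lower_semicontinuous:
  assumes "L2_conv m F f" "\<And>n. F n \<in> W12 m" "\<And>n. Chr (F n) \<le> b n" "b \<longlonglongrightarrow> a"
  shows "f \<in> W12 m" "Chr f \<le> a"
proof -
  have f: "f \<in> L2 m" using L2_convD[OF assms(1)] by blast
  \<comment> \<open>A diagonal choice: \<open>F n\<close> close to f is replaced by a Lipschitz
    function close to \<open>F n\<close>. The squared triangle inequality doubles both errors,
    whence e/4.\<close>
  have *: "\<exists>h\<in>Lip_bs. sqnorm m (\<lambda>x. h x - f x) < e \<and> sqnorm m (slope h) \<le> a + e" if e: "e > 0" for e
  proof -
    have "\<forall>\<^sub>F n in sequentially. sqnorm m (\<lambda>x. F n x - f x) < e / 4"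
      using e by (intro order_tendstoD[OF L2_convD(3)[OF assms(1)]]) simp
    moreover have "\<forall>\<^sub>F n in sequentially. b n < a + e / 2"
      using that by (intro order_tendstoD[OF assms(4)]) simp
    ultimately have "\<forall>\<^sub>F n in sequentially. sqnorm m (\<lambda>x. F n x - f x) < e / 4 \<and> b n < a + e / 2"
      by (rule eventually_conj)
    then obtain n where n: "sqnorm m (\<lambda>x. F n x - f x) < e / 4" "b n < a + e / 2"
      by (auto simp: eventually_sequentially)
    obtain h where h: "h \<in> Lip_bs" "sqnorm m (\<lambda>x. h x - F n x) < e / 4" "sqnorm m (slope h) < Chr (F n) + e / 4"
      using W12_approx[OF assms(2)[of n], of "e / 4"] e by auto
    have "sqnorm m (\<lambda>x. h x - f x) < e"
      using sqnorm_triangle_le[OF Lip_bs_L2[OF h(1)] W12_L2[OF assms(2)[of n]] f] h n by linarith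
    then show ?thesis using h n assms(3)[of n] e by (intro bexI[of _ h]) auto
  qed
  show "f \<in> W12 m" "Chr f \<le> a" using W12_I[OF f *] by auto
qed

text \<open>Lower semicontinuity in epsilon-delta form: if every L^2 neighbourhood of f contained a
  Lipschitz function of energy at most \<open>Chr f - e\<close>, relaxation would give
  \<open>Chr f \<le> Chr f - e\<close>.\<close>

lemma Ch_lower_bound:
  assumes "f \<in> W12 m" "e > 0"
  obtains d where "d > 0" "\<And>h. h \<in> Lip_bs \<Longrightarrow> sqnorm m (\<lambda>x. h x - f x) < d \<Longrightarrow> Chr f - e < sqnorm m (slope h)"
proof -
  have "\<exists>d>0. \<forall>h\<in>Lip_bs. sqnorm m (\<lambda>x. h x - f x) < d \<longrightarrow> Chr f - e < sqnorm m (slope h)"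
  proof (rule ccontr)
    assume "\<not> ?thesis"
    then have *: "\<exists>h\<in>Lip_bs. sqnorm m (\<lambda>x. h x - f x) < d \<and> sqnorm m (slope h) \<le> Chr f - e" if "d > 0" for d
      using that by (meson not_le)
    have "Chr f \<le> Chr f - e"
    proof (rule W12_I(2)[OF W12_L2[OF assms(1)]])
      fix d :: real assume "d > 0"
      then show "\<exists>h\<in>Lip_bs. sqnorm m (\<lambda>x. h x - f x) < d \<and> sqnorm m (slope h) \<le> Chr f - e + d"
        using *[of d] by force
    qed
    then show False using assms by simp
  qed
  then show thesis using that by blast
qed

text \<open>The choice of h bounds the energies from above; the bound from below is automatic by
  \<open>Ch_lower_bound\<close>, so that the energies converge and do not merely have the right
  liminf.\<close>

lemma W12_optimal_sequence:
  assumes "f \<in> W12 m"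
  obtains h where "\<And>n. h n \<in> Lip_bs" "L2_conv m h f" "(\<lambda>n. sqnorm m (slope (h n))) \<longlonglongrightarrow> Chr f"
proof -
  have ex: "\<exists>h\<in>L2 m. sqnorm m (\<lambda>x. h x - f x) < e \<and> (h \<in> Lip_bs \<and> sqnorm m (slope h) < Chr f + e)"
    if e: "e > 0" for e
    using W12_approx[OF assms e] Lip_bs_L2 by metis
  obtain h where conv: "L2_conv m h f"
    and "\<And>n. h n \<in> Lip_bs \<and> sqnorm m (slope (h n)) < Chr f + inverse (real (Suc n))"
    by (rule L2_approx_sequence[OF W12_L2[OF assms] ex]) (assumption | rule that)+
  then have h: "\<And>n. h n \<in> Lip_bs" "\<And>n. sqnorm m (slope (h n)) < Chr f + inverse (real (Suc n))" by auto
  have "(\<lambda>n. sqnorm m (slope (h n))) \<longlonglongrightarrow> Chr f"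
  proof (rule order_tendstoI)
    fix a assume "a < Chr f"
    then obtain d where d: "d > 0" "\<And>h. h \<in> Lip_bs \<Longrightarrow> sqnorm m (\<lambda>x. h x - f x) < d \<Longrightarrow> Chr f - (Chr f - a) < sqnorm m (slope h)"
      using Ch_lower_bound[OF assms, of "Chr f - a"] by auto
    have "\<forall>\<^sub>F n in sequentially. sqnorm m (\<lambda>x. h n x - f x) < d"
      using L2_convD(3)[OF conv] d(1) by (rule order_tendstoD)
    then show "\<forall>\<^sub>F n in sequentially. a < sqnorm m (slope (h n))"
      by eventually_elim (use d(2) h(1) in auto)
  next
    fix a assume a: "Chr f < a"
    have "(\<lambda>n. Chr f + inverse (real (Suc n))) \<longlonglongrightarrow> Chr f + 0"
      by (intro tendsto_add tendsto_const LIMSEQ_inverse_real_of_nat)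
    then have "\<forall>\<^sub>F n in sequentially. Chr f + inverse (real (Suc n)) < a" using a by (intro order_tendstoD) auto
    then show "\<forall>\<^sub>F n in sequentially. sqnorm m (slope (h n)) < a"
      by eventually_elim (use h(2) less_trans in blast)
  qed
  then show thesis using that h(1) conv by blast
qed

lemma Lip_bs_W12:
  assumes "f \<in> Lip_bs"
  shows "f \<in> W12 m" "Chr f \<le> sqnorm m (slope f)"
  using W12_I_seq[of "\<lambda>_. f" f "\<lambda>_. sqnorm m (slope f)"] L2_conv_const[OF Lip_bs_L2[OF assms]] assms
  by auto

lemma Ch_cong_AE:
  assumes "AE x in m. f x = g x" "f \<in> borel_measurable borel" "g \<in> borel_measurable borel"
  shows "Ch m f = Ch m g"
proof -
  have "L2_conv m F f \<longleftrightarrow> L2_conv m F g" for F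
  proof
    have "AE x in m. g x = f x" using assms(1) by eventually_elim simp
    then show "L2_conv m F g \<Longrightarrow> L2_conv m F f" using assms by (auto elim: L2_conv_cong_AE)
  qed (use assms in \<open>auto elim: L2_conv_cong_AE\<close>)
  then show ?thesis by (simp add: Ch_def)
qed

lemma sqnorm_slope_le:
  assumes "h \<in> Lip_bs" "\<And>x. slope h x \<le> u x" "u \<in> L2 m"
  shows "sqnorm m (slope h) \<le> sqnorm m u"
proof (rule sqnorm_mono[OF assms(3)])
  show "AE x in m. \<bar>slope h x\<bar> \<le> \<bar>u x\<bar>"
    using assms(2) by (auto intro!: AE_I2 order_trans[OF _ abs_ge_self])
qed (use borel_measurable_slope_Lip_bs[OF assms(1)] in simp)

lemma sqnorm_slope_comparison:
  assumes f: "f \<in> Lip_bs" and h: "\<And>x y. \<bar>h y - h x\<bar> \<le> C * \<bar>f y - f x\<bar>" "0 \<le> C" "\<And>x. f x = 0 \<Longrightarrow> h x = 0"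
  shows "sqnorm m (slope h) \<le> C\<^sup>2 * sqnorm m (slope f)"
proof -
  obtain L where L: "L-lipschitz_on UNIV f" using f by (rule Lip_bsE)
  have "sqnorm m (slope h) \<le> sqnorm m (\<lambda>x. C * slope f x)"
    using Lip_bs_comp[OF f h] slope_comparison[OF L h(1,2)] L2_cmult[OF slope_L2[OF f]]
    by (intro sqnorm_slope_le) auto
  then show ?thesis by (simp add: sqnorm_cmult)
qed

text \<open>Post-composition acts on an optimal sequence and multiplies slopes by at most C, while
  \<open>\<phi> 0 = 0\<close> keeps supports bounded. Scalar multiples and the truncation in the
  Markov property are the instances.\<close>

lemma W12_comp:
  assumes f: "f \<in> W12 m" and \<phi>: "\<And>s t. \<bar>\<phi> t - \<phi> s\<bar> \<le> C * \<bar>t - s\<bar>" "\<phi> 0 = 0" "0 \<le> C"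
  shows "(\<lambda>x. \<phi> (f x)) \<in> W12 m" "Chr (\<lambda>x. \<phi> (f x)) \<le> C\<^sup>2 * Chr f"
proof -
  obtain h where h: "\<And>n. h n \<in> Lip_bs" "L2_conv m h f" "(\<lambda>n. sqnorm m (slope (h n))) \<longlonglongrightarrow> Chr f"
    by (rule W12_optimal_sequence[OF f]) (rule that)
  have \<phi>h: "(\<lambda>x. \<phi> (h n x)) \<in> Lip_bs" for n
    by (rule Lip_bs_comp[OF h(1)[of n] \<phi>(1)]) (use \<phi> in auto)
  have \<phi>L: "C-lipschitz_on UNIV \<phi>"
    using \<phi> by (intro lipschitz_onI_real) (auto simp: dist_real_def)
  have \<phi>m: "\<phi> \<in> borel_measurable borel"
    by (intro borel_measurable_continuous_onI lipschitz_on_continuous_on[OF \<phi>L])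
  have fL: "f \<in> L2 m" by (rule W12_L2[OF f])
  have \<phi>f: "(\<lambda>x. \<phi> (f x)) \<in> L2 m"
    using \<phi>(1)[of 0] \<phi>(2,3) L2_borel[OF fL] \<phi>m
    by (intro L2_bound[OF L2_cmult[OF fL, of C]]) (auto simp: abs_mult intro: measurable_compose)
  have conv: "L2_conv m (\<lambda>n x. \<phi> (h n x)) (\<lambda>x. \<phi> (f x))"
    unfolding L2_conv_def
  proof (intro conjI allI \<phi>f Lip_bs_L2 \<phi>h)
    show "(\<lambda>n. sqnorm m (\<lambda>x. \<phi> (h n x) - \<phi> (f x))) \<longlonglongrightarrow> 0"
    proof (rule tendsto_sandwich[OF _ _ tendsto_const])
      show "(\<lambda>n. sqnorm m (\<lambda>x. C * (h n x - f x))) \<longlonglongrightarrow> 0"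
        unfolding sqnorm_cmult by (rule tendsto_eq_intros refl L2_convD(3)[OF h(2)])+ simp
      have "sqnorm m (\<lambda>x. \<phi> (h n x) - \<phi> (f x)) \<le> sqnorm m (\<lambda>x. C * (h n x - f x))" for n
      proof (rule sqnorm_mono)
        show "(\<lambda>x. C * (h n x - f x)) \<in> L2 m" by (intro L2_cmult L2_diff fL Lip_bs_L2 h)
        show "(\<lambda>x. \<phi> (h n x) - \<phi> (f x)) \<in> borel_measurable m"
          using L2_diff[OF Lip_bs_L2[OF \<phi>h[of n]] \<phi>f] by (rule L2_measurable)
        show "AE x in m. \<bar>\<phi> (h n x) - \<phi> (f x)\<bar> \<le> \<bar>C * (h n x - f x)\<bar>"
          using \<phi>(1,3) by (simp add: abs_mult)
      qed
      then show "\<forall>\<^sub>F n in sequentially. sqnorm m (\<lambda>x. \<phi> (h n x) - \<phi> (f x)) \<le> sqnorm m (\<lambda>x. C * (h n x - f x))"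
        by simp
    qed simp
  qed
  have le: "sqnorm m (slope (\<lambda>x. \<phi> (h n x))) \<le> C\<^sup>2 * sqnorm m (slope (h n))" for n
    by (rule sqnorm_slope_comparison[OF h(1)[of n] \<phi>(1)]) (use \<phi> in auto)
  have lim: "(\<lambda>n. C\<^sup>2 * sqnorm m (slope (h n))) \<longlonglongrightarrow> C\<^sup>2 * Chr f"
    by (intro tendsto_mult tendsto_const h)
  show "(\<lambda>x. \<phi> (f x)) \<in> W12 m" "Chr (\<lambda>x. \<phi> (f x)) \<le> C\<^sup>2 * Chr f"
    by (rule W12_I_seq[OF conv \<phi>h le lim])+
qed

lemma W12_zero: "(\<lambda>x. 0) \<in> W12 m" "Chr (\<lambda>x. 0) = 0"
proof -
  show "(\<lambda>x. 0) \<in> W12 m" by (rule Lip_bs_W12[OF Lip_bs_zero])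
  have "slope (\<lambda>x::'a. 0) = (\<lambda>x. 0)" by (intro ext slope_eq_0) auto
  then have "Chr (\<lambda>x. 0) \<le> 0" using Lip_bs_W12(2)[OF Lip_bs_zero] by simp
  then show "Chr (\<lambda>x. 0) = 0" using enn2real_nonneg[of "Ch m (\<lambda>x. 0)"] by linarith
qed

lemma W12_cmult:
  assumes "f \<in> W12 m"
  shows "(\<lambda>x. c * f x) \<in> W12 m" "Chr (\<lambda>x. c * f x) = c\<^sup>2 * Chr f"
proof -
  have *: "(\<lambda>x. c * f x) \<in> W12 m \<and> Chr (\<lambda>x. c * f x) \<le> c\<^sup>2 * Chr f" if "f \<in> W12 m" for c f
    using W12_comp[OF that, of "\<lambda>t. c * t" "\<bar>c\<bar>"] by (simp flip: abs_mult right_diff_distrib)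
  show "(\<lambda>x. c * f x) \<in> W12 m" using * assms by blast
  show "Chr (\<lambda>x. c * f x) = c\<^sup>2 * Chr f"
  proof (cases "c = 0")
    case True then show ?thesis using W12_zero by simp
  next
    case False
    \<comment> \<open>The reverse inequality is the same bound for the function c f and the factor
      1/c.\<close>
    have "Chr (\<lambda>x. inverse c * (c * f x)) \<le> (inverse c)\<^sup>2 * Chr (\<lambda>x. c * f x)"
      using * assms by blast
    then have "c\<^sup>2 * Chr (\<lambda>x. inverse c * (c * f x)) \<le> c\<^sup>2 * ((inverse c)\<^sup>2 * Chr (\<lambda>x. c * f x))"
      by (intro mult_left_mono) auto
    moreover have "(\<lambda>x. inverse c * (c * f x)) = f" using False by (simp add: fun_eq_iff)
    moreover have "c\<^sup>2 * ((inverse c)\<^sup>2 * Chr (\<lambda>x. c * f x)) = Chr (\<lambda>x. c * f x)"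
      using False by (simp add: power2_eq_square field_simps)
    ultimately have "c\<^sup>2 * Chr f \<le> Chr (\<lambda>x. c * f x)" by simp
    then show ?thesis using *[OF assms, of c] by linarith
  qed
qed

lemma W12_add:
  assumes f: "f \<in> W12 m" and g: "g \<in> W12 m"
  shows "(\<lambda>x. f x + g x) \<in> W12 m" "Chr (\<lambda>x. f x + g x) \<le> 2 * Chr f + 2 * Chr g"
proof -
  obtain h where h: "\<And>n. h n \<in> Lip_bs" "L2_conv m h f" "(\<lambda>n. sqnorm m (slope (h n))) \<longlonglongrightarrow> Chr f"
    by (rule W12_optimal_sequence[OF f]) (rule that)
  obtain k where k: "\<And>n. k n \<in> Lip_bs" "L2_conv m k g" "(\<lambda>n. sqnorm m (slope (k n))) \<longlonglongrightarrow> Chr g"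
    by (rule W12_optimal_sequence[OF g]) (rule that)
  have le: "sqnorm m (slope (\<lambda>x. h n x + k n x)) \<le> 2 * sqnorm m (slope (h n)) + 2 * sqnorm m (slope (k n))" for n
  proof -
    obtain L M where "L-lipschitz_on UNIV (h n)" "M-lipschitz_on UNIV (k n)"
      using h(1)[of n] k(1)[of n] by (auto simp: Lip_bs_def)
    then have "sqnorm m (slope (\<lambda>x. h n x + k n x)) \<le> sqnorm m (\<lambda>x. slope (h n) x + slope (k n) x)"
      using h k by (intro sqnorm_slope_le Lip_bs_add L2_add slope_L2 slope_add_le)
    also have "\<dots> \<le> 2 * sqnorm m (slope (h n)) + 2 * sqnorm m (slope (k n))"
      by (intro sqnorm_add_le slope_L2 h k)
    finally show ?thesis .
  qed
  have lim: "(\<lambda>n. 2 * sqnorm m (slope (h n)) + 2 * sqnorm m (slope (k n))) \<longlonglongrightarrow> 2 * Chr f + 2 * Chr g"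
    by (intro tendsto_intros h k)
  show "(\<lambda>x. f x + g x) \<in> W12 m" "Chr (\<lambda>x. f x + g x) \<le> 2 * Chr f + 2 * Chr g"
    using W12_I_seq[OF L2_conv_add[OF h(2) k(2)] Lip_bs_add[OF h(1) k(1)] le lim] by auto
qed

lemma W12_diff:
  assumes "f \<in> W12 m" "g \<in> W12 m"
  shows "(\<lambda>x. f x - g x) \<in> W12 m" "Chr (\<lambda>x. f x - g x) \<le> 2 * Chr f + 2 * Chr g"
  using W12_add[OF assms(1) W12_cmult(1)[OF assms(2), of "-1"]] W12_cmult(2)[OF assms(2), of "-1"] by auto

lemma Chr_swap: "f \<in> W12 m \<Longrightarrow> g \<in> W12 m \<Longrightarrow> Chr (\<lambda>x. g x - f x) = Chr (\<lambda>x. f x - g x)"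
  using W12_cmult(2)[OF W12_diff(1), of f g "-1"] by simp

section \<open>Density of Lipschitz functions in \<open>L2 m\<close>\<close>

lemma Lip_bs_dense_indicator:
  assumes A: "A \<in> sets borel" "bounded A" and "(e::real) > 0"
  shows "\<exists>h\<in>Lip_bs. sqnorm m (\<lambda>x. h x - indicator A x) < e"
proof -
  \<comment> \<open>Restricting m to A gives a finite measure, to which inner regularity by compact
    sets applies; a compact K exhausting A up to e/8 is then smoothed by its cutoffs.\<close>
  define \<mu> where "\<mu> = density m (indicator A)"
  have \<mu>: "emeasure \<mu> B = emeasure m (A \<inter> B)" if "B \<in> sets borel" for B
    unfolding \<mu>_def using that A by (intro emeasure_restricted) auto
  have fin: "emeasure m B < \<infinity>" if "B \<subseteq> A" "B \<in> sets borel" for B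
    using that A by (intro emeasure_bounded) (auto intro: bounded_subset)
  have "emeasure \<mu> A = (SUP K\<in>{K. K \<subseteq> A \<and> compact K}. emeasure \<mu> K)"
    using A \<mu>[of UNIV] fin[of A] by (intro inner_regular) (auto simp: \<mu>_def)
  moreover have "emeasure m A = ennreal (measure m A)"
    using fin[of A] A by (intro emeasure_eq_ennreal_measure) auto
  ultimately have sup: "ennreal (measure m A) = (SUP K\<in>{K. K \<subseteq> A \<and> compact K}. emeasure \<mu> K)"
    using \<mu>[of A] A by simp
  have "\<exists>K. K \<subseteq> A \<and> compact K \<and> measure m A - e / 8 < measure m K"
  proof (cases "measure m A - e / 8 < 0")
    case True then show ?thesis by (intro exI[of _ "{}"]) auto
  next
    case False
    then have "ennreal (measure m A - e / 8) < ennreal (measure m A)"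
      using \<open>e > 0\<close> by (simp add: ennreal_less_iff)
    also note sup
    finally obtain K where K: "K \<subseteq> A" "compact K" "ennreal (measure m A - e / 8) < emeasure \<mu> K"
      by (auto simp: less_SUP_iff)
    then have "emeasure \<mu> K = ennreal (measure m K)"
      using \<mu>[of K] fin[of K] by (simp add: borel_closed compact_imp_closed Int_absorb1 emeasure_eq_ennreal_measure)
    then show ?thesis using K False by (auto simp: ennreal_less_iff)
  qed
  then obtain K where K: "K \<subseteq> A" "compact K" "measure m A - e / 8 < measure m K" by blast
  have Kb: "K \<in> sets borel" using K by (simp add: borel_closed compact_imp_closed)
  have ind: "indicator B \<in> L2 m" "sqnorm m (indicator B) = measure m B" if "B \<subseteq> A" "B \<in> sets borel" for B
  proof -
    have eq: "(indicator B x :: real)\<^sup>2 = indicator B x" for x by (simp add: indicator_def)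
    show "indicator B \<in> L2 m"
      using fin[OF that] that by (auto simp: L2_def eq intro!: integrable_real_indicator)
    show "sqnorm m (indicator B) = measure m B" using that by (simp add: eq)
  qed
  have ind_diff: "indicator K x - indicator A x = (- 1 * indicator (A - K) x :: real)" for x
    using K(1) by (auto split: split_indicator)
  have "sqnorm m (\<lambda>x. indicator K x - indicator A x) = (-1)\<^sup>2 * sqnorm m (indicator (A - K))"
    unfolding ind_diff by (rule sqnorm_cmult)
  also have "\<dots> = measure m (A - K)" using ind(2)[of "A - K"] A Kb by auto
  also have "\<dots> = measure m A - measure m K"
    using A Kb fin[of A] K by (intro measure_Diff) auto
  finally have KA: "sqnorm m (\<lambda>x. indicator K x - indicator A x) < e / 8" using K by simp
  show ?thesis
  proof (cases "K = {}")
    case True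
    then show ?thesis using KA \<open>e > 0\<close> by (intro bexI[OF _ Lip_bs_zero]) auto
  next
    case False
    have conv: "L2_conv m (cutoff K) (indicator K)"
    proof (rule L2_dominated_convergence)
      show "cutoff K 0 \<in> L2 m"
        using Lip_bs_L2[OF cutoff_Lip_bs[OF compact_imp_bounded[OF K(2)] False]] by blast
      have "cutoff K n x \<le> cutoff K 0 x" for n x
      proof -
        have "1 * infdist x K \<le> real (Suc n) * infdist x K" by (intro mult_right_mono infdist_nonneg) auto
        then show ?thesis by (simp add: cutoff_def)
      qed
      then show "AE x in m. \<bar>cutoff K n x\<bar> \<le> \<bar>cutoff K 0 x\<bar>" for n
        using cutoff_bounds[of K] by simp
      show "AE x in m. (\<lambda>n. cutoff K n x) \<longlonglongrightarrow> indicator K x"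
        using cutoff_tendsto[OF compact_imp_closed[OF K(2)] False] by simp
    qed (use Kb in auto)
    have "\<forall>\<^sub>F n in sequentially. sqnorm m (\<lambda>x. cutoff K n x - indicator K x) < e / 8"
      using \<open>e > 0\<close> by (intro order_tendstoD[OF L2_convD(3)[OF conv]]) simp
    then obtain n where n: "sqnorm m (\<lambda>x. cutoff K n x - indicator K x) < e / 8"
      by (auto simp: eventually_sequentially)
    have "sqnorm m (\<lambda>x. cutoff K n x - indicator A x) < e"
      using sqnorm_triangle_le[OF L2_convD(1)[OF conv, of n] ind(1)[OF K(1) Kb] ind(1)[OF order_refl A(1)]] n KA \<open>e > 0\<close>
      by linarith
    then show ?thesis using cutoff_Lip_bs[OF compact_imp_bounded[OF K(2)] False] by blast
  qed
qed

text \<open>The functions that can be approximated form a linear space closed under L^2 limits, so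
  the standard induction for nonnegative measurable functions, starting from indicators, reaches all
  of \<open>L2 m\<close>.\<close>

lemma Lip_bs_dense:
  assumes "f \<in> L2 m" "(e::real) > 0"
  shows "\<exists>h\<in>Lip_bs. sqnorm m (\<lambda>x. h x - f x) < e"
proof -
  define P where "P u \<longleftrightarrow> (\<forall>e>0. \<exists>h\<in>Lip_bs. sqnorm m (\<lambda>x. h x - u x) < (e::real))" for u :: "'a \<Rightarrow> real"
  have lim: "P f" if F: "L2_conv m F f" "\<And>n. P (F n)" for F f
    unfolding P_def
  proof (intro allI impI)
    fix e :: real assume "e > 0"
    then have "\<forall>\<^sub>F n in sequentially. sqnorm m (\<lambda>x. F n x - f x) < e / 4"
      by (intro order_tendstoD[OF L2_convD(3)[OF F(1)]]) simp
    then obtain n where n: "sqnorm m (\<lambda>x. F n x - f x) < e / 4" by (auto simp: eventually_sequentially)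
    obtain h where h: "h \<in> Lip_bs" "sqnorm m (\<lambda>x. h x - F n x) < e / 4"
      using F(2)[of n] \<open>e > 0\<close> unfolding P_def by (meson zero_less_divide_iff zero_less_numeral)
    have "sqnorm m (\<lambda>x. h x - f x) < e"
      using sqnorm_triangle_le[OF Lip_bs_L2[OF h(1)] L2_convD(1,2)[OF F(1)], of n] n h \<open>e > 0\<close> by linarith
    then show "\<exists>h\<in>Lip_bs. sqnorm m (\<lambda>x. h x - f x) < e" using h by blast
  qed
  have seq: "\<exists>F. (\<forall>n. F n \<in> Lip_bs) \<and> L2_conv m F f" if P: "P f" "f \<in> L2 m" for f
  proof -
    have ex: "\<exists>h\<in>L2 m. sqnorm m (\<lambda>x. h x - f x) < e \<and> h \<in> Lip_bs" if "e > 0" for e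
      using P(1) that Lip_bs_L2 unfolding P_def by blast
    obtain F where "L2_conv m F f" "\<And>n. F n \<in> Lip_bs"
      by (rule L2_approx_sequence[OF P(2) ex]) (assumption | rule that)+
    then show ?thesis by blast
  qed
  have Lip: "P h" if "h \<in> Lip_bs" for h
    unfolding P_def using that by (auto intro!: bexI[of _ h])
  have P_add: "P (\<lambda>x. u x + v x)" if "P u" "P v" "u \<in> L2 m" "v \<in> L2 m" for u v
    using seq[OF that(1,3)] seq[OF that(2,4)] lim[OF L2_conv_add Lip[OF Lip_bs_add]] by metis
  have P_cmult: "P (\<lambda>x. c * u x)" if "P u" "u \<in> L2 m" for u c
    using seq[OF that] lim[OF L2_conv_cmult Lip[OF Lip_bs_cmult]] by metis
  \<comment> \<open>The induction runs through measurable functions, so square integrability is part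
    of the induction formula; summands and monotone approximants inherit it by domination.\<close>
  have pos: "u \<in> L2 m \<longrightarrow> P u" if "u \<in> borel_measurable m" "\<And>x. 0 \<le> u x" for u
    using that
  proof (induction rule: borel_measurable_induct_real)
    case (set A)
    obtain x0 :: 'a where True by simp
    show ?case
    proof
      assume A: "indicator A \<in> L2 m"
      show "P (indicator A)"
      proof (rule lim)
        show "L2_conv m (\<lambda>n. indicator (A \<inter> ball x0 (real n))) (indicator A)"
        proof (rule L2_dominated_convergence[OF _ _ A])
          show "indicator (A \<inter> ball x0 (real n)) \<in> borel_measurable m" for n
            using set by (intro borel_measurable_indicator) auto
          show "AE x in m. (\<lambda>n. indicator (A \<inter> ball x0 (real n)) x :: real) \<longlonglongrightarrow> indicator A x"
          proof (rule AE_I2)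
            fix x
            obtain N :: nat where N: "dist x0 x < N" using reals_Archimedean2 by blast
            have "indicator (A \<inter> ball x0 (real n)) x = (indicator A x :: real)" if "n \<ge> N" for n
              using N that by (auto simp: indicator_def)
            then show "(\<lambda>n. indicator (A \<inter> ball x0 (real n)) x :: real) \<longlonglongrightarrow> indicator A x"
              by (intro tendsto_eventually) (auto simp: eventually_sequentially)
          qed
          show "AE x in m. \<bar>indicator (A \<inter> ball x0 (real n)) x :: real\<bar> \<le> \<bar>indicator A x\<bar>" for n
            by (auto simp: indicator_def)
        qed (use set in auto)
        show "P (indicator (A \<inter> ball x0 (real n)))" for n
          unfolding P_def using set by (intro allI impI Lip_bs_dense_indicator) (auto intro: bounded_subset)
      qed
    qed
  next
    case (mult u c)
    show ?case
    proof
      assume cu: "(\<lambda>x. c * u x) \<in> L2 m"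
      show "P (\<lambda>x. c * u x)"
      proof (cases "c = 0")
        case True
        then show ?thesis using Lip[OF Lip_bs_zero] by simp
      next
        case False
        then have "u \<in> L2 m" using L2_cmult[OF cu, of "inverse c"] by (simp add: field_simps)
        then show ?thesis using P_cmult mult by blast
      qed
    qed
  next
    case (add u v)
    show ?case
    proof
      assume vu: "(\<lambda>x. v x + u x) \<in> L2 m"
      have "u \<in> L2 m" "v \<in> L2 m"
        using add by (auto intro!: L2_bound[OF vu])
      then show "P (\<lambda>x. v x + u x)" using P_add add by blast
    qed
  next
    case (seq U)
    show ?case
    proof
      assume u: "u \<in> L2 m"
      have inc: "incseq U" and Um: "\<And>i. U i \<in> borel_measurable m" and U0: "\<And>i x. 0 \<le> U i x"
        and PU: "\<And>i. U i \<in> L2 m \<longrightarrow> P (U i)" and Ulim: "\<And>x. (\<lambda>i. U i x) \<longlonglongrightarrow> u x"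
        using seq by auto
      have le: "U i x \<le> u x" for i x
        using Ulim[of x] inc by (intro incseq_le) (auto simp: incseq_def le_fun_def)
      have conv: "L2_conv m U u"
      proof (rule L2_dominated_convergence[OF Um L2_measurable[OF u] u])
        show "AE x in m. \<bar>U i x\<bar> \<le> \<bar>u x\<bar>" for i
        proof (rule AE_I2)
          show "\<bar>U i x\<bar> \<le> \<bar>u x\<bar>" for x using U0[of i x] le[of i x] by simp
        qed
      qed (use Ulim in auto)
      then show "P u" using lim[OF conv] PU L2_convD(1)[OF conv] by blast
    qed
  qed
  have fm: "f \<in> borel_measurable borel" by (rule L2_borel[OF assms(1)])
  have L: "(\<lambda>x. max (f x) 0) \<in> L2 m" "(\<lambda>x. max (- f x) 0) \<in> L2 m"
    by (rule L2_bound[OF assms(1)], use fm in auto)+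
  have "P (\<lambda>x. max (f x) 0)" "P (\<lambda>x. max (- f x) 0)"
    by (rule pos[rule_format], use fm L in auto)+
  then have "P (\<lambda>x. max (f x) 0 + (- 1 * max (- f x) 0))"
    by (intro P_add P_cmult L L2_cmult)
  moreover have "(\<lambda>x. max (f x) 0 + (- 1 * max (- f x) 0)) = f" by (auto simp: fun_eq_iff)
  ultimately have "P f" by (simp only:)
  then show ?thesis using assms(2) unfolding P_def by blast
qed

end

section \<open>The Cheeger energy as a Dirichlet form\<close>

text \<open>Cauchy's functional equation, for the homogeneity of the polarized form. After removal
  of the linear part, q is additive and vanishes on the integers, hence is determined by fractional
  parts and bounded on the whole line; a bounded additive function is 0.\<close>

lemma additive_bounded_imp_linear:
  fixes p :: "real \<Rightarrow> real"
  assumes add: "\<And>a b. p (a + b) = p a + p b" and bd: "\<And>a. \<bar>a\<bar> \<le> 1 \<Longrightarrow> \<bar>p a\<bar> \<le> B"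
  shows "p c = c * p 1"
proof -
  define q where "q a = p a - a * p 1" for a
  have q_add: "q (a + b) = q a + q b" for a b by (simp add: q_def add algebra_simps)
  have q1: "q 1 = 0" by (simp add: q_def)
  have q0: "q 0 = 0" using q_add[of 0 0] by simp
  have q_minus: "q (- a) = - q a" for a using q_add[of a "- a"] q0 by simp
  have q_nat: "q (real n * a) = real n * q a" for n a
    by (induction n) (auto simp: q0 q_add algebra_simps)
  have q_int: "q (of_int k) = 0" for k
  proof (cases "k \<ge> 0")
    case True
    then show ?thesis using q_nat[of "nat k" 1] q1 by simp
  next
    case False
    then show ?thesis using q_nat[of "nat (- k)" 1] q1 q_minus[of "of_int k"] by simp
  qed
  define C where "C = B + \<bar>p 1\<bar>"
  have qb: "\<bar>q a\<bar> \<le> C" if "0 \<le> a" "a \<le> 1" for a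
  proof -
    have "\<bar>a * p 1\<bar> \<le> 1 * \<bar>p 1\<bar>" unfolding abs_mult using that by (intro mult_right_mono) auto
    then show ?thesis using bd[of a] that unfolding q_def C_def by linarith
  qed
  have nb: "real n * \<bar>q c\<bar> \<le> C" for n
  proof -
    have "real n * q c = q (real n * c)" by (simp add: q_nat)
    also have "\<dots> = q (of_int \<lfloor>real n * c\<rfloor> + frac (real n * c))" by (simp add: frac_def)
    also have "\<dots> = q (frac (real n * c))" by (simp add: q_add q_int del: of_int_floor_le)
    finally have "\<bar>real n * q c\<bar> \<le> C" using qb[of "frac (real n * c)"] frac_lt_1[of "real n * c"] by simp
    then show ?thesis by (simp add: abs_mult)
  qed
  have "q c = 0"
  proof (rule ccontr)
    assume "q c \<noteq> 0"
    then obtain n :: nat where "C / \<bar>q c\<bar> < n" using reals_Archimedean2 by blast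
    then have "C < real n * \<bar>q c\<bar>" using \<open>q c \<noteq> 0\<close> by (simp add: field_simps)
    then show False using nb[of n] by simp
  qed
  then show ?thesis by (simp add: q_def)
qed

context boundedly_finite
begin

lemma Ch_form_self: "f \<in> W12 m \<Longrightarrow> Ch_form m f f = Chr f"
  using W12_cmult(2)[of f 2] W12_zero(2) by (simp add: Ch_form_def)

lemma Ch_form_commute: "f \<in> W12 m \<Longrightarrow> g \<in> W12 m \<Longrightarrow> Ch_form m f g = Ch_form m g f"
  unfolding Ch_form_def by (simp add: Chr_swap[of f g] add.commute)

lemma Chr_parallelogram:
  assumes H: "infinitesimally_Hilbertian m" and f: "f \<in> W12 m" and g: "g \<in> W12 m"
  shows "Chr (\<lambda>x. f x + g x) + Chr (\<lambda>x. f x - g x) = 2 * Chr f + 2 * Chr g"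
proof -
  have fin: "Ch m (\<lambda>x. f x + g x) < top" "Ch m (\<lambda>x. f x - g x) < top" "Ch m f < top" "Ch m g < top"
    using W12_add(1)[OF f g] W12_diff(1)[OF f g] f g by (simp_all add: W12_iff)
  have "Ch m (\<lambda>x. f x + g x) + Ch m (\<lambda>x. f x - g x) = 2 * Ch m f + 2 * Ch m g"
    using H f g by (simp add: infinitesimally_Hilbertian_def)
  then have "enn2real (Ch m (\<lambda>x. f x + g x) + Ch m (\<lambda>x. f x - g x)) = enn2real (2 * Ch m f + 2 * Ch m g)"
    by simp
  then show ?thesis using fin by (simp add: enn2real_plus enn2real_mult ennreal_mult_less_top)
qed

text \<open>For an optimal sequence h, the energy of f - h is 2 \<open>Chr f\<close> plus twice the
  energy of h minus the energy of f + h. As f + h tends to 2 f, the subtracted term is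
  asymptotically at least 4 \<open>Chr f\<close>, while the energy of h is asymptotically at most
  \<open>Chr f\<close>.\<close>

lemma W12_strong_approx:
  assumes H: "infinitesimally_Hilbertian m" and f: "f \<in> W12 m" and e: "(e::real) > 0"
  shows "\<exists>h\<in>Lip_bs. Chr (\<lambda>x. f x - h x) + sqnorm m (\<lambda>x. f x - h x) < e"
proof -
  obtain h where h: "\<And>n. h n \<in> Lip_bs" "L2_conv m h f" "(\<lambda>n. sqnorm m (slope (h n))) \<longlonglongrightarrow> Chr f"
    by (rule W12_optimal_sequence[OF f]) (rule that)
  have hW: "h n \<in> W12 m" for n by (rule Lip_bs_W12[OF h(1)])
  have par: "Chr (\<lambda>x. f x + h n x) + Chr (\<lambda>x. f x - h n x) = 2 * Chr f + 2 * Chr (h n)" for n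
    by (rule Chr_parallelogram[OF H f hW])
  have sum_lim: "L2_conv m (\<lambda>n x. f x + h n x) (\<lambda>x. 2 * f x)"
    using L2_conv_add[OF L2_conv_const[OF W12_L2[OF f]] h(2)] by simp
  \<comment> \<open>Otherwise infinitely many indices violate the bound, and lower semicontinuity
    along them contradicts that 2 f has four times the energy of f.\<close>
  have lower: "\<forall>\<^sub>F n in sequentially. 4 * Chr f - e / 2 < Chr (\<lambda>x. f x + h n x)"
  proof (rule ccontr)
    assume "\<not> ?thesis"
    then have "\<exists>\<^sub>F n in sequentially. Chr (\<lambda>x. f x + h n x) \<le> 4 * Chr f - e / 2"
      by (simp add: not_eventually not_less)
    then have inf: "infinite {n. Chr (\<lambda>x. f x + h n x) \<le> 4 * Chr f - e / 2}"
      unfolding cofinite_eq_sequentially[symmetric] frequently_cofinite .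
    obtain r :: "nat \<Rightarrow> nat" where "strict_mono r" "\<forall>n. r n \<in> {n. Chr (\<lambda>x. f x + h n x) \<le> 4 * Chr f - e / 2}"
      using infinite_enumerate[OF inf] by (elim exE conjE) (rule that)
    then have r: "strict_mono r" "\<And>n. Chr (\<lambda>x. f x + h (r n) x) \<le> 4 * Chr f - e / 2" by simp_all
    have conv: "L2_conv m (\<lambda>n x. f x + h (r n) x) (\<lambda>x. 2 * f x)"
      using L2_conv_subseq[OF sum_lim r(1)] .
    have "Chr (\<lambda>x. 2 * f x) \<le> 4 * Chr f - e / 2"
      by (rule Ch_lower_semicontinuous(2)[where b = "\<lambda>_. 4 * Chr f - e / 2", OF conv W12_add(1)[OF f hW] r(2) tendsto_const])
    then show False using W12_cmult(2)[OF f, of 2] e by simp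
  qed
  have upper: "\<forall>\<^sub>F n in sequentially. sqnorm m (slope (h n)) < Chr f + e / 8"
    using e by (intro order_tendstoD[OF h(3)]) simp
  have close: "\<forall>\<^sub>F n in sequentially. sqnorm m (\<lambda>x. h n x - f x) < e / 4"
    using e by (intro order_tendstoD[OF L2_convD(3)[OF h(2)]]) simp
  from lower upper close have "\<forall>\<^sub>F n in sequentially. Chr (\<lambda>x. f x - h n x) + sqnorm m (\<lambda>x. f x - h n x) < e"
  proof eventually_elim
    case (elim n)
    have "Chr (\<lambda>x. f x - h n x) = 2 * Chr f + 2 * Chr (h n) - Chr (\<lambda>x. f x + h n x)"
      using par[of n] by simp
    moreover have "sqnorm m (\<lambda>x. f x - h n x) = sqnorm m (\<lambda>x. h n x - f x)" by (simp add: power2_commute)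
    ultimately show ?case using elim Lip_bs_W12(2)[OF h(1)[of n]] by linarith
  qed
  then show ?thesis using h(1) by (auto simp: eventually_sequentially)
qed

lemma dirichlet_form_Ch:
  assumes H: "infinitesimally_Hilbertian m"
  shows "dirichlet_form m (Ch_form m) (W12 m)"
proof -
  note par = Chr_parallelogram[OF H]
  have add: "Ch_form m (\<lambda>x. f x + g x) h = Ch_form m f h + Ch_form m g h"
    if f: "f \<in> W12 m" and g: "g \<in> W12 m" and h: "h \<in> W12 m" for f g h
  proof -
    note W = W12_add(1) W12_diff(1) f g h
    \<comment> \<open>The Jordan-von Neumann computation: 1 and 3 minus 2 and 4 is the additivity
      identity up to a factor, since the mixed terms cancel by \<open>s1\<close> and
      \<open>s2\<close>.\<close>
    have 1: "Chr (\<lambda>x. (f x + h x) + g x) + Chr (\<lambda>x. (f x + h x) - g x) = 2 * Chr (\<lambda>x. f x + h x) + 2 * Chr g"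
      by (intro par W)
    have 2: "Chr (\<lambda>x. (f x - h x) + g x) + Chr (\<lambda>x. (f x - h x) - g x) = 2 * Chr (\<lambda>x. f x - h x) + 2 * Chr g"
      by (intro par W)
    have 3: "Chr (\<lambda>x. (g x + h x) + f x) + Chr (\<lambda>x. (g x + h x) - f x) = 2 * Chr (\<lambda>x. g x + h x) + 2 * Chr f"
      by (intro par W)
    have 4: "Chr (\<lambda>x. (g x - h x) + f x) + Chr (\<lambda>x. (g x - h x) - f x) = 2 * Chr (\<lambda>x. g x - h x) + 2 * Chr f"
      by (intro par W)
    have s1: "Chr (\<lambda>x. (f x - h x) - g x) = Chr (\<lambda>x. (g x + h x) - f x)"
    proof -
      have "(\<lambda>x. (f x - h x) - g x) = (\<lambda>x. f x - (g x + h x))" by (simp add: fun_eq_iff)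
      then show ?thesis using Chr_swap[OF f W12_add(1)[OF g h]] by simp
    qed
    have s2: "Chr (\<lambda>x. (g x - h x) - f x) = Chr (\<lambda>x. (f x + h x) - g x)"
    proof -
      have "(\<lambda>x. (g x - h x) - f x) = (\<lambda>x. g x - (f x + h x))" by (simp add: fun_eq_iff)
      then show ?thesis using Chr_swap[OF g W12_add(1)[OF f h]] by simp
    qed
    have e: "(\<lambda>x. (f x + h x) + g x) = (\<lambda>x. f x + g x + h x)" "(\<lambda>x. (g x + h x) + f x) = (\<lambda>x. f x + g x + h x)"
      "(\<lambda>x. (f x - h x) + g x) = (\<lambda>x. f x + g x - h x)" "(\<lambda>x. (g x - h x) + f x) = (\<lambda>x. f x + g x - h x)"
      by (simp_all add: fun_eq_iff)
    show ?thesis using 1 2 3 4 unfolding e s1 s2 Ch_form_def by (simp add: field_simps)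
  qed
  \<comment> \<open>Boundedness of the form in a f and g for |a| \<le> 1 is what upgrades additivity
    to homogeneity.\<close>
  have bound: "\<bar>Ch_form m f g\<bar> \<le> Chr f + Chr g" if f: "f \<in> W12 m" and g: "g \<in> W12 m" for f g
  proof -
    have "\<bar>(a - b) / 4\<bar> \<le> F + G" if "a \<le> 2 * F + 2 * G" "b \<le> 2 * F + 2 * G" "0 \<le> a" "0 \<le> b" "0 \<le> F" "0 \<le> G"
      for a b F G :: real
    proof -
      have "\<bar>a - b\<bar> \<le> 4 * (F + G)" using that by (auto simp: abs_le_iff)
      then show ?thesis by simp
    qed
    then show ?thesis
      unfolding Ch_form_def using W12_add(2)[OF f g] W12_diff(2)[OF f g] by simp
  qed
  have mult: "Ch_form m (\<lambda>x. c * f x) g = c * Ch_form m f g"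
    if f: "f \<in> W12 m" and g: "g \<in> W12 m" for f g c
  proof -
    define p where "p c = Ch_form m (\<lambda>x. c * f x) g" for c
    have "p c = c * p 1"
    proof (rule additive_bounded_imp_linear)
      show "p (a + b) = p a + p b" for a b
        unfolding p_def using add[OF W12_cmult(1)[OF f, of a] W12_cmult(1)[OF f, of b] g]
        by (simp add: distrib_right)
      show "\<bar>p a\<bar> \<le> Chr f + Chr g" if a: "\<bar>a\<bar> \<le> 1" for a
      proof -
        have "a\<^sup>2 * Chr f \<le> 1 * Chr f" using a by (intro mult_right_mono) (auto simp: abs_square_le_1)
        then show ?thesis
          unfolding p_def using bound[OF W12_cmult(1)[OF f, of a] g] W12_cmult(2)[OF f, of a] by linarith
      qed
    qed
    then show ?thesis by (simp add: p_def)
  qed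
  have closed: "\<exists>f\<in>W12 m. (\<lambda>n. Ch_form m (\<lambda>x. u n x - f x) (\<lambda>x. u n x - f x) + sqnorm m (\<lambda>x. u n x - f x)) \<longlonglongrightarrow> 0"
    if u: "\<forall>n. u n \<in> W12 m" and C: "\<forall>e>0. \<exists>n0. \<forall>i\<ge>n0. \<forall>j\<ge>n0.
           Ch_form m (\<lambda>x. u i x - u j x) (\<lambda>x. u i x - u j x) + sqnorm m (\<lambda>x. u i x - u j x) < e" for u
  proof -
    have uW: "u n \<in> W12 m" for n using u by blast
    have C': "\<exists>n0. \<forall>i\<ge>n0. \<forall>j\<ge>n0. Chr (\<lambda>x. u i x - u j x) + sqnorm m (\<lambda>x. u i x - u j x) < e" if "e > 0" for e
      using C that by (simp add: Ch_form_self[OF W12_diff(1)[OF uW uW]])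
    obtain f where f: "L2_conv m u f"
    proof (rule L2_complete)
      show "u n \<in> L2 m" for n by (rule W12_L2[OF uW])
      fix e :: real assume "e > 0"
      then obtain n0 where n0: "\<forall>i\<ge>n0. \<forall>j\<ge>n0. Chr (\<lambda>x. u i x - u j x) + sqnorm m (\<lambda>x. u i x - u j x) < e"
        using C' by blast
      have "sqnorm m (\<lambda>x. u i x - u j x) < e" if "i \<ge> n0" "j \<ge> n0" for i j
        using n0[rule_format, OF that] enn2real_nonneg[of "Ch m (\<lambda>x. u i x - u j x)"] by linarith
      then show "\<exists>n0. \<forall>i\<ge>n0. \<forall>j\<ge>n0. sqnorm m (\<lambda>x. u i x - u j x) < e" by blast
    qed
    \<comment> \<open>For fixed i the energy of u i - u j is bounded for large j; the index shift by
      n0 makes the bound hold along a whole sequence, and lower semicontinuity transfers it to u i -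
      f.\<close>
    have lsc: "(\<lambda>x. u i x - f x) \<in> W12 m \<and> Chr (\<lambda>x. u i x - f x) \<le> e"
      if le: "\<And>j. j \<ge> n0 \<Longrightarrow> Chr (\<lambda>x. u i x - u j x) \<le> e" for i n0 e
    proof -
      have "strict_mono (\<lambda>n. n + n0)" by (simp add: strict_mono_def)
      from L2_conv_diff[OF L2_conv_const[OF W12_L2[OF uW[of i]]] L2_conv_subseq[OF f this]]
      have conv: "L2_conv m (\<lambda>n x. u i x - u (n + n0) x) (\<lambda>x. u i x - f x)" .
      show ?thesis
        using Ch_lower_semicontinuous[OF conv W12_diff(1)[OF uW uW] _ tendsto_const, of e] le by auto
    qed
    obtain n1 where n1: "\<forall>i\<ge>n1. \<forall>j\<ge>n1. Chr (\<lambda>x. u i x - u j x) + sqnorm m (\<lambda>x. u i x - u j x) < 1"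
      using C'[of 1] by auto
    have "Chr (\<lambda>x. u n1 x - u j x) \<le> 1" if j: "j \<ge> n1" for j
    proof -
      have "0 \<le> sqnorm m (\<lambda>x. u n1 x - u j x)" by simp
      then show ?thesis using n1[rule_format, OF order_refl j] by linarith
    qed
    then have "(\<lambda>x. u n1 x - f x) \<in> W12 m" using lsc by blast
    then have fW: "f \<in> W12 m" using W12_diff(1)[OF uW[of n1], of "\<lambda>x. u n1 x - f x"] by simp
    have "(\<lambda>n. Chr (\<lambda>x. u n x - f x)) \<longlonglongrightarrow> 0"
    proof (rule LIMSEQ_I)
      fix e :: real assume "e > 0"
      then obtain n0 where n0: "\<forall>i\<ge>n0. \<forall>j\<ge>n0. Chr (\<lambda>x. u i x - u j x) + sqnorm m (\<lambda>x. u i x - u j x) < e / 2"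
        using C'[of "e / 2"] by auto
      have "norm (Chr (\<lambda>x. u i x - f x) - 0) < e" if i: "i \<ge> n0" for i
      proof -
        have "Chr (\<lambda>x. u i x - u j x) \<le> e / 2" if j: "j \<ge> n0" for j
        proof -
          have "0 \<le> sqnorm m (\<lambda>x. u i x - u j x)" by simp
          then show ?thesis using n0[rule_format, OF i j] by linarith
        qed
        then have "Chr (\<lambda>x. u i x - f x) \<le> e / 2" using lsc by blast
        then show ?thesis using \<open>e > 0\<close> by simp
      qed
      then show "\<exists>no. \<forall>n\<ge>no. norm (Chr (\<lambda>x. u n x - f x) - 0) < e" by blast
    qed
    then have "(\<lambda>n. Chr (\<lambda>x. u n x - f x) + sqnorm m (\<lambda>x. u n x - f x)) \<longlonglongrightarrow> 0 + 0"
      by (intro tendsto_add L2_convD(3)[OF f])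
    then show ?thesis
      using fW Ch_form_self[OF W12_diff(1)[OF uW fW]] by (intro bexI[of _ f]) auto
  qed
  have markov: "(\<lambda>x. min (max (f x) 0) 1) \<in> W12 m"
    "Chr (\<lambda>x. min (max (f x) 0) 1) \<le> Chr f" if f: "f \<in> W12 m" for f
  proof -
    have "\<bar>min (max t 0) 1 - min (max s 0) 1\<bar> \<le> 1 * \<bar>t - s\<bar>" for s t :: real
      by (auto simp: min_def max_def abs_if)
    from W12_comp[OF f, of "\<lambda>t. min (max t 0) 1", OF this]
    show "(\<lambda>x. min (max (f x) 0) 1) \<in> W12 m" "Chr (\<lambda>x. min (max (f x) 0) 1) \<le> Chr f" by auto
  qed
  have dense: "\<exists>u. (\<forall>n. u n \<in> W12 m) \<and> L2_conv m u f" if f: "f \<in> L2 m" for f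
  proof -
    have ex: "\<exists>h\<in>L2 m. sqnorm m (\<lambda>x. h x - f x) < e \<and> h \<in> W12 m" if "e > 0" for e
      using Lip_bs_dense[OF f that] Lip_bs_L2 Lip_bs_W12(1) by blast
    obtain F where "L2_conv m F f" "\<And>n. F n \<in> W12 m"
      by (rule L2_approx_sequence[OF f ex]) (assumption | rule that)+
    then show ?thesis by blast
  qed
  have cong: "g \<in> W12 m" if "f \<in> W12 m" "g \<in> borel_measurable m" "AE x in m. f x = g x" for f g
    using that Ch_cong_AE[OF that(3)] L2_borel[OF W12_L2[OF that(1)]] by (simp add: W12_iff)
  have cong2: "Ch_form m f g = Ch_form m f' g"
    if f: "f \<in> W12 m" and f': "f' \<in> W12 m" and g: "g \<in> W12 m" and eq: "AE x in m. f x = f' x" for f f' g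
  proof -
    note bm = L2_borel[OF W12_L2[OF f]] L2_borel[OF W12_L2[OF f']] L2_borel[OF W12_L2[OF g]]
    have "Ch m (\<lambda>x. f x + g x) = Ch m (\<lambda>x. f' x + g x)" "Ch m (\<lambda>x. f x - g x) = Ch m (\<lambda>x. f' x - g x)"
      using eq bm by (auto intro!: Ch_cong_AE)
    then show ?thesis by (simp add: Ch_form_def)
  qed
  show ?thesis
    unfolding dirichlet_form_def
  proof (intro conjI)
    show "W12 m \<subseteq> L2 m" using W12_L2 by (rule subsetI)
    show "\<forall>f\<in>W12 m. \<forall>g\<in>borel_measurable m. (AE x in m. f x = g x) \<longrightarrow> g \<in> W12 m"
      by (intro ballI impI, rule cong)
    show "\<forall>f\<in>W12 m. \<forall>f'\<in>W12 m. \<forall>g\<in>W12 m. (AE x in m. f x = f' x) \<longrightarrow> Ch_form m f g = Ch_form m f' g"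
      by (intro ballI impI, rule cong2)
    show "(\<lambda>x. 0) \<in> W12 m" by (rule W12_zero)
    show "\<forall>f\<in>W12 m. \<forall>g\<in>W12 m. (\<lambda>x. f x + g x) \<in> W12 m" by (intro ballI, rule W12_add(1))
    show "\<forall>c. \<forall>f\<in>W12 m. (\<lambda>x. c * f x) \<in> W12 m" by (intro allI ballI, rule W12_cmult(1))
    show "\<forall>f\<in>L2 m. \<exists>u. (\<forall>n. u n \<in> W12 m) \<and> L2_conv m u f" by (intro ballI dense)
    show "\<forall>f\<in>W12 m. \<forall>g\<in>W12 m. \<forall>h\<in>W12 m. Ch_form m (\<lambda>x. f x + g x) h = Ch_form m f h + Ch_form m g h"
      by (intro ballI add)
    show "\<forall>c. \<forall>f\<in>W12 m. \<forall>g\<in>W12 m. Ch_form m (\<lambda>x. c * f x) g = c * Ch_form m f g"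
      by (intro allI ballI mult)
    show "\<forall>f\<in>W12 m. \<forall>g\<in>W12 m. Ch_form m f g = Ch_form m g f" by (intro ballI Ch_form_commute)
    show "\<forall>f\<in>W12 m. 0 \<le> Ch_form m f f"
    proof
      show "0 \<le> Ch_form m f f" if "f \<in> W12 m" for f by (simp add: Ch_form_self[OF that])
    qed
    show "\<forall>f\<in>W12 m. (\<lambda>x. min (max (f x) 0) 1) \<in> W12 m \<and>
        Ch_form m (\<lambda>x. min (max (f x) 0) 1) (\<lambda>x. min (max (f x) 0) 1) \<le> Ch_form m f f"
    proof
      show "(\<lambda>x. min (max (f x) 0) 1) \<in> W12 m \<and>
        Ch_form m (\<lambda>x. min (max (f x) 0) 1) (\<lambda>x. min (max (f x) 0) 1) \<le> Ch_form m f f" if f: "f \<in> W12 m" for f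
        using markov[OF f] by (simp add: Ch_form_self[OF f] Ch_form_self[OF markov(1)[OF f]])
    qed
  next
    show "\<forall>u. (\<forall>n. u n \<in> W12 m) \<and> (\<forall>e>0. \<exists>n0. \<forall>i\<ge>n0. \<forall>j\<ge>n0.
        Ch_form m (\<lambda>x. u i x - u j x) (\<lambda>x. u i x - u j x) + sqnorm m (\<lambda>x. u i x - u j x) < e) \<longrightarrow>
        (\<exists>f\<in>W12 m. (\<lambda>n. Ch_form m (\<lambda>x. u n x - f x) (\<lambda>x. u n x - f x) + sqnorm m (\<lambda>x. u n x - f x)) \<longlonglongrightarrow> 0)"
      by (intro allI impI, elim conjE, rule closed)
  qed
qed

section \<open>Regularity and strong locality of the form\<close>

lemma Lip_bs_C0:
  fixes f :: "'a \<Rightarrow> real"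
  assumes proper: "\<And>B::'a set. bounded B \<Longrightarrow> compact (closure B)" and f: "f \<in> Lip_bs"
  shows "f \<in> C0"
  unfolding C0_def
proof (intro CollectI conjI allI impI)
  show "continuous_on UNIV f" by (rule Lip_bs_continuous[OF f])
  fix e :: real assume "e > 0"
  have "compact (closure {x. f x \<noteq> 0})" using f by (intro proper) (auto simp: Lip_bs_def)
  moreover have "\<bar>f x\<bar> < e" if "x \<notin> closure {x. f x \<noteq> 0}" for x
    using that closure_subset[of "{x. f x \<noteq> 0}"] \<open>e > 0\<close> by (cases "f x = 0") auto
  ultimately show "\<exists>C. compact C \<and> (\<forall>x. x \<notin> C \<longrightarrow> \<bar>f x\<bar> < e)" by blast
qed

text \<open>The inf-convolution \<open>x \<mapsto> inf\<^sub>y (f y + n d(x, y))\<close> of a uniformly continuous bounded function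
  is Lipschitz and uniformly close to \<open>f\<close>; soft thresholding then makes the support bounded.\<close>

lemma C0_uniform_approx:
  fixes f :: "'a \<Rightarrow> real"
  assumes proper: "\<And>B::'a set. bounded B \<Longrightarrow> compact (closure B)" and f: "f \<in> C0" and e: "e > 0"
  shows "\<exists>g\<in>Lip_bs. \<forall>x. \<bar>f x - g x\<bar> < e"
proof -
  define d where "d = e / 8"
  have d: "d > 0" using e by (simp add: d_def)
  have cont: "continuous_on UNIV f" using f by (simp add: C0_def)
  obtain C where C: "compact C" "\<And>x. x \<notin> C \<Longrightarrow> \<bar>f x\<bar> < d" using f d by (auto simp: C0_def)
  obtain c0 R where R: "C \<subseteq> cball c0 R"
    using compact_imp_bounded[OF C(1)] by (auto simp: bounded_subset_cball)
  \<comment> \<open>One unit of room around C: two points at distance below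
    \<open>s' \<le> 1\<close>, one of them in C, both lie in the compact set D.\<close>
  define D where "D = closure (cball c0 (R + 1))"
  have D: "compact D" unfolding D_def by (intro proper) simp
  have D': "cball c0 (R + 1) \<subseteq> D" unfolding D_def by (rule closure_subset)
  have "uniformly_continuous_on D f"
    using D cont by (intro compact_uniformly_continuous continuous_on_subset[OF cont]) auto
  then obtain s where s: "s > 0" "\<And>x y. x \<in> D \<Longrightarrow> y \<in> D \<Longrightarrow> dist x y < s \<Longrightarrow> dist (f x) (f y) < d"
    using d unfolding uniformly_continuous_on_def by metis
  define s' where "s' = min s 1"
  have s': "s' > 0" using s by (simp add: s'_def)
  have unif: "\<bar>f x - f y\<bar> \<le> 2 * d" if "dist x y < s'" for x y
  proof (cases "x \<in> C \<or> y \<in> C")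
    case True
    have "x \<in> cball c0 (R + 1) \<and> y \<in> cball c0 (R + 1)"
      using True R that dist_triangle[of c0 x y] dist_triangle[of c0 y x]
      by (auto simp: s'_def dist_commute subset_iff)
    then have "dist (f x) (f y) < d" using that D' by (intro s(2)) (auto simp: s'_def)
    then show ?thesis using d by (simp add: dist_real_def)
  next
    case False
    then show ?thesis using C(2)[of x] C(2)[of y] by linarith
  qed
  have "\<exists>M>0. \<forall>x. \<bar>f x\<bar> \<le> M"
  proof -
    have "bounded (f ` C)" by (intro compact_imp_bounded compact_continuous_image continuous_on_subset[OF cont] C) auto
    then obtain M where M: "\<And>x. x \<in> C \<Longrightarrow> \<bar>f x\<bar> \<le> M" by (auto simp: bounded_iff)
    have "\<bar>f x\<bar> \<le> max M d" for x
    proof (cases "x \<in> C")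
      case True then show ?thesis using M[of x] by simp
    next
      case False then show ?thesis using C(2)[of x] by simp
    qed
    then show ?thesis using d by (intro exI[of _ "max M d"]) auto
  qed
  then obtain M where M: "M > 0" "\<And>x. \<bar>f x\<bar> \<le> M" by blast
  \<comment> \<open>At distance s' or more the penalty n d(x, y) is at least 2 M, the largest
    possible oscillation of f, so such y cannot push the infimum below f x.\<close>
  define n where "n = 2 * M / s'"
  have n: "n \<ge> 0" using M s' by (simp add: n_def)
  define g where "g x = (INF y. f y + n * dist x y)" for x
  have bdd: "bdd_below (range (\<lambda>y. f y + n * dist x y))" for x
  proof (rule bdd_belowI2)
    fix y
    have "0 \<le> n * dist x y" using n by simp
    then show "- M \<le> f y + n * dist x y" using M(2)[of y] by linarith
  qed
  have g_le: "g x \<le> f y + n * dist x y" for x y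
    unfolding g_def by (rule cINF_lower[OF bdd]) simp
  have g_ge: "f x - 2 * d \<le> g x" for x
    unfolding g_def
  proof (rule cINF_greatest)
    fix y
    show "f x - 2 * d \<le> f y + n * dist x y"
    proof (cases "dist x y < s'")
      case True
      have "0 \<le> n * dist x y" using n by simp
      then show ?thesis using unif[OF True] by linarith
    next
      case False
      then have "n * s' \<le> n * dist x y" using n by (intro mult_left_mono) auto
      then have "2 * M \<le> n * dist x y" using s' by (simp add: n_def)
      then show ?thesis using M(2)[of x] M(2)[of y] d by linarith
    qed
  qed simp
  have g_lip: "g x - g y \<le> n * dist x y" for x y
  proof -
    have "g x - n * dist x y \<le> g y"
      unfolding g_def[of y]
    proof (rule cINF_greatest)
      fix z
      have "n * dist x z \<le> n * dist x y + n * dist y z"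
        using mult_left_mono[OF dist_triangle[of x z y] n] by (simp add: distrib_left)
      then show "g x - n * dist x y \<le> f z + n * dist y z" using g_le[of x z] by linarith
    qed simp
    then show ?thesis by simp
  qed
  \<comment> \<open>Off C the function g is at most d + 2 d in absolute value, so thresholding at 3
    d makes it vanish there; the total error is at most 2 d + 3 d < 8 d = e.\<close>
  define h where "h x = g x - min (max (g x) (- (d * 3))) (d * 3)" for x
  have fg: "\<bar>f x - g x\<bar> \<le> 2 * d" for x using g_ge[of x] g_le[of x x] d by simp
  have "\<bar>h x - h y\<bar> \<le> n * dist x y" for x y
  proof -
    have "\<bar>h x - h y\<bar> \<le> \<bar>g x - g y\<bar>" unfolding h_def by linarith
    also have "\<bar>g x - g y\<bar> \<le> n * dist x y" using g_lip[of x y] g_lip[of y x] by (simp add: dist_commute abs_le_iff)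
    finally show ?thesis .
  qed
  then have "n-lipschitz_on UNIV h" using n by (intro lipschitz_onI_real)
  moreover have "{x. h x \<noteq> 0} \<subseteq> C"
  proof
    fix x assume hx: "x \<in> {x. h x \<noteq> 0}"
    show "x \<in> C"
    proof (rule ccontr)
      assume "x \<notin> C"
      then have "\<bar>g x\<bar> \<le> d * 3" using C(2)[of x] fg[of x] by linarith
      then show False using hx by (auto simp: h_def abs_le_iff min_def max_def split: if_splits)
    qed
  qed
  then have "bounded {x. h x \<noteq> 0}" using bounded_subset compact_imp_bounded[OF C(1)] by blast
  ultimately have "h \<in> Lip_bs" by (auto simp: Lip_bs_def)
  moreover have "\<bar>f x - h x\<bar> < e" for x
    using fg[of x] e unfolding h_def d_def by linarith
  ultimately show ?thesis by blast
qed

lemma regular_form_Ch: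
  assumes H: "infinitesimally_Hilbertian m"
    and proper: "\<And>B::'a set. bounded B \<Longrightarrow> compact (closure B)"
  shows "regular_form m (Ch_form m) (W12 m)"
  unfolding regular_form_def
proof (intro conjI ballI allI impI)
  fix f and e :: real assume f: "f \<in> W12 m" and "e > 0"
  then obtain h where h: "h \<in> Lip_bs" "Chr (\<lambda>x. f x - h x) + sqnorm m (\<lambda>x. f x - h x) < e\<^sup>2"
    using W12_strong_approx[OF H f, of "e\<^sup>2"] by auto
  then have "sqrt (Chr (\<lambda>x. f x - h x) + sqnorm m (\<lambda>x. f x - h x)) < sqrt (e\<^sup>2)"
    by (intro real_sqrt_less_mono)
  then show "\<exists>g\<in>W12 m \<inter> C0. sqrt (Ch_form m (\<lambda>x. f x - g x) (\<lambda>x. f x - g x) + sqnorm m (\<lambda>x. f x - g x)) < e"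
    using h(1) Lip_bs_W12(1)[OF h(1)] Lip_bs_C0[OF proper h(1)] \<open>e > 0\<close>
    by (intro bexI[of _ h]) (auto simp: Ch_form_self[OF W12_diff(1)[OF f]])
next
  fix f :: "'a \<Rightarrow> real" and e :: real assume "f \<in> C0" "e > 0"
  then obtain g where "g \<in> Lip_bs" "\<forall>x. \<bar>f x - g x\<bar> < e"
    using C0_uniform_approx[OF proper] by blast
  then show "\<exists>g\<in>W12 m \<inter> C0. \<forall>x. \<bar>f x - g x\<bar> < e"
    using Lip_bs_W12(1) Lip_bs_C0[OF proper] by blast
qed

text \<open>If \<open>h\<^sub>n \<rightarrow> f + g\<close>, reflecting \<open>h\<^sub>n\<close> at the level \<open>c\<close> near the support of \<open>g\<close> yields functions
  with the same slope up to an error supported where \<open>h\<^sub>n \<rightarrow> c\<close>, and these converge to \<open>f - g\<close>.\<close>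

lemma Ch_reflect_le:
  assumes f: "f \<in> W12 m" and g: "g \<in> W12 m" and S: "compact S" "S \<noteq> {}" "open U" "S \<subseteq> U"
    and g0: "AE x in m. x \<notin> S \<longrightarrow> g x = 0" and fc: "AE x in m. x \<in> U \<longrightarrow> f x = c"
  shows "Chr (\<lambda>x. f x - g x) \<le> Chr (\<lambda>x. f x + g x)"
proof -
  note fg = W12_add(1)[OF f g] and fgL = L2_diff[OF W12_L2[OF f] W12_L2[OF g]]
  obtain h where h: "\<And>n. h n \<in> Lip_bs" "L2_conv m h (\<lambda>x. f x + g x)"
    "(\<lambda>n. sqnorm m (slope (h n))) \<longlonglongrightarrow> Chr (\<lambda>x. f x + g x)"
    by (rule W12_optimal_sequence[OF fg]) (rule that)
  obtain N where N: "\<And>n x. n \<ge> N \<Longrightarrow> infdist x S \<le> 1 / real (Suc n) \<Longrightarrow> x \<in> U"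
    by (rule infdist_le_subset_open[OF S]) (rule that)
  \<comment> \<open>Doubling and capping the cutoff makes \<eta> equal to 1 on a neighbourhood of S,
    so its slope vanishes on S as well as off F. The slope is thus confined to F - S, where f = c
    and g = 0 almost everywhere.\<close>
  define \<eta> where "\<eta> x = min 1 (2 * cutoff S N x)" for x
  define L where "L = 2 * real (Suc N)"
  define F where "F = {x. infdist x S \<le> 1 / real (Suc N)}"
  have FU: "x \<in> U" if "x \<in> F" for x using N[of N x] that by (simp add: F_def)
  have F_closed: "closed F" unfolding F_def by (intro closed_Collect_le continuous_intros)
  have \<eta>F: "\<eta> x = 0" if "x \<notin> F" for x using that by (simp add: \<eta>_def F_def cutoff_eq_0)
  have \<eta>L: "L-lipschitz_on UNIV \<eta>"
  proof (rule lipschitz_onI_real)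
    fix x y
    have "\<bar>\<eta> x - \<eta> y\<bar> \<le> 2 * \<bar>cutoff S N y - cutoff S N x\<bar>" by (auto simp: \<eta>_def min_def abs_if)
    also have "\<dots> \<le> 2 * (real (Suc N) * dist x y)" by (intro mult_left_mono lipschitz_onD_real[OF cutoff_lipschitz]) auto
    finally show "\<bar>\<eta> x - \<eta> y\<bar> \<le> L * dist x y" by (simp add: L_def algebra_simps)
  qed (simp add: L_def)
  have \<eta>b: "0 \<le> \<eta> x" "\<eta> x \<le> 1" for x using cutoff_bounds[of S N x] by (auto simp: \<eta>_def)
  have \<eta>_Lip: "\<eta> \<in> Lip_bs"
  proof (rule Lip_bs_comp[OF cutoff_Lip_bs[OF compact_imp_bounded[OF S(1)] S(2)]])
    show "\<bar>\<eta> y - \<eta> x\<bar> \<le> 2 * \<bar>cutoff S N y - cutoff S N x\<bar>" for x y by (auto simp: \<eta>_def min_def abs_if)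
  qed (auto simp: \<eta>_def)
  have \<eta>m: "\<eta> \<in> borel_measurable borel" unfolding \<eta>_def by measurable
  define k where "k n x = \<eta> x * (2 * c - h n x) + (1 - \<eta> x) * h n x" for n x
  \<comment> \<open>In this form, with the bounded Lipschitz coefficient 1 - 2 \<eta>, the
    reflection visibly stays in \<open>Lip_bs\<close> and converges in L^2; the defining form
    displays the slope estimate.\<close>
  have k_eq: "k n x = 2 * c * \<eta> x + (1 - 2 * \<eta> x) * h n x" for n x by (simp add: k_def algebra_simps)
  have L12: "(2 * L)-lipschitz_on UNIV (\<lambda>x. 1 - 2 * \<eta> x)"
  proof (rule lipschitz_onI_real)
    show "\<bar>1 - 2 * \<eta> x - (1 - 2 * \<eta> y)\<bar> \<le> 2 * L * dist x y" for x y
      using lipschitz_onD_real[OF \<eta>L, of x y] by (simp add: dist_commute abs_if split: if_splits)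
  qed (simp add: L_def)
  have b12: "\<bar>1 - 2 * \<eta> x\<bar> \<le> 1" for x using \<eta>b[of x] by simp
  have k_Lip: "k n \<in> Lip_bs" for n
    unfolding k_eq[abs_def] by (intro Lip_bs_add Lip_bs_cmult \<eta>_Lip Lip_bs_bounded_mult[OF h(1) L12 b12])
  have "L2_conv m k (\<lambda>x. 2 * c * \<eta> x + (1 - 2 * \<eta> x) * (f x + g x))"
    unfolding k_eq[abs_def]
    using \<eta>m by (intro L2_conv_add L2_conv_const L2_cmult Lip_bs_L2 \<eta>_Lip L2_conv_bounded_mult[OF h(2) _ b12]) auto
  moreover have "AE x in m. 2 * c * \<eta> x + (1 - 2 * \<eta> x) * (f x + g x) = f x - g x"
    using g0 fc
  proof eventually_elim
    case (elim x)
    consider "x \<in> S" | "x \<notin> S" "x \<in> U" | "x \<notin> U" using S by blast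
    then show ?case
    proof cases
      case 1
      then have "\<eta> x = 1" "f x = c" using elim S by (auto simp: \<eta>_def cutoff_eq_1)
      then show ?thesis by simp
    next
      case 2
      then show ?thesis using elim by (simp add: algebra_simps)
    next
      case 3
      then have "\<eta> x = 0" "g x = 0" using elim S \<eta>F FU by auto
      then show ?thesis by simp
    qed
  qed
  ultimately have k_conv: "L2_conv m k (\<lambda>x. f x - g x)"
    by (rule L2_conv_cong_AE) (use L2_measurable[OF fgL] in simp)
  have slope_\<eta>: "slope \<eta> x \<le> L * indicator (F - S) x" for x
  proof (cases "x \<in> F - S")
    case True then show ?thesis using slope_le_lipschitz[OF \<eta>L] by simp
  next
    case False
    have "slope \<eta> x = 0"
    proof (cases "x \<in> S")
      case True
      show ?thesis
      proof (rule slope_eq_0_open)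
        show "open {y. cutoff S N y > 1/2}"
          by (intro open_Collect_less continuous_intros lipschitz_on_continuous_on[OF cutoff_lipschitz])
      qed (use True in \<open>auto simp: \<eta>_def cutoff_eq_1\<close>)
    next
      case False
      then show ?thesis using \<open>x \<notin> F - S\<close> \<eta>F by (intro slope_eq_0_outside[OF F_closed]) auto
    qed
    then show ?thesis using False by simp
  qed
  \<comment> \<open>The gluing error. On F - S the limit f + g equals c almost everywhere, so |2 c -
    2 h n| is twice the distance of h n from its limit and the error tends to 0 in L^2.\<close>
  define r where "r n x = L * indicator (F - S) x * \<bar>2 * c - 2 * h n x\<bar>" for n x
  have SF: "F - S \<in> sets borel" using F_closed compact_imp_closed[OF S(1)] by auto
  define d where "d n x = h n x - (f x + g x)" for n x
  have dL: "d n \<in> L2 m" for n unfolding d_def by (intro L2_diff Lip_bs_L2 h W12_L2[OF fg])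
  have rm: "r n \<in> borel_measurable m" for n
    unfolding r_def using SF L2_borel[OF Lip_bs_L2[OF h(1)[of n]]] by auto
  have rd: "AE x in m. \<bar>r n x\<bar> \<le> \<bar>2 * L * d n x\<bar>" for n
    using g0 fc
  proof eventually_elim
    case (elim x)
    show ?case
    proof (cases "x \<in> F - S")
      case True
      then have "f x = c" "g x = 0" using elim FU by auto
      then have "\<bar>2 * c - 2 * h n x\<bar> = 2 * \<bar>d n x\<bar>" by (simp add: d_def abs_if)
      then show ?thesis using True by (simp add: r_def L_def abs_mult algebra_simps)
    qed (simp add: r_def)
  qed
  have rL: "r n \<in> L2 m" for n by (rule L2_bound[OF L2_cmult[OF dL] rm rd])
  have r_le: "sqnorm m (r n) \<le> (2 * L)\<^sup>2 * sqnorm m (d n)" for n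
    using sqnorm_mono[OF L2_cmult[OF dL] rm rd] by (simp only: sqnorm_cmult)
  have r0: "(\<lambda>n. sqnorm m (r n)) \<longlonglongrightarrow> 0"
  proof (rule tendsto_sandwich[OF _ _ tendsto_const])
    show "(\<lambda>n. (2 * L)\<^sup>2 * sqnorm m (d n)) \<longlonglongrightarrow> 0"
      unfolding d_def by (rule tendsto_eq_intros refl L2_convD(3)[OF h(2)])+ simp
  qed (use r_le in auto)
  have k_slope: "slope (k n) x \<le> slope (h n) x + r n x" for n x
  proof -
    obtain M where M: "M-lipschitz_on UNIV (h n)" using h(1)[of n] by (auto simp: Lip_bs_def)
    have M': "M-lipschitz_on UNIV (\<lambda>x. 2 * c - h n x)"
      using lipschitz_on_diff[OF lipschitz_on_constant[of UNIV "2 * c"] M] by simp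
    have "slope (k n) x \<le> \<eta> x * slope (\<lambda>x. 2 * c - h n x) x + (1 - \<eta> x) * slope (h n) x
        + slope \<eta> x * \<bar>(2 * c - h n x) - h n x\<bar>"
      unfolding k_def[abs_def] by (rule slope_cut_le[OF M' M \<eta>L \<eta>b])
    also have "\<dots> = slope (h n) x + slope \<eta> x * \<bar>2 * c - 2 * h n x\<bar>"
      by (simp add: slope_diff_const algebra_simps)
    also have "slope \<eta> x * \<bar>2 * c - 2 * h n x\<bar> \<le> r n x"
      unfolding r_def by (intro mult_right_mono slope_\<eta>) auto
    finally show ?thesis by simp
  qed
  define a where "a n = sqnorm m (slope (h n))" for n
  have "sqnorm m (slope (k n)) \<le> a n + 2 * (sqrt (a n) * sqrt (sqnorm m (r n))) + sqnorm m (r n)" for n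
  proof -
    have "sqnorm m (slope (k n)) \<le> sqnorm m (\<lambda>x. slope (h n) x + r n x)"
      by (intro sqnorm_slope_le k_Lip k_slope L2_add slope_L2 h rL)
    also have "\<dots> = a n + 2 * (\<integral>x. slope (h n) x * r n x \<partial>m) + sqnorm m (r n)"
      unfolding a_def by (intro sqnorm_add slope_L2 h rL)
    finally show ?thesis
      using Cauchy_Schwarz_L2_abs[OF slope_L2[OF h(1)[of n]] rL[of n]] by (simp add: a_def abs_le_iff)
  qed
  moreover have "(\<lambda>n. a n + 2 * (sqrt (a n) * sqrt (sqnorm m (r n))) + sqnorm m (r n)) \<longlonglongrightarrow>
      Chr (\<lambda>x. f x + g x) + 2 * (sqrt (Chr (\<lambda>x. f x + g x)) * sqrt 0) + 0"
    unfolding a_def by (intro tendsto_intros h(3) r0)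
  ultimately have "Chr (\<lambda>x. f x - g x) \<le> Chr (\<lambda>x. f x + g x) + 2 * (sqrt (Chr (\<lambda>x. f x + g x)) * sqrt 0) + 0"
    by (rule W12_I_seq(2)[OF k_conv k_Lip])
  then show ?thesis by simp
qed

text \<open>The union that defines the support may be uncountable; by Lindelof countably many of its
  open sets suffice, so the exceptional sets add up to a null set.\<close>

lemma AE_ess_support:
  assumes "g \<in> borel_measurable borel"
  shows "AE x in m. x \<notin> ess_support m g \<longrightarrow> g x = 0"
proof -
  let ?\<U> = "{U. open U \<and> (AE x in m. x \<in> U \<longrightarrow> g x = 0)}"
  obtain \<V> where \<V>: "\<V> \<subseteq> ?\<U>" "countable \<V>" "\<Union> \<V> = \<Union> ?\<U>"
    using Lindelof[of ?\<U>] by blast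
  have "AE x in m. \<forall>U\<in>\<V>. x \<in> U \<longrightarrow> g x = 0"
    using \<V>(1) by (subst AE_ball_countable[OF \<V>(2)]) auto
  then show ?thesis
  proof eventually_elim
    case (elim x)
    then show ?case using \<V>(3) unfolding ess_support_def by blast
  qed
qed

lemma strongly_local_form_Ch: "strongly_local_form m (Ch_form m) (W12 m)"
  unfolding strongly_local_form_def
proof (intro ballI impI, elim conjE exE)
  fix f g U c
  assume f: "f \<in> W12 m" and g: "g \<in> W12 m" and S: "compact (ess_support m g)" "open U" "ess_support m g \<subseteq> U"
    and fc: "AE x in m. x \<in> U \<longrightarrow> f x = c"
  have g0: "AE x in m. x \<notin> ess_support m g \<longrightarrow> g x = 0" by (rule AE_ess_support[OF L2_borel[OF W12_L2[OF g]]])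
  have "Chr (\<lambda>x. f x - g x) = Chr (\<lambda>x. f x + g x)"
  proof (cases "ess_support m g = {}")
    case True
    then have "AE x in m. f x - g x = f x + g x" using g0 by auto
    then have "Ch m (\<lambda>x. f x - g x) = Ch m (\<lambda>x. f x + g x)"
      using L2_borel[OF W12_L2[OF f]] L2_borel[OF W12_L2[OF g]] by (intro Ch_cong_AE) auto
    then show ?thesis by simp
  next
    case False
    \<comment> \<open>The reverse inequality is the reflection applied to -g.\<close>
    have g': "(\<lambda>x. - 1 * g x) \<in> W12 m" by (rule W12_cmult(1)[OF g])
    have g0': "AE x in m. x \<notin> ess_support m g \<longrightarrow> - 1 * g x = 0" using g0 by simp
    show ?thesis
      using Ch_reflect_le[OF f g S(1) False S(2,3) g0 fc] Ch_reflect_le[OF f g' S(1) False S(2,3) g0' fc] by simp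
  qed
  then show "Ch_form m f g = 0" by (simp add: Ch_form_def)
qed

end

section \<open>Minimal relaxed slopes\<close>

context boundedly_finite
begin

text \<open>A strong variant of \<open>relaxed_slopes\<close>: it contains all relaxed slopes by Mazur's lemma, and it is
  stable under gluing along Lipschitz cutoffs.\<close>

definition upper_slopes :: "('a \<Rightarrow> real) \<Rightarrow> ('a \<Rightarrow> real) set" where
  "upper_slopes f = {w \<in> L2 m. \<forall>d>0. \<exists>h\<in>Lip_bs. \<exists>u\<in>L2 m. sqnorm m (\<lambda>x. h x - f x) < d \<and>
     (\<forall>x. slope h x \<le> u x) \<and> sqnorm m (\<lambda>x. u x - w x) < d}"

lemma upper_slopesI:
  assumes "L2_conv m u w" "L2_conv m h f" "\<And>n. h n \<in> Lip_bs" "\<And>n x. slope (h n) x \<le> u n x"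
  shows "w \<in> upper_slopes f"
  unfolding upper_slopes_def
proof (intro CollectI conjI allI impI)
  show "w \<in> L2 m" by (rule L2_convD(2)[OF assms(1)])
  fix d :: real assume "d > 0"
  then have "\<forall>\<^sub>F n in sequentially. sqnorm m (\<lambda>x. h n x - f x) < d \<and> sqnorm m (\<lambda>x. u n x - w x) < d"
    by (intro eventually_conj order_tendstoD[OF L2_convD(3)[OF assms(1)]] order_tendstoD[OF L2_convD(3)[OF assms(2)]])
  then obtain n where "sqnorm m (\<lambda>x. h n x - f x) < d" "sqnorm m (\<lambda>x. u n x - w x) < d"
    by (auto simp: eventually_sequentially)
  then show "\<exists>h\<in>Lip_bs. \<exists>u\<in>L2 m. sqnorm m (\<lambda>x. h x - f x) < d \<and> (\<forall>x. slope h x \<le> u x) \<and> sqnorm m (\<lambda>x. u x - w x) < d"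
    using assms(3,4) L2_convD(1)[OF assms(1)] by blast
qed

lemma upper_slopesE:
  assumes "w \<in> upper_slopes f" "f \<in> L2 m"
  obtains h u where "L2_conv m u w" "L2_conv m h f" "\<And>n. h n \<in> Lip_bs" "\<And>n x. slope (h n) x \<le> u n x"
proof -
  have w: "w \<in> L2 m" using assms(1) by (simp add: upper_slopes_def)
  have "\<forall>n::nat. \<exists>p. fst p \<in> Lip_bs \<and> snd p \<in> L2 m \<and> sqnorm m (\<lambda>x. fst p x - f x) < inverse (real (Suc n)) \<and>
     (\<forall>x. slope (fst p) x \<le> snd p x) \<and> sqnorm m (\<lambda>x. snd p x - w x) < inverse (real (Suc n))"
  proof
    fix n :: nat
    have "0 < inverse (real (Suc n))" by simp
    then obtain h u where "h \<in> Lip_bs" "u \<in> L2 m" "sqnorm m (\<lambda>x. h x - f x) < inverse (real (Suc n))"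
      "\<forall>x. slope h x \<le> u x" "sqnorm m (\<lambda>x. u x - w x) < inverse (real (Suc n))"
      using assms(1) unfolding upper_slopes_def by blast
    then show "\<exists>p. fst p \<in> Lip_bs \<and> snd p \<in> L2 m \<and> sqnorm m (\<lambda>x. fst p x - f x) < inverse (real (Suc n)) \<and>
     (\<forall>x. slope (fst p) x \<le> snd p x) \<and> sqnorm m (\<lambda>x. snd p x - w x) < inverse (real (Suc n))"
      by (intro exI[of _ "(h, u)"]) simp
  qed
  from choice[OF this] obtain p where p: "\<forall>n. fst (p n) \<in> Lip_bs \<and> snd (p n) \<in> L2 m \<and>
     sqnorm m (\<lambda>x. fst (p n) x - f x) < inverse (real (Suc n)) \<and>
     (\<forall>x. slope (fst (p n)) x \<le> snd (p n) x) \<and> sqnorm m (\<lambda>x. snd (p n) x - w x) < inverse (real (Suc n))"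
    by blast
  have "(\<lambda>n. sqnorm m (\<lambda>x. fst (p n) x - f x)) \<longlonglongrightarrow> 0" "(\<lambda>n. sqnorm m (\<lambda>x. snd (p n) x - w x)) \<longlonglongrightarrow> 0"
    by (rule tendsto_sandwich[OF _ _ tendsto_const LIMSEQ_inverse_real_of_nat],
        use p in \<open>auto intro!: always_eventually less_imp_le\<close>)+
  then have "L2_conv m (\<lambda>n. snd (p n)) w" "L2_conv m (\<lambda>n. fst (p n)) f"
    using p assms(2) w by (auto simp: L2_conv_def Lip_bs_L2)
  then show thesis using that[of "\<lambda>n. snd (p n)" "\<lambda>n. fst (p n)"] p by blast
qed

lemma slope_in_upper_slopes: "f \<in> Lip_bs \<Longrightarrow> slope f \<in> upper_slopes f"
  by (rule upper_slopesI[where u = "\<lambda>_. slope f" and h = "\<lambda>_. f"])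
    (auto intro: L2_conv_const slope_L2 Lip_bs_L2)

lemma relaxed_slopes_subset: "relaxed_slopes m f \<subseteq> upper_slopes f"
proof
  fix w assume "w \<in> relaxed_slopes m f"
  then obtain F where F: "\<And>n. F n \<in> Lip_bs" "L2_conv m F f" "L2_weak_conv m (\<lambda>n. slope (F n)) w"
    by (auto simp: relaxed_slopes_def)
  have f: "f \<in> L2 m" using L2_convD[OF F(2)] by blast
  show "w \<in> upper_slopes f"
    unfolding upper_slopes_def
  proof (intro CollectI conjI allI impI)
    show "w \<in> L2 m" using F(3) by (simp add: L2_weak_conv_def)
    fix d :: real assume d: "d > 0"
    \<comment> \<open>The distance constraint is put on the norm, by square roots, so that the
      triangle inequality makes \<open>A\<close> convex: one convex combination then serves
      functions and slopes at the same time.\<close>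
    define A where "A = {u \<in> L2 m. \<exists>h\<in>Lip_bs. sqrt (sqnorm m (\<lambda>x. h x - f x)) < sqrt d \<and> (\<forall>x. slope h x \<le> u x)}"
    have "\<forall>\<^sub>F n in sequentially. sqnorm m (\<lambda>x. F n x - f x) < d"
      using d by (intro order_tendstoD[OF L2_convD(3)[OF F(2)]])
    then obtain n0 where n0: "\<And>n. n \<ge> n0 \<Longrightarrow> sqnorm m (\<lambda>x. F n x - f x) < d"
      by (auto simp: eventually_sequentially)
    obtain u where u: "u \<in> A" "sqnorm m (\<lambda>x. u x - w x) < d"
    proof (rule Mazur_L2[OF _ _ F(3) _ d])
      show "A \<subseteq> L2 m" by (auto simp: A_def)
      show "slope (F n) \<in> A" if "n \<ge> n0" for n
        using n0[OF that] F(1)[of n] slope_L2[OF F(1)] by (auto simp: A_def)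
      fix u v and s :: real assume "u \<in> A" "v \<in> A" and s: "0 \<le> s" "s \<le> 1"
      then obtain h k where h: "h \<in> Lip_bs" "sqrt (sqnorm m (\<lambda>x. h x - f x)) < sqrt d" "\<forall>x. slope h x \<le> u x" "u \<in> L2 m"
        and k: "k \<in> Lip_bs" "sqrt (sqnorm m (\<lambda>x. k x - f x)) < sqrt d" "\<forall>x. slope k x \<le> v x" "v \<in> L2 m"
        by (auto simp: A_def)
      define l where "l x = (1 - s) * h x + s * k x" for x
      have hf: "(\<lambda>x. h x - f x) \<in> L2 m" "(\<lambda>x. k x - f x) \<in> L2 m" by (intro L2_diff Lip_bs_L2 h k f)+
      have "sqnorm m (\<lambda>x. l x - f x) = sqnorm m (\<lambda>x. (1 - s) * (h x - f x) + s * (k x - f x))"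
        by (simp add: l_def algebra_simps)
      also have "\<dots> = (1 - s)\<^sup>2 * sqnorm m (\<lambda>x. h x - f x) + 2 * (1 - s) * s * (\<integral>x. (h x - f x) * (k x - f x) \<partial>m)
          + s\<^sup>2 * sqnorm m (\<lambda>x. k x - f x)" by (rule sqnorm_lincomb[OF hf])
      also have "\<dots> \<le> (1 - s)\<^sup>2 * sqnorm m (\<lambda>x. h x - f x)
          + 2 * (1 - s) * s * (sqrt (sqnorm m (\<lambda>x. h x - f x)) * sqrt (sqnorm m (\<lambda>x. k x - f x)))
          + s\<^sup>2 * sqnorm m (\<lambda>x. k x - f x)"
        using s Cauchy_Schwarz_L2_abs[OF hf] by (intro add_mono mult_left_mono order_refl) (auto simp: abs_le_iff)
      also have "\<dots> = ((1 - s) * sqrt (sqnorm m (\<lambda>x. h x - f x)) + s * sqrt (sqnorm m (\<lambda>x. k x - f x)))\<^sup>2"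
        by (simp add: power2_sum power_mult_distrib mult_ac add_ac)
      finally have "sqrt (sqnorm m (\<lambda>x. l x - f x)) \<le> (1 - s) * sqrt (sqnorm m (\<lambda>x. h x - f x)) + s * sqrt (sqnorm m (\<lambda>x. k x - f x))"
        using s by (intro real_le_lsqrt) auto
      also have "\<dots> < sqrt d"
        by (rule convex_bound_lt) (use h k s in auto)
      finally have close: "sqrt (sqnorm m (\<lambda>x. l x - f x)) < sqrt d" .
      obtain L M where LM: "L-lipschitz_on UNIV h" "M-lipschitz_on UNIV k" using h k by (auto simp: Lip_bs_def)
      have "slope l x \<le> (1 - s) * u x + s * v x" for x
      proof -
        have "slope l x \<le> (1 - s) * slope h x + s * slope k x"
          unfolding l_def[abs_def] by (rule slope_convex_le[OF LM s])
        also have "\<dots> \<le> (1 - s) * u x + s * v x" using h k s by (intro add_mono mult_left_mono) auto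
        finally show ?thesis .
      qed
      moreover have "l \<in> Lip_bs" unfolding l_def[abs_def] by (intro Lip_bs_add Lip_bs_cmult h k)
      ultimately show "(\<lambda>x. (1 - s) * u x + s * v x) \<in> A"
        using close h k by (auto simp: A_def intro!: L2_add L2_cmult)
    qed (rule that)
    then show "\<exists>h\<in>Lip_bs. \<exists>u\<in>L2 m. sqnorm m (\<lambda>x. h x - f x) < d \<and> (\<forall>x. slope h x \<le> u x) \<and> sqnorm m (\<lambda>x. u x - w x) < d"
      by (auto simp: A_def)
  qed
qed

text \<open>Enlarging relaxed slopes to upper slopes does not lower the minimum, so the weak
  gradient is minimal among upper slopes too.\<close>

lemma Chr_le_upper_slope:
  assumes "w \<in> upper_slopes f" "f \<in> L2 m"
  shows "f \<in> W12 m" "Chr f \<le> sqnorm m w"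
proof -
  obtain h u where hu: "L2_conv m u w" "L2_conv m h f" "\<And>n. h n \<in> Lip_bs" "\<And>n x. slope (h n) x \<le> u n x"
    by (rule upper_slopesE[OF assms]) (rule that)
  have "sqnorm m (slope (h n)) \<le> sqnorm m (u n)" for n
    using hu L2_convD(1)[OF hu(1)] by (intro sqnorm_slope_le)
  then show "f \<in> W12 m" "Chr f \<le> sqnorm m w"
    using W12_I_seq[OF hu(2,3) _ L2_conv_sqnorm[OF hu(1)]] by auto
qed

text \<open>The majorants u n of slopes are nonnegative, so the negative part of w is pointwise at
  most |u n - w|, which tends to 0 in L^2.\<close>

lemma upper_slope_nonneg:
  assumes "w \<in> upper_slopes f" "f \<in> L2 m"
  shows "AE x in m. 0 \<le> w x"
proof -
  obtain h u where hu: "L2_conv m u w" "L2_conv m h f" "\<And>n. h n \<in> Lip_bs" "\<And>n x. slope (h n) x \<le> u n x"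
    by (rule upper_slopesE[OF assms]) (rule that)
  note w = L2_convD(2)[OF hu(1)]
  have wm: "w \<in> borel_measurable borel" by (rule L2_borel[OF w])
  define v where "v x = max (- w x) 0" for x
  have v: "v \<in> L2 m" unfolding v_def[abs_def] by (rule L2_bound[OF w]) (use wm in auto)
  have "sqnorm m v \<le> sqnorm m (\<lambda>x. u n x - w x)" for n
  proof (rule sqnorm_mono)
    show "(\<lambda>x. u n x - w x) \<in> L2 m" by (intro L2_diff w L2_convD(1)[OF hu(1)])
    show "v \<in> borel_measurable m" by (rule L2_measurable[OF v])
    have "\<bar>v x\<bar> \<le> \<bar>u n x - w x\<bar>" for x
    proof -
      have "0 \<le> u n x" using slope_nonneg[of "h n" x] hu(4)[of n x] by linarith
      then show ?thesis by (simp add: v_def)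
    qed
    then show "AE x in m. \<bar>v x\<bar> \<le> \<bar>u n x - w x\<bar>" by simp
  qed
  then have "sqnorm m v \<le> 0" by (intro LIMSEQ_le_const[OF L2_convD(3)[OF hu(1)]]) auto
  moreover have "0 \<le> sqnorm m v" by simp
  ultimately have "sqnorm m v = 0" by linarith
  then have "AE x in m. (v x)\<^sup>2 = 0"
    using integral_nonneg_eq_0_iff_AE[OF L2_integrable[OF v]] by simp
  then show ?thesis by eventually_elim (simp add: v_def max_def split: if_splits)
qed

text \<open>Near-minimisers have Cauchy slopes by the parallelogram law, since midpoints of near-minimisers
  cannot have smaller energy.\<close>

lemma minimal_relaxed_slope_exists:
  assumes f: "f \<in> W12 m"
  obtains g where "g \<in> relaxed_slopes m f" "sqnorm m g = Chr f"
proof -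
  obtain h where h: "\<And>n. h n \<in> Lip_bs" "L2_conv m h f" "(\<lambda>n. sqnorm m (slope (h n))) \<longlonglongrightarrow> Chr f"
    by (rule W12_optimal_sequence[OF f]) (rule that)
  have sL: "slope (h n) \<in> L2 m" for n by (rule slope_L2[OF h(1)])
  obtain g where g: "L2_conv m (\<lambda>n. slope (h n)) g"
  proof (rule L2_complete[OF sL])
    fix e :: real assume e: "e > 0"
    \<comment> \<open>With e/16 the parallelogram law bounds the squared distance of two slopes by 4
      (Chr f + e/16) - 4 (Chr f - e/16) = e/2.\<close>
    obtain d where d: "d > 0" "\<And>k. k \<in> Lip_bs \<Longrightarrow> sqnorm m (\<lambda>x. k x - f x) < d \<Longrightarrow> Chr f - e / 16 < sqnorm m (slope k)"
      using Ch_lower_bound[OF f, of "e / 16"] e by auto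
    have "\<forall>\<^sub>F n in sequentially. sqnorm m (\<lambda>x. h n x - f x) < d \<and> sqnorm m (slope (h n)) < Chr f + e / 16"
      using d e by (intro eventually_conj order_tendstoD[OF L2_convD(3)[OF h(2)]] order_tendstoD[OF h(3)]) auto
    then obtain n0 where n0: "\<And>n. n \<ge> n0 \<Longrightarrow> sqnorm m (\<lambda>x. h n x - f x) < d"
      "\<And>n. n \<ge> n0 \<Longrightarrow> sqnorm m (slope (h n)) < Chr f + e / 16"
      by (auto simp: eventually_sequentially)
    have "sqnorm m (\<lambda>x. slope (h i) x - slope (h j) x) < e" if i: "i \<ge> n0" and j: "j \<ge> n0" for i j
    proof -
      define k where "k x = (1 - 1/2) * h i x + (1/2) * h j x" for x
      have k: "k \<in> Lip_bs" unfolding k_def[abs_def] by (intro Lip_bs_add Lip_bs_cmult h)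
      have "sqnorm m (\<lambda>x. k x - f x) = sqnorm m (\<lambda>x. (1/2) * ((h i x - f x) + (h j x - f x)))"
        by (intro arg_cong[of _ _ "integral\<^sup>L m"] ext arg_cong[of _ _ "\<lambda>t. t\<^sup>2"]) (simp add: k_def field_simps)
      also have "\<dots> = (1/2)\<^sup>2 * sqnorm m (\<lambda>x. (h i x - f x) + (h j x - f x))" by (rule sqnorm_cmult)
      also have "\<dots> \<le> (1/2)\<^sup>2 * (2 * sqnorm m (\<lambda>x. h i x - f x) + 2 * sqnorm m (\<lambda>x. h j x - f x))"
        by (intro mult_left_mono sqnorm_add_le L2_diff Lip_bs_L2 h W12_L2[OF f]) auto
      also have "\<dots> < d" using n0(1)[OF i] n0(1)[OF j] by (simp add: power2_eq_square)
      finally have low: "Chr f - e / 16 < sqnorm m (slope k)" by (rule d(2)[OF k])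
      obtain L M where LM: "L-lipschitz_on UNIV (h i)" "M-lipschitz_on UNIV (h j)"
        using h(1)[of i] h(1)[of j] by (auto simp: Lip_bs_def)
      have "sqnorm m (slope k) \<le> sqnorm m (\<lambda>x. (1/2) * (slope (h i) x + slope (h j) x))"
      proof (rule sqnorm_slope_le[OF k])
        show "slope k x \<le> (1/2) * (slope (h i) x + slope (h j) x)" for x
          using slope_convex_le[OF LM, of "1/2" x] unfolding k_def[abs_def] by simp
      qed (intro L2_cmult L2_add sL)
      also have "\<dots> = (1/2)\<^sup>2 * sqnorm m (\<lambda>x. slope (h i) x + slope (h j) x)" by (rule sqnorm_cmult)
      finally have "4 * sqnorm m (slope k) \<le> sqnorm m (\<lambda>x. slope (h i) x + slope (h j) x)"
        by (simp add: power2_eq_square)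
      then show ?thesis
        using low n0(2)[OF i] n0(2)[OF j] sqnorm_parallelogram[OF sL[of i] sL[of j]] e by linarith
    qed
    then show "\<exists>n0. \<forall>i\<ge>n0. \<forall>j\<ge>n0. sqnorm m (\<lambda>x. slope (h i) x - slope (h j) x) < e" by blast
  qed (rule that)
  have "g \<in> relaxed_slopes m f"
    unfolding relaxed_slopes_def using h L2_conv_imp_weak[OF g] by blast
  moreover have "sqnorm m g = Chr f"
    by (rule LIMSEQ_unique[OF L2_conv_sqnorm[OF g] h(3)])
  ultimately show thesis by (rule that)
qed

text \<open>The minimum in the choice that defines \<open>weak_grad\<close> is attained: every
  relaxed slope has squared norm at least \<open>Chr f\<close>, and one of them has exactly this
  value.\<close>

lemma weak_grad_relaxed:
  assumes f: "f \<in> W12 m"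
  shows "weak_grad m f \<in> relaxed_slopes m f" "sqnorm m (weak_grad m f) = Chr f"
proof -
  obtain g where g: "g \<in> relaxed_slopes m f" "sqnorm m g = Chr f"
    by (rule minimal_relaxed_slope_exists[OF f]) (rule that)
  have min: "Chr f \<le> sqnorm m g'" if "g' \<in> relaxed_slopes m f" for g'
    using Chr_le_upper_slope(2) relaxed_slopes_subset that W12_L2[OF f] by blast
  have *: "weak_grad m f \<in> relaxed_slopes m f \<and> (\<forall>g'\<in>relaxed_slopes m f. sqnorm m (weak_grad m f) \<le> sqnorm m g')"
    unfolding weak_grad_def
    by (rule someI[of "\<lambda>g. g \<in> relaxed_slopes m f \<and> (\<forall>g'\<in>relaxed_slopes m f. sqnorm m g \<le> sqnorm m g')" g])
      (use g min in auto)
  then show "weak_grad m f \<in> relaxed_slopes m f" by blast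
  show "sqnorm m (weak_grad m f) = Chr f" using * g min by (intro antisym) auto
qed

lemma weak_grad_upper: "f \<in> W12 m \<Longrightarrow> weak_grad m f \<in> upper_slopes f"
  using weak_grad_relaxed(1) relaxed_slopes_subset by blast

lemma weak_grad_L2: "f \<in> W12 m \<Longrightarrow> weak_grad m f \<in> L2 m"
  using weak_grad_upper by (auto simp: upper_slopes_def)

lemma weak_grad_nonneg: "f \<in> W12 m \<Longrightarrow> AE x in m. 0 \<le> weak_grad m f x"
  by (rule upper_slope_nonneg[OF weak_grad_upper W12_L2])

section \<open>Locality of the weak gradient\<close>

lemma upper_slopes_cut:
  assumes w: "w \<in> upper_slopes f" "f \<in> L2 m" and w': "w' \<in> upper_slopes f'" "f' \<in> L2 m"
    and F: "closed F" and eq: "AE x in m. x \<in> F \<longrightarrow> f x = f' x"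
    and \<eta>: "L-lipschitz_on UNIV \<eta>" "\<And>x. 0 \<le> \<eta> x" "\<And>x. \<eta> x \<le> 1" "\<And>x. x \<notin> F \<Longrightarrow> \<eta> x = 0"
  shows "(\<lambda>x. \<eta> x * w' x + (1 - \<eta> x) * w x) \<in> upper_slopes f"
proof -
  obtain h u where hu: "L2_conv m u w" "L2_conv m h f" "\<And>n. h n \<in> Lip_bs" "\<And>n x. slope (h n) x \<le> u n x"
    by (rule upper_slopesE[OF w]) (rule that)
  obtain h' u' where hu': "L2_conv m u' w'" "L2_conv m h' f'" "\<And>n. h' n \<in> Lip_bs" "\<And>n x. slope (h' n) x \<le> u' n x"
    by (rule upper_slopesE[OF w']) (rule that)
  have \<eta>m: "\<eta> \<in> borel_measurable borel"
    by (intro borel_measurable_continuous_onI lipschitz_on_continuous_on[OF \<eta>(1)])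
  have L0: "L \<ge> 0" by (rule lipschitz_on_nonneg[OF \<eta>(1)])
  define k where "k n x = \<eta> x * h' n x + (1 - \<eta> x) * h n x" for n x
  \<comment> \<open>The Leibniz error is supported in F, where f = f' almost everywhere; there h' n
    - h n tends to 0 in L^2, so that the plain interpolation of w' and w remains in the
    limit.\<close>
  define r where "r n x = (L * indicator F x) * \<bar>h' n x - h n x\<bar>" for n x
  define v where "v n x = (\<eta> x * u' n x + (1 - \<eta> x) * u n x) + r n x" for n x
  have k: "k n \<in> Lip_bs" for n
    unfolding k_def[abs_def] by (rule Lip_bs_cut[OF hu'(3) hu(3) \<eta>(1-3)])
  have slope_\<eta>: "slope \<eta> x \<le> L * indicator F x" for x
  proof (cases "x \<in> F")
    case True then show ?thesis using slope_le_lipschitz[OF \<eta>(1)] by simp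
  next
    case False
    then show ?thesis using slope_eq_0_outside[OF F False, of \<eta> 0] \<eta>(4) by simp
  qed
  have kv: "slope (k n) x \<le> v n x" for n x
  proof -
    obtain A B where AB: "A-lipschitz_on UNIV (h n)" "B-lipschitz_on UNIV (h' n)"
      using hu(3)[of n] hu'(3)[of n] by (auto simp: Lip_bs_def)
    have "slope (k n) x \<le> \<eta> x * slope (h' n) x + (1 - \<eta> x) * slope (h n) x + slope \<eta> x * \<bar>h' n x - h n x\<bar>"
      unfolding k_def[abs_def] by (rule slope_cut_le[OF AB(2,1) \<eta>(1-3)])
    also have "\<dots> \<le> v n x"
      unfolding v_def r_def using hu(4)[of n x] hu'(4)[of n x] \<eta>(2,3)[of x] slope_\<eta>[of x]
      by (intro add_mono mult_left_mono mult_right_mono) auto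
    finally show ?thesis .
  qed
  have b: "\<bar>\<eta> x\<bar> \<le> 1" "\<bar>1 - \<eta> x\<bar> \<le> 1" for x using \<eta>(2,3)[of x] by auto
  have m1: "(\<lambda>x. 1 - \<eta> x) \<in> borel_measurable borel" using \<eta>m by auto
  have "L2_conv m k (\<lambda>x. \<eta> x * f' x + (1 - \<eta> x) * f x)"
    unfolding k_def[abs_def] using \<eta>m m1
    by (intro L2_conv_add L2_conv_bounded_mult[OF hu(2) _ b(2)] L2_conv_bounded_mult[OF hu'(2) _ b(1)]) auto
  moreover have "AE x in m. \<eta> x * f' x + (1 - \<eta> x) * f x = f x"
    using eq by eventually_elim (use \<eta>(4) in \<open>auto simp: algebra_simps\<close>)
  ultimately have kf: "L2_conv m k f"
    by (rule L2_conv_cong_AE) (use L2_measurable[OF w(2)] in simp)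
  define D where "D n x = (h' n x - h n x) - (f' x - f x)" for n x
  have Dc: "L2_conv m D (\<lambda>x. 0)"
    using L2_conv_diff[OF L2_conv_diff[OF hu'(2) hu(2)] L2_conv_const[OF L2_diff[OF w'(2) w(2)]]]
    by (simp add: D_def[abs_def])
  note DL = L2_convD(1)[OF Dc]
  have rm: "r n \<in> borel_measurable m" for n
    unfolding r_def[abs_def] using L2_borel[OF Lip_bs_L2[OF hu(3)[of n]]] L2_borel[OF Lip_bs_L2[OF hu'(3)[of n]]] F by auto
  have rD: "AE x in m. \<bar>r n x\<bar> \<le> \<bar>L * D n x\<bar>" for n
    using eq by eventually_elim (auto simp: r_def D_def abs_mult indicator_def L0)
  have rL: "r n \<in> L2 m" for n by (rule L2_bound[OF L2_cmult[OF DL] rm rD])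
  have r0: "L2_conv m r (\<lambda>x. 0)"
    unfolding L2_conv_def
  proof (intro conjI allI rL L2_zero)
    show "(\<lambda>n. sqnorm m (\<lambda>x. r n x - 0)) \<longlonglongrightarrow> 0"
    proof (rule tendsto_sandwich[OF _ _ tendsto_const])
      show "(\<lambda>n. L\<^sup>2 * sqnorm m (\<lambda>x. D n x - 0)) \<longlonglongrightarrow> 0"
        by (rule tendsto_eq_intros refl L2_convD(3)[OF Dc])+ simp
      have "sqnorm m (r n) \<le> L\<^sup>2 * sqnorm m (D n)" for n
        using sqnorm_mono[OF L2_cmult[OF DL] rm rD] by (simp only: sqnorm_cmult)
      then show "\<forall>\<^sub>F n in sequentially. sqnorm m (\<lambda>x. r n x - 0) \<le> L\<^sup>2 * sqnorm m (\<lambda>x. D n x - 0)" by simp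
    qed simp
  qed
  have "L2_conv m v (\<lambda>x. (\<eta> x * w' x + (1 - \<eta> x) * w x) + 0)"
    unfolding v_def[abs_def] using \<eta>m m1
    by (intro L2_conv_add r0 L2_conv_bounded_mult[OF hu(1) _ b(2)] L2_conv_bounded_mult[OF hu'(1) _ b(1)]) auto
  then have "L2_conv m v (\<lambda>x. \<eta> x * w' x + (1 - \<eta> x) * w x)" by simp
  then show ?thesis by (rule upper_slopesI[OF _ kf k kv])
qed

text \<open>If the weak gradient exceeded w' on a part of G of positive measure, splicing w' in near
  a compact piece of that part would give an upper slope of smaller norm than the minimal one. The
  splice is admissible because f and f' agree on G.\<close>

lemma weak_grad_le_upper_slope:
  assumes f: "f \<in> W12 m" and w': "w' \<in> upper_slopes f'" "f' \<in> L2 m"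
    and G: "open G" and eq: "AE x in m. x \<in> G \<longrightarrow> f x = f' x"
  shows "AE x in m. x \<in> G \<longrightarrow> weak_grad m f x \<le> w' x"
proof -
  define g where "g = weak_grad m f"
  have g: "g \<in> upper_slopes f" "g \<in> L2 m" "AE x in m. 0 \<le> g x" "sqnorm m g = Chr f"
    unfolding g_def using weak_grad_upper weak_grad_L2 weak_grad_nonneg weak_grad_relaxed(2) f by auto
  have w'L: "w' \<in> L2 m" using w' by (simp add: upper_slopes_def)
  have w'0: "AE x in m. 0 \<le> w' x" by (rule upper_slope_nonneg[OF w'])
  have gm: "g \<in> borel_measurable borel" "w' \<in> borel_measurable borel" using g w'L by (auto intro: L2_borel)
  note int = L2_integrable[OF g(2)] L2_integrable[OF w'L]
  have key: "(\<integral>x. \<eta> x * ((g x)\<^sup>2 - (w' x)\<^sup>2) \<partial>m) \<le> 0"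
    if F: "closed F" "F \<subseteq> G" and \<eta>: "L-lipschitz_on UNIV \<eta>" "\<And>x. 0 \<le> \<eta> x" "\<And>x. \<eta> x \<le> 1" "\<And>x. x \<notin> F \<Longrightarrow> \<eta> x = 0"
    for F \<eta> L
  proof -
    have \<eta>m: "\<eta> \<in> borel_measurable borel"
      by (intro borel_measurable_continuous_onI lipschitz_on_continuous_on[OF \<eta>(1)])
    have eqF: "AE x in m. x \<in> F \<longrightarrow> f x = f' x" using eq by eventually_elim (use F in auto)
    define v where "v x = \<eta> x * w' x + (1 - \<eta> x) * g x" for x
    have v: "v \<in> upper_slopes f"
      unfolding v_def[abs_def] by (rule upper_slopes_cut[OF g(1) W12_L2[OF f] w' F(1) eqF \<eta>])
    have vL: "v \<in> L2 m" using v by (simp add: upper_slopes_def)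
    have int\<eta>: "integrable m (\<lambda>x. \<eta> x * ((g x)\<^sup>2 - (w' x)\<^sup>2))"
    proof (rule Bochner_Integration.integrable_bound)
      show "integrable m (\<lambda>x. (g x)\<^sup>2 - (w' x)\<^sup>2)" using int by (rule Bochner_Integration.integrable_diff)
      show "AE x in m. norm (\<eta> x * ((g x)\<^sup>2 - (w' x)\<^sup>2)) \<le> norm ((g x)\<^sup>2 - (w' x)\<^sup>2)"
        using \<eta>(2,3) by (auto simp: abs_mult intro!: mult_left_le_one_le)
    qed (use \<eta>m gm in auto)
    have "sqnorm m g \<le> sqnorm m v" using Chr_le_upper_slope(2)[OF v W12_L2[OF f]] g(4) by simp
    also have "\<dots> \<le> (\<integral>x. (g x)\<^sup>2 - \<eta> x * ((g x)\<^sup>2 - (w' x)\<^sup>2) \<partial>m)"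
    proof (rule integral_mono)
      show "(v x)\<^sup>2 \<le> (g x)\<^sup>2 - \<eta> x * ((g x)\<^sup>2 - (w' x)\<^sup>2)" for x
      proof -
        \<comment> \<open>The convexity defect of the square for the weights \<eta> and 1 -
          \<eta>.\<close>
        have "0 \<le> \<eta> x * (1 - \<eta> x) * (w' x - g x)\<^sup>2" using \<eta>(2,3)[of x] by auto
        also have "\<dots> = (g x)\<^sup>2 - \<eta> x * ((g x)\<^sup>2 - (w' x)\<^sup>2) - (v x)\<^sup>2"
          unfolding v_def by algebra
        finally show ?thesis by simp
      qed
    qed (use L2_integrable[OF vL] int int\<eta> in auto)
    also have "\<dots> = sqnorm m g - (\<integral>x. \<eta> x * ((g x)\<^sup>2 - (w' x)\<^sup>2) \<partial>m)"
      using int int\<eta> by (intro Bochner_Integration.integral_diff)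
    finally show ?thesis by simp
  qed
  have Kint: "(\<integral>x. indicator K x * ((g x)\<^sup>2 - (w' x)\<^sup>2) \<partial>m) \<le> 0" if K: "compact K" "K \<subseteq> G" "K \<noteq> {}" for K
  proof -
    obtain N where N: "\<And>n x. n \<ge> N \<Longrightarrow> infdist x K \<le> 1 / real (Suc n) \<Longrightarrow> x \<in> G"
      by (rule infdist_le_subset_open[OF K(1,3) G K(2)]) (rule that)
    have le: "(\<integral>x. cutoff K n x * ((g x)\<^sup>2 - (w' x)\<^sup>2) \<partial>m) \<le> 0" if n: "n \<ge> N" for n
    proof (rule key[OF _ _ cutoff_lipschitz cutoff_bounds])
      show "closed {x. infdist x K \<le> 1 / real (Suc n)}" by (intro closed_Collect_le continuous_intros)
      show "{x. infdist x K \<le> 1 / real (Suc n)} \<subseteq> G" using N[OF n] by auto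
      show "cutoff K n x = 0" if "x \<notin> {x. infdist x K \<le> 1 / real (Suc n)}" for x
        using that by (intro cutoff_eq_0) simp
    qed
    have "(\<lambda>n. \<integral>x. cutoff K n x * ((g x)\<^sup>2 - (w' x)\<^sup>2) \<partial>m) \<longlonglongrightarrow> (\<integral>x. indicator K x * ((g x)\<^sup>2 - (w' x)\<^sup>2) \<partial>m)"
    proof (rule integral_dominated_convergence)
      show "integrable m (\<lambda>x. \<bar>(g x)\<^sup>2 - (w' x)\<^sup>2\<bar>)"
        using int by (intro integrable_abs Bochner_Integration.integrable_diff)
      show "AE x in m. (\<lambda>n. cutoff K n x * ((g x)\<^sup>2 - (w' x)\<^sup>2)) \<longlonglongrightarrow> indicator K x * ((g x)\<^sup>2 - (w' x)\<^sup>2)"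
        by (intro AE_I2 tendsto_mult tendsto_const cutoff_tendsto compact_imp_closed K)
      show "AE x in m. norm (cutoff K n x * ((g x)\<^sup>2 - (w' x)\<^sup>2)) \<le> \<bar>(g x)\<^sup>2 - (w' x)\<^sup>2\<bar>" for n
        using cutoff_bounds[of K n] by (auto simp: abs_mult intro!: mult_left_le_one_le)
    qed (use gm K compact_imp_closed[OF K(1)] in auto)
    then show ?thesis by (rule LIMSEQ_le_const2) (use le in blast)
  qed
  \<comment> \<open>Nonnegativity is built in because the argument compares squares; it holds almost
    everywhere, so nothing is lost.\<close>
  define B where "B = {x \<in> G. g x > w' x \<and> g x \<ge> 0 \<and> w' x \<ge> 0}"
  have Bm: "B \<in> sets borel"
  proof -
    have "B = G \<inter> ({x \<in> space borel. w' x < g x} \<inter> {x \<in> space borel. 0 \<le> g x} \<inter> {x \<in> space borel. 0 \<le> w' x})"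
      by (auto simp: B_def)
    also have "\<dots> \<in> sets borel" using G gm by measurable
    finally show ?thesis .
  qed
  have "emeasure m B = 0"
  proof (rule ccontr)
    assume "emeasure m B \<noteq> 0"
    then have "emeasure m B > 0" by (simp add: zero_less_iff_neq_zero)
    then obtain K where K: "compact K" "K \<subseteq> B" "emeasure m K > 0" using compact_subset_positive[OF Bm] by blast
    have Kb: "K \<in> sets borel" using compact_imp_closed[OF K(1)] by simp
    have pos: "0 \<le> indicator K x * ((g x)\<^sup>2 - (w' x)\<^sup>2)" for x
    proof (cases "x \<in> K")
      case True
      then have "0 \<le> w' x" "w' x \<le> g x" using K(2) by (auto simp: B_def)
      then show ?thesis by (simp add: power_mono)
    qed simp
    have "integrable m (\<lambda>x. indicator K x * ((g x)\<^sup>2 - (w' x)\<^sup>2))"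
      using Kb int by (intro integrable_real_mult_indicator[of K m "\<lambda>x. (g x)\<^sup>2 - (w' x)\<^sup>2", simplified mult.commute] Bochner_Integration.integrable_diff) auto
    moreover have "(\<integral>x. indicator K x * ((g x)\<^sup>2 - (w' x)\<^sup>2) \<partial>m) = 0"
    proof (rule antisym)
      show "(\<integral>x. indicator K x * ((g x)\<^sup>2 - (w' x)\<^sup>2) \<partial>m) \<le> 0"
        using K by (intro Kint) (auto simp: B_def)
    qed (intro integral_nonneg_AE AE_I2 pos)
    ultimately have "AE x in m. indicator K x * ((g x)\<^sup>2 - (w' x)\<^sup>2) = 0"
      using integral_nonneg_eq_0_iff_AE[of m "\<lambda>x. indicator K x * ((g x)\<^sup>2 - (w' x)\<^sup>2)"] pos by blast
    then have "AE x in m. x \<notin> K"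
    proof eventually_elim
      case (elim x)
      show ?case
      proof
        assume "x \<in> K"
        then have "0 \<le> w' x" "w' x < g x" using K(2) by (auto simp: B_def)
        then have "(w' x)\<^sup>2 < (g x)\<^sup>2" by (intro power_strict_mono) auto
        then show False using elim \<open>x \<in> K\<close> by simp
      qed
    qed
    then have "emeasure m K = 0" using Kb AE_iff_measurable[of K m "\<lambda>x. x \<notin> K"] by simp
    then show False using K by simp
  qed
  then have "AE x in m. x \<notin> B" using Bm by (intro AE_not_in) (simp add: null_sets_def)
  then show ?thesis
    using g(3) w'0 unfolding g_def[symmetric] by eventually_elim (auto simp: B_def)
qed

lemma weak_grad_local:
  assumes "f \<in> W12 m" "f' \<in> W12 m" "open G" "AE x in m. x \<in> G \<longrightarrow> f x = f' x"
  shows "AE x in m. x \<in> G \<longrightarrow> weak_grad m f x = weak_grad m f' x"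
proof -
  have eq': "AE x in m. x \<in> G \<longrightarrow> f' x = f x" using assms(4) by eventually_elim simp
  show ?thesis
    using weak_grad_le_upper_slope[OF assms(1) weak_grad_upper[OF assms(2)] W12_L2[OF assms(2)] assms(3,4)]
      weak_grad_le_upper_slope[OF assms(2) weak_grad_upper[OF assms(1)] W12_L2[OF assms(1)] assms(3) eq']
    by eventually_elim auto
qed

lemma weak_grad_le_slope: "f \<in> Lip_bs \<Longrightarrow> AE x in m. weak_grad m f x \<le> slope f x"
  using weak_grad_le_upper_slope[OF Lip_bs_W12(1) slope_in_upper_slopes Lip_bs_L2 open_UNIV, of f f] by simp

text \<open>The specification under \<open>SOME\<close> has to be shown satisfiable. Weak gradients
  of Sobolev representatives on the balls around x0 agree on overlaps by locality, and properness
  makes every ball relatively compact, so they glue to one measurable function.\<close>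

lemma weak_grad_loc_spec:
  assumes proper: "\<And>B::'a set. bounded B \<Longrightarrow> compact (closure B)" and f: "f \<in> W12_loc m"
    and G: "open G" "compact (closure G)" and fG: "fG \<in> W12 m" "AE x in m. x \<in> G \<longrightarrow> f x = fG x"
  shows "AE x in m. x \<in> G \<longrightarrow> weak_grad_loc m f x = weak_grad m fG x"
proof -
  obtain x0 :: 'a where True by simp
  have "\<forall>n::nat. \<exists>u. u \<in> W12 m \<and> (AE x in m. x \<in> ball x0 (real n) \<longrightarrow> f x = u x)"
    using f proper[of "ball x0 _"] unfolding W12_loc_def by blast
  from choice[OF this] obtain u where u: "\<forall>n. u n \<in> W12 m \<and> (AE x in m. x \<in> ball x0 (real n) \<longrightarrow> f x = u n x)"
    by blast
  \<comment> \<open>The summand 1 puts x strictly inside the open ball of radius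
    \<open>k x\<close>.\<close>
  define k where "k x = nat \<lceil>dist x0 x\<rceil> + 1" for x
  have k: "x \<in> ball x0 (real (k x))" for x unfolding k_def by simp linarith
  define g where "g x = weak_grad m (u (k x)) x" for x
  have "g \<in> borel_measurable borel"
    unfolding g_def[abs_def]
  proof (rule measurable_compose_countable)
    show "weak_grad m (u n) \<in> borel_measurable borel" for n
      using u weak_grad_L2 L2_borel by blast
    have "(\<lambda>x. \<lceil>dist x0 x\<rceil>) \<in> measurable borel (count_space UNIV)" by measurable
    then show "k \<in> measurable borel (count_space UNIV)" unfolding k_def[abs_def] by measurable
  qed
  moreover have "AE x in m. x \<in> G' \<longrightarrow> g x = weak_grad m v x"
    if "v \<in> W12 m" "open G'" "AE x in m. x \<in> G' \<longrightarrow> f x = v x" for v G'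
  proof -
    have "AE x in m. x \<in> G' \<inter> ball x0 (real n) \<longrightarrow> weak_grad m (u n) x = weak_grad m v x" for n
    proof (rule weak_grad_local)
      have "AE x in m. x \<in> ball x0 (real n) \<longrightarrow> f x = u n x" using u by blast
      then show "AE x in m. x \<in> G' \<inter> ball x0 (real n) \<longrightarrow> u n x = v x"
        using that(3) by eventually_elim auto
    qed (use u that in auto)
    then have "AE x in m. \<forall>n. x \<in> G' \<inter> ball x0 (real n) \<longrightarrow> weak_grad m (u n) x = weak_grad m v x"
      by (simp add: AE_all_countable)
    then show ?thesis
      by eventually_elim (use k in \<open>auto simp: g_def\<close>)
  qed
  moreover define P where "P g \<longleftrightarrow> g \<in> borel_measurable m \<and> (\<forall>G. \<forall>fG\<in>W12 m. open G \<and> compact (closure G) \<and>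
        (AE x in m. x \<in> G \<longrightarrow> f x = fG x) \<longrightarrow> (AE x in m. x \<in> G \<longrightarrow> g x = weak_grad m fG x))" for g
  ultimately have "P g" by simp
  then have "P (SOME g. P g)" by (rule someI[of P g])
  moreover have "weak_grad_loc m f = (SOME g. P g)" by (simp add: weak_grad_loc_def P_def)
  ultimately have "P (weak_grad_loc m f)" by simp
  then show ?thesis using G fG unfolding P_def by blast
qed

end

section \<open>Lower bounds for the distortion coefficients\<close>

text \<open>Concavity of \<open>sin\<close> on [0, pi], with value 0 at the origin.\<close>

lemma sin_mult_ge:
  assumes "0 \<le> t" "t \<le> 1" "0 \<le> x" "x \<le> pi"
  shows "t * sin x \<le> sin (t * x)"
proof -
  have "convex_on {0..pi} (\<lambda>x. - sin x)"
  proof (rule f''_ge0_imp_convex)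
    show "((\<lambda>x. - sin x) has_real_derivative - cos x) (at x)" for x by (auto intro!: derivative_eq_intros)
    show "((\<lambda>x. - cos x) has_real_derivative sin x) (at x)" for x by (auto intro!: derivative_eq_intros)
  qed (auto intro: sin_ge_zero)
  from convex_onD[OF this, of t 0 x] show ?thesis using assms by auto
qed

text \<open>By the mean value theorem \<open>sinh y = y * cosh z\<close> for some z between 0 and y,
  whence sinh (t x) \<ge> t x and sinh x \<le> x cosh x.\<close>

lemma sinh_quotient_ge:
  fixes x t :: real
  assumes t: "0 < t" and x: "0 < x"
  shows "t / cosh x \<le> sinh (t * x) / sinh x"
proof -
  have mvt: "\<exists>z>0. z < y \<and> sinh y = y * cosh z" if "0 < y" for y :: real
  proof -
    have "(sinh has_real_derivative cosh x) (at x)" for x :: real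
      using has_field_derivative_sinh[OF DERIV_ident, of x UNIV] by simp
    then show ?thesis using MVT2[of 0 y sinh cosh] that by simp
  qed
  obtain z where z: "0 < z" "z < x" "sinh x = x * cosh z" using mvt[OF x] by blast
  have "0 < t * x" using t x by simp
  then obtain z' where z': "0 < z'" "z' < t * x" "sinh (t * x) = (t * x) * cosh z'" using mvt by blast
  have "t * x * 1 \<le> t * x * cosh z'" using t x cosh_real_ge_1[of z'] by (intro mult_left_mono) auto
  then have a: "t * x \<le> sinh (t * x)" using z' by simp
  have "cosh z \<le> cosh x" using z by (subst cosh_real_nonneg_le_iff) auto
  then have b: "sinh x \<le> x * cosh x" using z x by (simp add: mult_left_mono)
  have sx: "0 < sinh x" using x by simp
  have "t / cosh x = t * x / (x * cosh x)" using x by simp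
  also have "\<dots> \<le> t * x / sinh x" using b sx t x by (intro divide_left_mono) auto
  also have "\<dots> \<le> sinh (t * x) / sinh x" using a sx by (intro divide_right_mono) auto
  finally show ?thesis .
qed

text \<open>What matters later is linearity in t with a constant uniform over distances up to D. For
  K \<ge> 0 concavity of the sine gives the constant 1, infinite values included; for K < 0 the loss
  is at most the value of cosh at the largest scaled distance.\<close>

lemma sigma_coeff_ge:
  assumes N': "N' > 0"
  obtains c where "0 < c" "c \<le> 1"
    "\<And>t \<theta>. 0 < t \<Longrightarrow> t < 1 \<Longrightarrow> 0 \<le> \<theta> \<Longrightarrow> \<theta> \<le> D \<Longrightarrow> ennreal (c * t) \<le> sigma_coeff K N' t \<theta>"
proof (cases "K < 0")
  case False
  show thesis
  proof (rule that[of 1])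
    fix t \<theta> :: real assume t: "0 < t" "t < 1" and \<theta>: "0 \<le> \<theta>" "\<theta> \<le> D"
    have "ennreal t \<le> sigma_coeff K N' t \<theta>"
    proof (cases "K = 0 \<or> \<theta> = 0 \<or> \<not> \<theta> < pi / sqrt (K / N')")
      case True
      then show ?thesis using False by (auto simp: sigma_coeff_def)
    next
      case 2: False
      define x where "x = \<theta> * sqrt (K / N')"
      have s: "sqrt (K / N') > 0" using 2 False N' by simp
      have x: "0 < x" "x < pi" using 2 \<theta> s by (auto simp: x_def pos_less_divide_eq)
      have "t \<le> sin (t * x) / sin x"
        using sin_mult_ge[of t x] t x sin_gt_zero[of x] by (simp add: pos_le_divide_eq)
      then show ?thesis using 2 False by (auto simp: sigma_coeff_def x_def mult.assoc intro!: ennreal_leI)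
    qed
    then show "ennreal (1 * t) \<le> sigma_coeff K N' t \<theta>" by simp
  qed auto
next
  case True
  define s where "s = sqrt (- (K / N'))"
  have s: "s > 0" using True N' by (simp add: s_def divide_neg_pos)
  show thesis
  proof (rule that[of "1 / cosh (\<bar>D\<bar> * s)"])
    show "0 < 1 / cosh (\<bar>D\<bar> * s)" "1 / cosh (\<bar>D\<bar> * s) \<le> 1"
      using cosh_real_ge_1[of "\<bar>D\<bar> * s"] by (auto simp: divide_le_eq)
    fix t \<theta> :: real assume t: "0 < t" "t < 1" and \<theta>: "0 \<le> \<theta>" "\<theta> \<le> D"
    show "ennreal (1 / cosh (\<bar>D\<bar> * s) * t) \<le> sigma_coeff K N' t \<theta>"
    proof (cases "\<theta> = 0")
      case True
      then show ?thesis
        using t cosh_real_ge_1[of "\<bar>D\<bar> * s"] by (auto simp: sigma_coeff_def divide_le_eq intro!: ennreal_leI)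
    next
      case False
      then have x: "0 < \<theta> * s" using \<theta> s by simp
      have "\<theta> * s \<le> \<bar>D\<bar> * s" using \<theta> s by (intro mult_right_mono) auto
      then have "cosh (\<theta> * s) \<le> cosh (\<bar>D\<bar> * s)" using x by (subst cosh_real_nonneg_le_iff) auto
      then have "t / cosh (\<bar>D\<bar> * s) \<le> t / cosh (\<theta> * s)"
        using t by (intro divide_left_mono) auto
      also have "\<dots> \<le> sinh (t * (\<theta> * s)) / sinh (\<theta> * s)" by (rule sinh_quotient_ge[OF t(1) x])
      finally show ?thesis
        using False True by (auto simp: sigma_coeff_def s_def[symmetric] mult.assoc intro!: ennreal_leI)
    qed
  qed
qed

lemma ennreal_powr_ge:
  assumes "ennreal y \<le> x" "0 < y" "0 < p"
  shows "ennreal (y powr p) \<le> ennreal_powr x p"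
proof (cases "x = \<infinity>")
  case True
  then show ?thesis using assms by (simp add: ennreal_powr_def)
next
  case False
  then obtain r where r: "x = ennreal r" "0 \<le> r" by (cases x) auto
  then have yr: "y \<le> r" using assms by (simp add: ennreal_le_iff)
  then have "x \<noteq> 0" using r assms by simp
  then show ?thesis using r yr assms False by (auto simp: ennreal_powr_def intro!: ennreal_leI powr_mono2)
qed

text \<open>The exponents 1/N and 1 - 1/N add up to 1, so the factor t^(1/N) restores exact
  linearity in t.\<close>

lemma tau_coeff_ge:
  assumes N: "N > 1"
  obtains c where "0 < c"
    "\<And>t \<theta>. 0 < t \<Longrightarrow> t < 1 \<Longrightarrow> 0 \<le> \<theta> \<Longrightarrow> \<theta> \<le> D \<Longrightarrow> ennreal (c * t) \<le> tau_coeff K N t \<theta>"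
proof -
  have "N - 1 > 0" using N by simp
  then obtain c where c: "0 < c" "c \<le> 1"
    "\<And>t \<theta>. 0 < t \<Longrightarrow> t < 1 \<Longrightarrow> 0 \<le> \<theta> \<Longrightarrow> \<theta> \<le> D \<Longrightarrow> ennreal (c * t) \<le> sigma_coeff K (N - 1) t \<theta>"
    by (rule sigma_coeff_ge[where D = D and K = K]) (rule that)
  show thesis
  proof (rule that)
    define p where "p = 1 - 1 / N"
    have p: "0 < p" using N by (simp add: p_def)
    show "0 < c powr p" using c by simp
    fix t \<theta> :: real assume t: "0 < t" "t < 1" and \<theta>: "0 \<le> \<theta>" "\<theta> \<le> D"
    have "ennreal ((c * t) powr p) \<le> ennreal_powr (sigma_coeff K (N - 1) t \<theta>) p"
      using c(1) t p by (intro ennreal_powr_ge c(3) \<theta>) auto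
    then have "ennreal (t powr (1 / N)) * ennreal ((c * t) powr p) \<le> tau_coeff K N t \<theta>"
      unfolding tau_coeff_def p_def by (intro mult_left_mono) auto
    moreover have "t powr (1 / N) * (c * t) powr p = c powr p * t"
    proof -
      have "t powr (1 / N) * (c * t) powr p = c powr p * (t powr (1 / N) * t powr p)"
        using c t by (simp add: powr_mult)
      also have "t powr (1 / N) * t powr p = t powr 1" by (simp add: p_def flip: powr_add)
      finally show ?thesis using t by simp
    qed
    ultimately show "ennreal (c powr p * t) \<le> tau_coeff K N t \<theta>" by (simp flip: ennreal_mult)
  qed
qed

text \<open>Turns a lower bound on the power -1/N of a density into an upper bound on the density.
  The value \<open>r = \<infinity>\<close> is excluded because its negative power is 0, and
  \<open>r = 0\<close> is trivial.\<close>

lemma ennreal_powr_ge_imp_le: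
  assumes "ennreal y \<le> ennreal_powr r (- 1 / N)" "0 < y" "0 < N"
  shows "r \<le> ennreal (y powr (- N))"
proof (cases "r = \<infinity>")
  case True
  then show ?thesis using assms by (simp add: ennreal_powr_def)
next
  case False
  then obtain s where s: "r = ennreal s" "0 \<le> s" by (cases r) auto
  show ?thesis
  proof (cases "s = 0")
    case True then show ?thesis using s by simp
  next
    case 2: False
    then have "ennreal_powr r (- 1 / N) = ennreal (s powr (- 1 / N))"
      using s assms by (simp add: ennreal_powr_def)
    then have "y \<le> s powr (- 1 / N)" using assms by (simp add: ennreal_le_iff)
    then have "(s powr (- 1 / N)) powr (- N) \<le> y powr (- N)"
      using assms by (intro powr_mono2') auto
    moreover have "(s powr (- 1 / N)) powr (- N) = s" using s 2 assms by (simp add: powr_powr)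
    ultimately show ?thesis using s by (simp add: ennreal_leI)
  qed
qed

section \<open>Curves\<close>

text \<open>\<open>Abs_unit_interval\<close> is unspecified off [0, 1], so \<open>ev t\<close> is
  meaningful only there. Clamping the time yields a continuous function on all of the reals, which
  can be integrated against \<open>lborel\<close> directly.\<close>

definition clamp01 :: "real \<Rightarrow> real" where
  "clamp01 t = max 0 (min 1 t)"

lemma clamp01_in [simp]: "0 \<le> clamp01 t" "clamp01 t \<le> 1"
  by (auto simp: clamp01_def)

lemma clamp01_id: "0 \<le> t \<Longrightarrow> t \<le> 1 \<Longrightarrow> clamp01 t = t"
  by (simp add: clamp01_def)

lemma abs_clamp01_le: "\<bar>clamp01 s - clamp01 t\<bar> \<le> \<bar>s - t\<bar>"
  unfolding clamp01_def by linarith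

lemma continuous_on_ev_clamp01: "continuous_on UNIV (\<lambda>t. ev (clamp01 t) \<gamma>)"
proof -
  have "dist (Abs_unit_interval (clamp01 s)) (Abs_unit_interval (clamp01 t)) \<le> dist s t" for s t
    using abs_clamp01_le[of s t] by (simp add: dist_unit_interval_def Abs_unit_interval_inverse dist_real_def)
  then have "1-lipschitz_on UNIV (\<lambda>t. Abs_unit_interval (clamp01 t))"
    by (intro lipschitz_onI) auto
  then have "continuous_on UNIV (\<lambda>t. Abs_unit_interval (clamp01 t))" by (rule lipschitz_on_continuous_on)
  from continuous_on_compose2[OF continuous_on_apply_bcontfun[of UNIV \<gamma>] this]
  show ?thesis unfolding ev_def by auto
qed

lemma borel_measurable_ev [measurable]: "ev t \<in> borel_measurable borel"
proof -
  have "1-lipschitz_on UNIV (ev t)"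
    unfolding ev_def by (intro lipschitz_onI) (auto intro: dist_bounded)
  then show ?thesis by (intro borel_measurable_continuous_onI lipschitz_on_continuous_on)
qed

lemma Geo_dist:
  assumes "\<gamma> \<in> Geo" "0 \<le> s" "s \<le> 1" "0 \<le> t" "t \<le> 1"
  shows "dist (ev s \<gamma>) (ev t \<gamma>) = \<bar>s - t\<bar> * dist (ev 0 \<gamma>) (ev 1 \<gamma>)"
proof -
  have "s \<in> {0..1}" "t \<in> {0..1}" using assms by auto
  then show ?thesis using assms(1) unfolding Geo_def by blast
qed

section \<open>Density bounds along optimal geodesics\<close>

lemma uniform_measure_Pcm_P2:
  fixes m :: "'a::polish_space measure"
  assumes "boundedly_finite m" and A: "compact A" "emeasure m A > 0"
  shows "uniform_measure m A \<in> Pcm m" "uniform_measure m A \<in> P2" "absolutely_continuous m (uniform_measure m A)"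
proof -
  interpret boundedly_finite m by fact
  have Ab: "A \<in> sets borel" using compact_imp_closed[OF A(1)] by simp
  have fin: "emeasure m A < \<infinity>" by (rule emeasure_bounded[OF Ab compact_imp_bounded[OF A(1)]])
  have prob: "prob_space (uniform_measure m A)" using A fin by (intro prob_space_uniform_measure) auto
  have bp: "borel_prob (uniform_measure m A)" using prob by (simp add: borel_prob_def)
  show ac: "absolutely_continuous m (uniform_measure m A)"
    unfolding uniform_measure_def by (rule absolutely_continuousI_density) (use Ab in measurable)
  have "measure_support (uniform_measure m A) \<subseteq> A"
  proof
    fix x assume x: "x \<in> measure_support (uniform_measure m A)"
    show "x \<in> A"
    proof (rule ccontr)
      assume "x \<notin> A"
      then have "0 < emeasure (uniform_measure m A) (- A)"
        using x compact_imp_closed[OF A(1)] by (auto simp: measure_support_def)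
      then show False using Ab by simp
    qed
  qed
  moreover have "closed (measure_support (uniform_measure m A))"
  proof -
    have "- measure_support (uniform_measure m A) = \<Union>{U. open U \<and> emeasure (uniform_measure m A) U = 0}"
      by (auto simp: measure_support_def zero_less_iff_neq_zero)
    then show ?thesis by (simp add: closed_def open_Union)
  qed
  ultimately have "compact (measure_support (uniform_measure m A))"
    using compact_Int_closed[OF A(1)] by (metis inf.absorb2)
  then show "uniform_measure m A \<in> Pcm m" using bp ac by (simp add: Pcm_def)
  obtain x0 R where R: "\<And>x. x \<in> A \<Longrightarrow> dist x0 x \<le> R"
    using compact_imp_bounded[OF A(1)] by (auto simp: bounded_def)
  have "(\<integral>\<^sup>+x. ennreal ((dist x x0)\<^sup>2) \<partial>uniform_measure m A) \<le> (\<integral>\<^sup>+x. ennreal (R\<^sup>2) \<partial>uniform_measure m A)"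
  proof (rule nn_integral_mono_AE)
    show "AE x in uniform_measure m A. ennreal ((dist x x0)\<^sup>2) \<le> ennreal (R\<^sup>2)"
      using R by (intro AE_uniform_measureI AE_I2) (auto simp: Ab dist_commute intro!: ennreal_leI power_mono)
  qed
  also have "\<dots> < \<infinity>" using prob_space.emeasure_space_1[OF prob] by (simp add: ennreal_mult_less_top)
  finally show "uniform_measure m A \<in> P2" using bp by (auto simp: P2_def)
qed

locale qcd_space = boundedly_finite m for m :: "'a::polish_space measure" +
  fixes Q K N :: real
  assumes monge: "monge_space m" and qcd: "QCD Q K N m" and Q_ge_1: "1 \<le> Q" and N_gt_1: "1 < N"
begin

lemma emeasure_open_pos:
  assumes "open U" "U \<noteq> {}"
  shows "emeasure m U > 0"
proof -
  obtain x where "x \<in> U" using assms by blast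
  moreover have "x \<in> measure_support m" using monge by (simp add: monge_space_def metric_measure_space_def)
  ultimately show ?thesis using assms(1) unfolding measure_support_def by blast
qed

text \<open>The density is 1/m(A) on A, and the complement of A is null for the uniform
  measure.\<close>

lemma RN_deriv_uniform_measure:
  assumes A: "compact A" "emeasure m A > 0"
  shows "AE x in uniform_measure m A.
    ennreal_powr (RN_deriv m (uniform_measure m A) x) (- 1 / N) = ennreal (measure m A powr (1 / N))"
proof (rule AE_uniform_measureI)
  interpret sigma_finite_measure m by (rule sigma_finite)
  have Ab: "A \<in> sets borel" using compact_imp_closed[OF A(1)] by simp
  then show "A \<in> sets m" by simp
  have fin: "emeasure m A < \<infinity>" by (rule emeasure_bounded[OF Ab compact_imp_bounded[OF A(1)]])
  have mA: "emeasure m A = ennreal (measure m A)" using fin by (intro emeasure_eq_ennreal_measure) auto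
  then have pos: "measure m A > 0" using A(2) by (metis ennreal_less_zero_iff ennreal_0 measure_nonneg order_le_less not_less_iff_gr_or_eq)
  have "AE x in m. indicator A x / emeasure m A = RN_deriv m (uniform_measure m A) x"
    by (rule RN_deriv_unique) (use Ab in \<open>auto simp: uniform_measure_def\<close>)
  then show "AE x in m. x \<in> A \<longrightarrow>
      ennreal_powr (RN_deriv m (uniform_measure m A) x) (- 1 / N) = ennreal (measure m A powr (1 / N))"
  proof eventually_elim
    case (elim x)
    show ?case
    proof
      assume "x \<in> A"
      then have "RN_deriv m (uniform_measure m A) x = 1 / ennreal (measure m A)" using elim mA by simp
      also have "\<dots> = ennreal (1 / measure m A)" using divide_ennreal[of 1 "measure m A"] pos by simp
      finally have eq: "RN_deriv m (uniform_measure m A) x = ennreal (1 / measure m A)" .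
      have "(1 / measure m A) powr (- 1 / N) = measure m A powr (1 / N)"
        using pos by (simp add: powr_divide powr_minus_divide)
      then show "ennreal_powr (RN_deriv m (uniform_measure m A) x) (- 1 / N) = ennreal (measure m A powr (1 / N))"
        unfolding eq ennreal_powr_def using pos N_gt_1 by (simp add: divide_eq_0_iff)
    qed
  qed
qed

lemma optimal_plan_exists:
  assumes A0: "compact A0" "emeasure m A0 > 0" and A1: "compact A1" "emeasure m A1 > 0"
  obtains \<pi> where "\<pi> \<in> OptGeo (uniform_measure m A0) (uniform_measure m A1)"
    "prob_space \<pi>" "sets \<pi> = sets borel" "AE \<gamma> in \<pi>. \<gamma> \<in> Geo \<and> ev 0 \<gamma> \<in> A0 \<and> ev 1 \<gamma> \<in> A1"
    "distr \<pi> borel (ev 0) = uniform_measure m A0" "distr \<pi> borel (ev 1) = uniform_measure m A1"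
    "\<And>t. 0 \<le> t \<Longrightarrow> t \<le> 1 \<Longrightarrow> absolutely_continuous m (distr \<pi> borel (ev t))"
proof -
  have bf: "boundedly_finite m" by unfold_locales
  note u0 = uniform_measure_Pcm_P2[OF bf A0] and u1 = uniform_measure_Pcm_P2[OF bf A1]
  obtain \<pi> where \<pi>: "\<pi> \<in> OptGeo (uniform_measure m A0) (uniform_measure m A1)"
    "\<And>t. 0 \<le> t \<Longrightarrow> t < 1 \<Longrightarrow> absolutely_continuous m (distr \<pi> borel (ev t))"
    using monge u0(2,3) u1(2) unfolding monge_space_def by (auto simp: Ball_def) (metis (no_types, lifting))
  have bp: "prob_space \<pi>" "sets \<pi> = sets borel" and geo: "AE \<gamma> in \<pi>. \<gamma> \<in> Geo"
    and e: "distr \<pi> borel (ev 0) = uniform_measure m A0" "distr \<pi> borel (ev 1) = uniform_measure m A1"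
    using \<pi>(1) by (auto simp: OptGeo_def borel_prob_def)
  have meas: "ev t \<in> measurable \<pi> borel" for t
    using borel_measurable_ev[of t] measurable_cong_sets[OF bp(2) refl] by blast
  have in_A: "AE \<gamma> in \<pi>. ev s \<gamma> \<in> A" if "compact A" "distr \<pi> borel (ev s) = uniform_measure m A" for s A
  proof -
    have "AE x in uniform_measure m A. x \<in> A"
      using compact_imp_closed[OF that(1)] by (intro AE_uniform_measureI) auto
    then show ?thesis unfolding that(2)[symmetric] by (rule AE_distrD[OF meas])
  qed
  have "AE \<gamma> in \<pi>. \<gamma> \<in> Geo \<and> ev 0 \<gamma> \<in> A0 \<and> ev 1 \<gamma> \<in> A1"
    using geo in_A[OF A0(1) e(1)] in_A[OF A1(1) e(2)] by eventually_elim simp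
  \<comment> \<open>The Monge property covers t < 1; at t = 1 the marginal is itself a uniform
    measure.\<close>
  moreover have "absolutely_continuous m (distr \<pi> borel (ev t))" if "0 \<le> t" "t \<le> 1" for t
    using \<pi>(2)[of t] that u1(3) e(2) by (cases "t = 1") auto
  ultimately show thesis using that \<pi>(1) bp e by blast
qed

text \<open>Each bound drops one of the two nonnegative summands. The densities at times 0 and 1 are
  constant along the plan, so the surviving summand is explicit, and inverting the power -1/N bounds
  the density at time t.\<close>

lemma density_bound:
  assumes A0: "compact A0" "emeasure m A0 > 0" and A1: "compact A1" "emeasure m A1 > 0"
    and D: "\<And>x y. x \<in> A0 \<Longrightarrow> y \<in> A1 \<Longrightarrow> dist x y \<le> D"
    and c: "0 < c" "\<And>t \<theta>. 0 < t \<Longrightarrow> t < 1 \<Longrightarrow> 0 \<le> \<theta> \<Longrightarrow> \<theta> \<le> D \<Longrightarrow> ennreal (c * t) \<le> tau_coeff K N t \<theta>"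
    and \<pi>: "\<pi> \<in> OptGeo (uniform_measure m A0) (uniform_measure m A1)"
    "prob_space \<pi>" "sets \<pi> = sets borel" "AE \<gamma> in \<pi>. \<gamma> \<in> Geo \<and> ev 0 \<gamma> \<in> A0 \<and> ev 1 \<gamma> \<in> A1"
    "distr \<pi> borel (ev 0) = uniform_measure m A0" "distr \<pi> borel (ev 1) = uniform_measure m A1"
    and ac: "absolutely_continuous m (distr \<pi> borel (ev t))"
    and t: "0 < t" "t < 1" and B: "B \<in> sets borel"
  shows "emeasure (distr \<pi> borel (ev t)) B \<le>
      ennreal ((Q powr (- 1 / N) * (c * t * measure m A1 powr (1 / N))) powr (- N)) * emeasure m B" (is ?thesis1)
    and "emeasure (distr \<pi> borel (ev t)) B \<le>
      ennreal ((Q powr (- 1 / N) * (c * (1 - t) * measure m A0 powr (1 / N))) powr (- N)) * emeasure m B" (is ?thesis2)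
proof -
  interpret sigma_finite_measure m by (rule sigma_finite)
  define \<rho> where "\<rho> s = RN_deriv m (distr \<pi> borel (ev s))" for s
  have meas: "ev s \<in> measurable \<pi> borel" for s
    using borel_measurable_ev[of s] measurable_cong_sets[OF \<pi>(3) refl] by blast
  have bf: "boundedly_finite m" by unfold_locales
  note u0 = uniform_measure_Pcm_P2[OF bf A0] and u1 = uniform_measure_Pcm_P2[OF bf A1]
  have mpos: "measure m A > 0" if "compact A" "emeasure m A > 0" for A
  proof -
    have "emeasure m A < \<infinity>"
      using that compact_imp_closed[OF that(1)] by (intro emeasure_bounded compact_imp_bounded) auto
    then show ?thesis using that(2) by (simp add: measure_def enn2real_positive_iff)
  qed
  have q: "AE \<gamma> in \<pi>. ennreal_powr (\<rho> t (ev t \<gamma>)) (- 1 / N) \<ge>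
      ennreal (Q powr (- 1 / N)) *
        (tau_coeff K N (1 - t) (dist (ev 0 \<gamma>) (ev 1 \<gamma>)) * ennreal_powr (\<rho> 0 (ev 0 \<gamma>)) (- 1 / N) +
         tau_coeff K N t (dist (ev 0 \<gamma>) (ev 1 \<gamma>)) * ennreal_powr (\<rho> 1 (ev 1 \<gamma>)) (- 1 / N))"
    using qcd u0(1) u1(1) \<pi>(1) t unfolding QCD_def Let_def \<rho>_def by simp
  have r0: "AE \<gamma> in \<pi>. ennreal_powr (\<rho> 0 (ev 0 \<gamma>)) (- 1 / N) = ennreal (measure m A0 powr (1 / N))"
    unfolding \<rho>_def \<pi>(5) by (rule AE_distrD[OF meas]) (simp only: \<pi>(5) RN_deriv_uniform_measure[OF A0])
  have r1: "AE \<gamma> in \<pi>. ennreal_powr (\<rho> 1 (ev 1 \<gamma>)) (- 1 / N) = ennreal (measure m A1 powr (1 / N))"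
    unfolding \<rho>_def \<pi>(6) by (rule AE_distrD[OF meas]) (simp only: \<pi>(6) RN_deriv_uniform_measure[OF A1])
  \<comment> \<open>A bound known almost surely under the plan is pushed to m: it holds m-almost
    everywhere where \<rho> is positive, and where \<rho> vanishes it is trivial.\<close>
  have final: "emeasure (distr \<pi> borel (ev t)) B \<le> ennreal (y powr (- N)) * emeasure m B"
    if y: "y > 0" and AE: "AE \<gamma> in \<pi>. ennreal y \<le> ennreal_powr (\<rho> t (ev t \<gamma>)) (- 1 / N)" for y
  proof -
    let ?\<mu> = "distr \<pi> borel (ev t)"
    have dens: "density m (\<rho> t) = ?\<mu>"
      unfolding \<rho>_def by (rule density_RN_deriv[OF ac]) simp
    have \<rho>m: "\<rho> t \<in> borel_measurable m" unfolding \<rho>_def by (rule borel_measurable_RN_deriv)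
    have "AE \<gamma> in \<pi>. \<rho> t (ev t \<gamma>) \<le> ennreal (y powr (- N))"
      using AE by eventually_elim (use y N_gt_1 in \<open>auto intro: ennreal_powr_ge_imp_le\<close>)
    then have "AE x in ?\<mu>. \<rho> t x \<le> ennreal (y powr (- N))"
      using \<rho>m by (subst AE_distr_iff[OF meas]) auto
    then have "AE x in m. 0 < \<rho> t x \<longrightarrow> \<rho> t x \<le> ennreal (y powr (- N))"
      unfolding dens[symmetric] using AE_density[OF \<rho>m] by simp
    then have "AE x in m. \<rho> t x * indicator B x \<le> ennreal (y powr (- N)) * indicator B x"
    proof eventually_elim
      case (elim x)
      then show ?case by (cases "\<rho> t x = 0") (auto simp: zero_less_iff_neq_zero indicator_def)
    qed
    then have "(\<integral>\<^sup>+x. \<rho> t x * indicator B x \<partial>m) \<le> (\<integral>\<^sup>+x. ennreal (y powr (- N)) * indicator B x \<partial>m)"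
      by (rule nn_integral_mono_AE)
    also have "\<dots> = ennreal (y powr (- N)) * emeasure m B" using B by (simp add: nn_integral_cmult)
    also have "(\<integral>\<^sup>+x. \<rho> t x * indicator B x \<partial>m) = emeasure ?\<mu> B"
      unfolding dens[symmetric] using B \<rho>m by (simp add: emeasure_density)
    finally show ?thesis .
  qed
  have dD: "AE \<gamma> in \<pi>. dist (ev 0 \<gamma>) (ev 1 \<gamma>) \<le> D"
    using \<pi>(4) by eventually_elim (use D in auto)
  have Qpos: "Q powr (- 1 / N) > 0" using Q_ge_1 by simp
  show ?thesis1
  proof (rule final)
    show "0 < Q powr (- 1 / N) * (c * t * measure m A1 powr (1 / N))"
      using Qpos c(1) t mpos[OF A1] by simp
    show "AE \<gamma> in \<pi>. ennreal (Q powr (- 1 / N) * (c * t * measure m A1 powr (1 / N))) \<le> ennreal_powr (\<rho> t (ev t \<gamma>)) (- 1 / N)"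
      using q r1 dD
    proof eventually_elim
      case (elim \<gamma>)
      have "ennreal (Q powr (- 1 / N) * (c * t * measure m A1 powr (1 / N))) =
          ennreal (Q powr (- 1 / N)) * (ennreal (c * t) * ennreal (measure m A1 powr (1 / N)))"
        using c(1) t by (simp add: ennreal_mult)
      also have "\<dots> \<le> ennreal (Q powr (- 1 / N)) * (tau_coeff K N (1 - t) (dist (ev 0 \<gamma>) (ev 1 \<gamma>)) * ennreal_powr (\<rho> 0 (ev 0 \<gamma>)) (- 1 / N) +
         tau_coeff K N t (dist (ev 0 \<gamma>) (ev 1 \<gamma>)) * ennreal_powr (\<rho> 1 (ev 1 \<gamma>)) (- 1 / N))"
        unfolding elim(2) using c(2)[OF t, of "dist (ev 0 \<gamma>) (ev 1 \<gamma>)"] elim(3)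
        by (intro mult_left_mono add_increasing mult_right_mono) auto
      also note elim(1)
      finally show ?case .
    qed
  qed
  show ?thesis2
  proof (rule final)
    show "0 < Q powr (- 1 / N) * (c * (1 - t) * measure m A0 powr (1 / N))"
      using Qpos c(1) t mpos[OF A0] by simp
    show "AE \<gamma> in \<pi>. ennreal (Q powr (- 1 / N) * (c * (1 - t) * measure m A0 powr (1 / N))) \<le> ennreal_powr (\<rho> t (ev t \<gamma>)) (- 1 / N)"
      using q r0 dD
    proof eventually_elim
      case (elim \<gamma>)
      have "ennreal (Q powr (- 1 / N) * (c * (1 - t) * measure m A0 powr (1 / N))) =
          ennreal (Q powr (- 1 / N)) * (ennreal (c * (1 - t)) * ennreal (measure m A0 powr (1 / N)))"
        using c(1) t by (simp add: ennreal_mult)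
      also have "\<dots> \<le> ennreal (Q powr (- 1 / N)) * (tau_coeff K N (1 - t) (dist (ev 0 \<gamma>) (ev 1 \<gamma>)) * ennreal_powr (\<rho> 0 (ev 0 \<gamma>)) (- 1 / N) +
         tau_coeff K N t (dist (ev 0 \<gamma>) (ev 1 \<gamma>)) * ennreal_powr (\<rho> 1 (ev 1 \<gamma>)) (- 1 / N))"
        unfolding elim(2) using c(2)[of "1 - t" "dist (ev 0 \<gamma>) (ev 1 \<gamma>)"] elim(3) t
        by (intro mult_left_mono add_increasing2 mult_right_mono) auto
      also note elim(1)
      finally show ?case .
    qed
  qed
qed

text \<open>Transporting mass from a small ball at \<open>x\<close> towards a fixed compact set \<open>A\<^sub>1\<close> for a short time keeps
  it near \<open>x\<close> with density bounded independently of the mass of the small ball.\<close>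

lemma ball_measure_lower_bound:
  assumes R: "R > 0" and e: "e > 0"
  obtains b where "b > 0" "\<And>x. x \<in> ball x0 R \<Longrightarrow> ennreal b \<le> emeasure m (ball x e)"
proof -
  have "emeasure m (ball x0 R) > 0" using R by (intro emeasure_open_pos) auto
  then obtain A1 where A1: "compact A1" "A1 \<subseteq> ball x0 R" "emeasure m A1 > 0"
    by (rule compact_subset_positive[rotated]) auto
  define D where "D = 2 * R + e"
  have D: "D > 0" using R e by (simp add: D_def)
  obtain c where c: "0 < c" "\<And>t \<theta>. 0 < t \<Longrightarrow> t < 1 \<Longrightarrow> 0 \<le> \<theta> \<Longrightarrow> \<theta> \<le> D \<Longrightarrow> ennreal (c * t) \<le> tau_coeff K N t \<theta>"
    by (rule tau_coeff_ge[OF N_gt_1]) (rule that)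
  \<comment> \<open>Short enough that no curve, having length at most D, moves farther than e/2 away
    from its start in \<open>ball x (e / 2)\<close>.\<close>
  define t where "t = min (1/2) (e / (2 * D))"
  have t: "0 < t" "t < 1" using e D by (auto simp: t_def)
  have "t * D \<le> e / (2 * D) * D" unfolding t_def using D by (intro mult_right_mono) auto
  then have tD: "t * D \<le> e / 2" using D by simp
  define C where "C = (Q powr (- 1 / N) * (c * t * measure m A1 powr (1 / N))) powr (- N)"
  \<comment> \<open>All the mass at time t sits in \<open>ball x e\<close>, so C times the measure
    of this ball is at least 1. The denominator C + 1 avoids dividing by a C that is only known to
    be nonnegative.\<close>
  have bound: "ennreal (1 / (C + 1)) \<le> emeasure m (ball x e)" if x: "x \<in> ball x0 R" for x
  proof -
    have "emeasure m (ball x (e / 2)) > 0" using e by (intro emeasure_open_pos) auto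
    then obtain A0 where A0: "compact A0" "A0 \<subseteq> ball x (e / 2)" "emeasure m A0 > 0"
      by (rule compact_subset_positive[rotated]) auto
    have dD: "dist a b \<le> D" if "a \<in> A0" "b \<in> A1" for a b
    proof -
      have "dist x a < e / 2" "dist x0 b < R" "dist x0 x < R" using that A0 A1 x by auto
      then show ?thesis
        using dist_triangle[of a b x] dist_triangle[of x b x0] e by (simp add: D_def dist_commute)
    qed
    obtain \<pi> where \<pi>: "\<pi> \<in> OptGeo (uniform_measure m A0) (uniform_measure m A1)"
      "prob_space \<pi>" "sets \<pi> = sets borel" "AE \<gamma> in \<pi>. \<gamma> \<in> Geo \<and> ev 0 \<gamma> \<in> A0 \<and> ev 1 \<gamma> \<in> A1"
      "distr \<pi> borel (ev 0) = uniform_measure m A0" "distr \<pi> borel (ev 1) = uniform_measure m A1"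
      "\<And>t. 0 \<le> t \<Longrightarrow> t \<le> 1 \<Longrightarrow> absolutely_continuous m (distr \<pi> borel (ev t))"
      by (rule optimal_plan_exists[OF A0(1,3) A1(1,3)]) (rule that)
    have meas: "ev t \<in> measurable \<pi> borel"
      using borel_measurable_ev[of t] measurable_cong_sets[OF \<pi>(3) refl] by blast
    have ac: "absolutely_continuous m (distr \<pi> borel (ev t))" using \<pi>(7) t by simp
    have "AE \<gamma> in \<pi>. ev t \<gamma> \<in> ball x e"
      using \<pi>(4)
    proof eventually_elim
      case (elim \<gamma>)
      have "dist (ev 0 \<gamma>) (ev t \<gamma>) = t * dist (ev 0 \<gamma>) (ev 1 \<gamma>)"
        using Geo_dist[of \<gamma> 0 t] elim t by simp
      also have "\<dots> \<le> t * D" using elim dD t by (intro mult_left_mono) auto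
      finally have "dist (ev 0 \<gamma>) (ev t \<gamma>) \<le> e / 2" using tD by simp
      moreover have "dist x (ev 0 \<gamma>) < e / 2" using elim A0 by auto
      ultimately show ?case using dist_triangle[of x "ev t \<gamma>" "ev 0 \<gamma>"] by simp
    qed
    then have "1 = emeasure \<pi> (ev t -` ball x e \<inter> space \<pi>)"
      using meas measurable_sets[OF meas, of "ball x e"]
      by (intro prob_space.emeasure_eq_1_AE[OF \<pi>(2), symmetric]) auto
    also have "\<dots> = emeasure (distr \<pi> borel (ev t)) (ball x e)" using meas by (subst emeasure_distr) auto
    also have "\<dots> \<le> ennreal C * emeasure m (ball x e)"
      unfolding C_def by (rule density_bound(1)[OF A0(1,3) A1(1,3) dD c \<pi>(1-6) ac t]) auto
    also have "emeasure m (ball x e) = ennreal (measure m (ball x e))"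
      using emeasure_bounded[of "ball x e"] by (intro emeasure_eq_ennreal_measure) auto
    finally have "1 \<le> C * measure m (ball x e)"
      by (simp add: C_def ennreal_mult[symmetric] flip: ennreal_1)
    also have "\<dots> \<le> (C + 1) * measure m (ball x e)" by (intro mult_right_mono) auto
    finally have "1 / (C + 1) \<le> measure m (ball x e)"
      by (simp add: C_def divide_le_eq add_nonneg_pos mult.commute)
    then show ?thesis
      using emeasure_bounded[of "ball x e"] by (subst emeasure_eq_ennreal_measure) (auto intro: ennreal_leI)
  qed
  have "0 < 1 / (C + 1)" by (simp add: C_def add_nonneg_pos)
  then show thesis using that bound by blast
qed

text \<open>Balls of radius e/2 about an e-separated set are disjoint, have mass at least b each and
  lie in one ball of finite mass; this bounds the cardinality of separated sets. One of largest
  cardinality is an e-net, and a closed totally bounded set in a complete space is compact.\<close>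

lemma proper:
  fixes B :: "'a set"
  assumes "bounded B"
  shows "compact (closure B)"
proof -
  have tb: "\<exists>k. finite k \<and> closure B \<subseteq> (\<Union>x\<in>k. ball x e)" if e: "e > 0" for e
  proof -
    obtain x0 R where R: "R > 0" "closure B \<subseteq> ball x0 R"
    proof -
      obtain x0 r where "closure B \<subseteq> cball x0 r"
        using assms bounded_closure bounded_subset_cball by metis
      then have "closure B \<subseteq> ball x0 (\<bar>r\<bar> + 1)" by force
      then show ?thesis using that[of "\<bar>r\<bar> + 1" x0] by simp
    qed
    obtain b where b: "b > 0" "\<And>x. x \<in> ball x0 R \<Longrightarrow> ennreal b \<le> emeasure m (ball x (e / 2))"
      using ball_measure_lower_bound[OF R(1), of "e / 2" x0] e by auto
    define M where "M = measure m (ball x0 (R + e))"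
    have Mfin: "emeasure m (ball x0 (R + e)) = ennreal M"
      unfolding M_def using emeasure_bounded[of "ball x0 (R + e)"] by (intro emeasure_eq_ennreal_measure) auto
    define P where "P T \<longleftrightarrow> finite T \<and> T \<subseteq> closure B \<and> (\<forall>x\<in>T. \<forall>y\<in>T. x \<noteq> y \<longrightarrow> e \<le> dist x y)" for T
    have card: "real (card T) * b \<le> M" if "P T" for T
    proof -
      have T: "finite T" "T \<subseteq> ball x0 R" using that R by (auto simp: P_def)
      have disj: "disjoint_family_on (\<lambda>x. ball x (e / 2)) T"
        unfolding disjoint_family_on_def
      proof (intro ballI impI equals0I)
        fix x y z assume xy: "x \<in> T" "y \<in> T" "x \<noteq> y" and z: "z \<in> ball x (e / 2) \<inter> ball y (e / 2)"
        then have "dist x y < e" using dist_triangle[of x y z] by (simp add: dist_commute)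
        moreover have "e \<le> dist x y" using \<open>P T\<close> xy by (auto simp: P_def)
        ultimately show False by simp
      qed
      have "ennreal (real (card T) * b) = (\<Sum>x\<in>T. ennreal b)"
        using b by (simp add: ennreal_mult ennreal_of_nat_eq_real_of_nat)
      also have "\<dots> \<le> (\<Sum>x\<in>T. emeasure m (ball x (e / 2)))" using b T by (intro sum_mono) auto
      also have "\<dots> = emeasure m (\<Union>x\<in>T. ball x (e / 2))" using disj T by (intro sum_emeasure) auto
      also have "\<dots> \<le> emeasure m (ball x0 (R + e))"
      proof (intro emeasure_mono subsetI)
        fix z assume "z \<in> (\<Union>x\<in>T. ball x (e / 2))"
        then obtain x where "x \<in> T" "dist x z < e / 2" by auto
        moreover have "dist x0 x < R" using \<open>x \<in> T\<close> T by auto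
        ultimately show "z \<in> ball x0 (R + e)" using dist_triangle[of x0 z x] e by simp
      qed auto
      finally show ?thesis using Mfin by (simp add: M_def)
    qed
    have "\<forall>T. P T \<longrightarrow> card T < nat \<lceil>M / b\<rceil> + 1"
    proof (intro allI impI)
      fix T assume "P T"
      then have "real (card T) \<le> M / b" using card b by (simp add: pos_le_divide_eq)
      then show "card T < nat \<lceil>M / b\<rceil> + 1" by linarith
    qed
    moreover have "P {}" by (simp add: P_def)
    ultimately obtain T where T: "P T" "\<forall>T'. P T' \<longrightarrow> card T' \<le> card T"
      using ex_has_greatest_nat[of P "{}" card] by blast
    have "closure B \<subseteq> (\<Union>x\<in>T. ball x e)"
    proof (rule ccontr)
      assume "\<not> ?thesis"
      then obtain z where z: "z \<in> closure B" "z \<notin> (\<Union>x\<in>T. ball x e)" by blast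
      then have zT: "e \<le> dist x z" if "x \<in> T" for x using that by (force simp: not_less)
      have "z \<notin> T" using zT e by force
      moreover have "P (insert z T)" using T(1) z(1) zT by (auto simp: P_def dist_commute)
      then have "card (insert z T) \<le> card T" using T(2) by blast
      ultimately show False using T(1) by (simp add: P_def)
    qed
    then show ?thesis using T(1) by (auto simp: P_def)
  qed
  then show ?thesis using complete_eq_closed[of "closure B"] by (simp add: compact_eq_totally_bounded)
qed

end

section \<open>Slopes along geodesics\<close>

text \<open>Reverse Fatou for the difference quotients of \<open>\<phi>\<close> replaces the almost everywhere
  differentiability of Lipschitz functions.\<close>

lemma increment_le_nn_integral:
  fixes \<phi> s :: "real \<Rightarrow> real"
  assumes lip: "M-lipschitz_on UNIV \<phi>" and s: "s \<in> borel_measurable borel" "\<And>t. 0 \<le> s t" "\<And>t. s t \<le> M"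
    and quot: "\<And>t e. 0 < t \<Longrightarrow> t < 1 \<Longrightarrow> e > 0 \<Longrightarrow>
      \<forall>\<^sub>F n in sequentially. \<phi> (t + inverse (real (Suc n))) - \<phi> t \<le> (s t + e) * inverse (real (Suc n))"
  shows "ennreal (\<phi> 1 - \<phi> 0) \<le> (\<integral>\<^sup>+t. ennreal (s t) * indicator {0<..<1} t \<partial>lborel)"
proof -
  define h where "h n = inverse (real (Suc n))" for n
  have h: "0 < h n" "h n \<le> 1" for n by (auto simp: h_def inverse_le_1_iff)
  have h0: "h \<longlonglongrightarrow> 0" unfolding h_def[abs_def] by (rule LIMSEQ_inverse_real_of_nat)
  have M0: "0 \<le> M" by (rule lipschitz_on_nonneg[OF lip])
  have cont: "continuous_on A \<phi>" for A by (rule continuous_on_subset[OF lipschitz_on_continuous_on[OF lip]]) auto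
  \<comment> \<open>The interval [-1, 3] leaves room on both sides: two-sided derivatives are used
    on [0, 2], as t + h n can reach 2.\<close>
  obtain \<Phi> where \<Phi>: "\<And>x. x \<in> {-1..3} \<Longrightarrow> (\<Phi> has_vector_derivative \<phi> x) (at x within {-1..3})"
    using antiderivative_continuous[OF cont] by blast
  have D\<Phi>: "(\<Phi> has_real_derivative \<phi> x) (at x)" if "0 \<le> x" "x \<le> 2" for x
    using \<Phi>[of x] that at_within_Icc_at[of "-1" x 3] by (simp add: has_real_derivative_iff_has_vector_derivative)
  \<comment> \<open>Subtracting the quotients from the Lipschitz constant makes them nonnegative, as
    Fatou's lemma requires; \<open>F n\<close> is a primitive of \<open>v n\<close>.\<close>
  define v where "v n t = M - (\<phi> (t + h n) - \<phi> t) / h n" for n t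
  define F where "F n t = M * t - (\<Phi> (t + h n) - \<Phi> t) / h n" for n t
  have v0: "0 \<le> v n t" for n t
  proof -
    have "\<bar>\<phi> (t + h n) - \<phi> t\<bar> \<le> M * h n" using lipschitz_onD_real[OF lip, of "t + h n" t] h(1)[of n] by (simp add: dist_real_def)
    then have "\<phi> (t + h n) - \<phi> t \<le> M * h n" by simp
    then show ?thesis using h(1)[of n] by (simp add: v_def pos_divide_le_eq)
  qed
  have v_cont: "continuous_on A (v n)" for n A
    unfolding v_def[abs_def] using h(1)[of n]
    by (intro continuous_intros continuous_on_compose2[OF cont[of UNIV]] cont) auto
  have int_v: "(\<integral>\<^sup>+t. ennreal (indicator {0..1} t *\<^sub>R v n t) \<partial>lborel) = ennreal (F n 1 - F n 0)" for n
  proof -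
    have FTC: "integral\<^sup>L lborel (\<lambda>x. indicator {0..1} x *\<^sub>R v n x) = F n 1 - F n 0"
    proof (rule integral_FTC_atLeastAtMost)
      fix x :: real assume x: "0 \<le> x" "x \<le> 1"
      have "((\<lambda>t. \<Phi> (t + h n)) has_real_derivative \<phi> (x + h n)) (at x)"
        using D\<Phi>[of "x + h n"] x h[of n] by (simp add: DERIV_shift)
      then have "(F n has_real_derivative v n x) (at x)"
        unfolding F_def[abs_def] v_def using D\<Phi>[of x] x h(1)[of n] by (auto intro!: derivative_eq_intros)
      then show "(F n has_vector_derivative v n x) (at x within {0..1})"
        by (simp add: has_real_derivative_iff_has_vector_derivative has_vector_derivative_at_within)
    qed (auto intro: v_cont)
    have "integrable lborel (\<lambda>x. indicator {0..1} x *\<^sub>R v n x)"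
      using borel_integrable_atLeastAtMost'[OF v_cont] unfolding set_integrable_def by blast
    then show ?thesis unfolding FTC[symmetric] using v0 by (intro nn_integral_eq_integral) auto
  qed
  \<comment> \<open>Only difference quotients of \<Phi> at 0 and 1 occur here, and \<Phi> is
    differentiable there with derivative \<phi>, whereas \<phi> itself need not be
    differentiable.\<close>
  have lim: "(\<lambda>n. F n 1 - F n 0) \<longlonglongrightarrow> M - (\<phi> 1 - \<phi> 0)"
  proof -
    have q: "(\<lambda>n. (\<Phi> (x + h n) - \<Phi> x) / h n) \<longlonglongrightarrow> \<phi> x" if "0 \<le> x" "x \<le> 2" for x
    proof -
      have "((\<lambda>k. (\<Phi> (x + k) - \<Phi> x) / k) \<longlongrightarrow> \<phi> x) (at 0)" using D\<Phi>[OF that] by (simp add: DERIV_def)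
      moreover have "filterlim h (at 0) sequentially"
        using h0 h(1) by (auto simp: filterlim_at intro!: always_eventually less_imp_neq[symmetric])
      ultimately show ?thesis by (rule filterlim_compose)
    qed
    have "F n 1 - F n 0 = M - ((\<Phi> (1 + h n) - \<Phi> 1) / h n - (\<Phi> (0 + h n) - \<Phi> 0) / h n)" for n
      by (simp add: F_def)
    then show ?thesis by (simp only:) (intro tendsto_diff tendsto_const q; simp)
  qed
  have pw: "ennreal (M - s t) * indicator {0<..<1} t \<le> liminf (\<lambda>n. ennreal (indicator {0..1} t *\<^sub>R v n t))" for t
  proof (cases "0 < t \<and> t < 1")
    case True
    have "ennreal (M - s t) \<le> liminf (\<lambda>n. ennreal (v n t))"
      unfolding le_Liminf_iff
    proof (intro allI impI)
      fix y assume y: "y < ennreal (M - s t)"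
      then obtain r where r: "y = ennreal r" "0 \<le> r" by (cases y) auto
      then have rs: "r < M - s t" using y by (simp add: ennreal_less_iff)
      define e where "e = (M - s t - r) / 2"
      have e: "e > 0" using rs by (simp add: e_def)
      have "\<forall>\<^sub>F n in sequentially. \<phi> (t + h n) - \<phi> t \<le> (s t + e) * h n"
        unfolding h_def by (rule quot) (use True e in auto)
      then show "\<forall>\<^sub>F n in sequentially. y < ennreal (v n t)"
      proof eventually_elim
        case (elim n)
        then have "(\<phi> (t + h n) - \<phi> t) / h n \<le> s t + e" using h(1)[of n] by (simp add: pos_divide_le_eq)
        moreover have "r < M - (s t + e)" using rs by (simp add: e_def field_simps)
        ultimately have "r < v n t" unfolding v_def by linarith
        then show ?case using r by (simp add: ennreal_less_iff)
      qed
    qed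
    then show ?thesis using True by simp
  qed simp
  have "(\<integral>\<^sup>+t. ennreal (M - s t) * indicator {0<..<1} t \<partial>lborel) \<le>
      (\<integral>\<^sup>+t. liminf (\<lambda>n. ennreal (indicator {0..1} t *\<^sub>R v n t)) \<partial>lborel)"
    by (intro nn_integral_mono pw)
  also have "\<dots> \<le> liminf (\<lambda>n. \<integral>\<^sup>+t. ennreal (indicator {0..1} t *\<^sub>R v n t) \<partial>lborel)"
  proof (rule nn_integral_liminf)
    have "v n \<in> borel_measurable borel" for n by (rule borel_measurable_continuous_onI[OF v_cont])
    then show "(\<lambda>t. ennreal (indicator {0..1} t *\<^sub>R v n t)) \<in> borel_measurable lborel" for n by measurable
  qed
  also have "\<dots> = ennreal (M - (\<phi> 1 - \<phi> 0))"
    unfolding int_v by (intro lim_imp_Liminf tendsto_ennrealI lim) simp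
  finally have le: "(\<integral>\<^sup>+t. ennreal (M - s t) * indicator {0<..<1} t \<partial>lborel) \<le> ennreal (M - (\<phi> 1 - \<phi> 0))" .
  have "ennreal M = (\<integral>\<^sup>+t. ennreal M * indicator {0<..<1::real} t \<partial>lborel)"
    by (subst nn_integral_cmult_indicator) auto
  also have "\<dots> = (\<integral>\<^sup>+t. ennreal (M - s t) * indicator {0<..<1} t + ennreal (s t) * indicator {0<..<1} t \<partial>lborel)"
  proof (intro nn_integral_cong)
    fix t
    have "ennreal M = ennreal (M - s t) + ennreal (s t)" using s(2,3)[of t] by (simp flip: ennreal_plus)
    then show "ennreal M * indicator {0<..<1} t = ennreal (M - s t) * indicator {0<..<1} t + ennreal (s t) * indicator {0<..<1} t"
      by (simp add: distrib_right)
  qed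
  also have "\<dots> = (\<integral>\<^sup>+t. ennreal (M - s t) * indicator {0<..<1} t \<partial>lborel) + (\<integral>\<^sup>+t. ennreal (s t) * indicator {0<..<1} t \<partial>lborel)"
    using s(1) by (intro nn_integral_add borel_measurable_times_ennreal borel_measurable_indicator) auto
  also have "\<dots> \<le> ennreal (M - (\<phi> 1 - \<phi> 0)) + (\<integral>\<^sup>+t. ennreal (s t) * indicator {0<..<1} t \<partial>lborel)"
    by (intro add_right_mono le)
  finally have M_le: "ennreal M \<le> ennreal (M - (\<phi> 1 - \<phi> 0)) + (\<integral>\<^sup>+t. ennreal (s t) * indicator {0<..<1} t \<partial>lborel)" .
  show ?thesis
  proof (cases "\<phi> 1 - \<phi> 0 \<le> 0")
    case True
    then show ?thesis by (simp add: ennreal_neg)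
  next
    case False
    have "\<phi> 1 - \<phi> 0 \<le> M" using lipschitz_onD_real[OF lip, of 1 0] by simp
    \<comment> \<open>Splitting M in this way lets the finite term M - (\<phi> 1 - \<phi> 0),
      nonnegative by the Lipschitz bound, be cancelled from both sides.\<close>
    then have "ennreal M = ennreal (M - (\<phi> 1 - \<phi> 0)) + ennreal (\<phi> 1 - \<phi> 0)"
      using False by (simp flip: ennreal_plus)
    with M_le have "ennreal (M - (\<phi> 1 - \<phi> 0)) + ennreal (\<phi> 1 - \<phi> 0) \<le>
        ennreal (M - (\<phi> 1 - \<phi> 0)) + (\<integral>\<^sup>+t. ennreal (s t) * indicator {0<..<1} t \<partial>lborel)" by simp
    then show ?thesis by (simp add: ennreal_add_left_cancel_le)
  qed
qed

text \<open>Constant speed makes the distance travelled exactly the length times the elapsed time,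
  so the difference quotients of g along the curve are asymptotically at most the length times the
  slope at the current point.\<close>

lemma geodesic_increment_le:
  fixes g :: "'a::metric_space \<Rightarrow> real"
  assumes g: "L-lipschitz_on UNIV g" and \<gamma>: "\<gamma> \<in> Geo"
  shows "ennreal (g (ev 1 \<gamma>) - g (ev 0 \<gamma>)) \<le>
    (\<integral>\<^sup>+t. ennreal (dist (ev 0 \<gamma>) (ev 1 \<gamma>) * slope g (ev (clamp01 t) \<gamma>)) * indicator {0<..<1} t \<partial>lborel)"
proof -
  define l where "l = dist (ev 0 \<gamma>) (ev 1 \<gamma>)"
  define \<phi> where "\<phi> t = g (ev (clamp01 t) \<gamma>)" for t
  define s where "s t = l * slope g (ev (clamp01 t) \<gamma>)" for t
  have l0: "0 \<le> l" by (simp add: l_def)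
  have L0: "0 \<le> L" by (rule lipschitz_on_nonneg[OF g])
  have d: "dist (ev (clamp01 t) \<gamma>) (ev (clamp01 u) \<gamma>) = \<bar>clamp01 t - clamp01 u\<bar> * l" for t u
    unfolding l_def by (rule Geo_dist[OF \<gamma>]) auto
  have "ennreal (\<phi> 1 - \<phi> 0) \<le> (\<integral>\<^sup>+t. ennreal (s t) * indicator {0<..<1} t \<partial>lborel)"
  proof (rule increment_le_nn_integral)
    show "(L * l)-lipschitz_on UNIV \<phi>"
    proof (rule lipschitz_onI_real)
      fix t u
      have "\<bar>\<phi> t - \<phi> u\<bar> \<le> L * dist (ev (clamp01 u) \<gamma>) (ev (clamp01 t) \<gamma>)"
        unfolding \<phi>_def by (rule lipschitz_onD_real[OF g])
      also have "\<dots> = L * (\<bar>clamp01 u - clamp01 t\<bar> * l)" by (simp add: d)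
      also have "\<dots> \<le> L * (\<bar>u - t\<bar> * l)" using L0 l0 by (intro mult_left_mono mult_right_mono abs_clamp01_le)
      finally show "\<bar>\<phi> t - \<phi> u\<bar> \<le> L * l * dist t u" by (simp add: dist_real_def abs_minus_commute mult_ac)
    qed (use L0 l0 in simp)
    have "slope g \<in> borel_measurable borel"
      by (rule borel_measurable_slope[OF lipschitz_on_continuous_on[OF g]])
    then show "s \<in> borel_measurable borel"
      unfolding s_def[abs_def]
      by (intro borel_measurable_times borel_measurable_const
          measurable_compose[OF borel_measurable_continuous_onI[OF continuous_on_ev_clamp01]])
    show "0 \<le> s t" for t by (simp add: s_def l0)
    show "s t \<le> L * l" for t
      unfolding s_def mult.commute[of L l] by (intro mult_left_mono slope_le_lipschitz[OF g] l0)
    fix t e :: real assume t: "0 < t" "t < 1" and e: "e > 0"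
    let ?h = "\<lambda>n. inverse (real (Suc n))"
    have small: "\<forall>\<^sub>F n in sequentially. t + ?h n < 1"
    proof -
      have "(\<lambda>n. t + ?h n) \<longlonglongrightarrow> t + 0" by (intro tendsto_add tendsto_const LIMSEQ_inverse_real_of_nat)
      then show ?thesis using t by (intro order_tendstoD) auto
    qed
    show "\<forall>\<^sub>F n in sequentially. \<phi> (t + ?h n) - \<phi> t \<le> (s t + e) * ?h n"
    \<comment> \<open>The slope only sees points y different from x, so constant curves are treated
      apart; for l > 0 the tolerance e/l becomes e after multiplication by the speed.\<close>
    proof (cases "l = 0")
      case True
      have "\<phi> u = \<phi> t" for u
      proof -
        have "ev (clamp01 u) \<gamma> = ev (clamp01 t) \<gamma>" using d[of u t] True by simp
        then show ?thesis by (simp only: \<phi>_def)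
      qed
      then have "\<phi> (t + ?h n) - \<phi> t = 0" for n using diff_self by metis
      then show ?thesis using e l0 by (simp add: s_def True)
    next
      case False
      then have l: "l > 0" using l0 by simp
      define x where "x = ev (clamp01 t) \<gamma>"
      have "\<forall>\<^sub>F y in at x. \<bar>g y - g x\<bar> \<le> (slope g x + e / l) * dist x y"
        using e l by (intro slope_less_imp_eventually[OF g]) simp
      then obtain r where r: "r > 0" "\<And>y. y \<noteq> x \<Longrightarrow> dist y x < r \<Longrightarrow> \<bar>g y - g x\<bar> \<le> (slope g x + e / l) * dist x y"
        unfolding eventually_at by blast
      have "(\<lambda>n. ?h n * l) \<longlonglongrightarrow> 0 * l" by (intro tendsto_mult tendsto_const LIMSEQ_inverse_real_of_nat)
      then have "\<forall>\<^sub>F n in sequentially. ?h n * l < r" using r by (intro order_tendstoD) auto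
      with small show ?thesis
      proof eventually_elim
        case (elim n)
        define y where "y = ev (clamp01 (t + ?h n)) \<gamma>"
        have hn: "0 < ?h n" by simp
        have xy: "dist y x = ?h n * l"
          unfolding x_def y_def d using clamp01_id[of t] clamp01_id[of "t + ?h n"] t elim hn by simp
        then have "y \<noteq> x" using hn l by (metis dist_self mult_pos_pos less_irrefl)
        then have "\<bar>g y - g x\<bar> \<le> (slope g x + e / l) * (?h n * l)"
          using r(2)[of y] xy elim(2) by (simp add: dist_commute)
        also have "\<dots> = (l * slope g x + e / l * l) * ?h n" by (simp only: algebra_simps)
        also have "\<dots> = (s t + e) * ?h n" using l by (simp add: s_def x_def)
        finally show ?case by (simp add: \<phi>_def x_def y_def)
      qed
    qed
  qed
  then show ?thesis by (simp add: \<phi>_def s_def l_def clamp01_id)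
qed

text \<open>\<open>ennreal\<close> truncates negative values to 0, so the right-hand side integrates
  the positive part.\<close>

lemma ennreal_integral_le_nn_integral:
  fixes f :: "'b \<Rightarrow> real"
  assumes "integrable M f"
  shows "ennreal (integral\<^sup>L M f) \<le> (\<integral>\<^sup>+x. ennreal (f x) \<partial>M)"
proof -
  have i: "integrable M (\<lambda>x. max 0 (f x))" using assms by auto
  have "integral\<^sup>L M f \<le> (\<integral>x. max 0 (f x) \<partial>M)" by (intro integral_mono assms i) auto
  then have "ennreal (integral\<^sup>L M f) \<le> ennreal (\<integral>x. max 0 (f x) \<partial>M)" by (rule ennreal_leI)
  also have "\<dots> = (\<integral>\<^sup>+x. ennreal (max 0 (f x)) \<partial>M)" by (intro nn_integral_eq_integral[symmetric] i) auto
  also have "\<dots> = (\<integral>\<^sup>+x. ennreal (f x) \<partial>M)"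
    by (intro nn_integral_cong) (auto simp: max_def ennreal_neg)
  finally show ?thesis .
qed

section \<open>The Sobolev-to-Lipschitz property\<close>

lemma (in boundedly_finite) uniform_measure_integral:
  assumes A: "compact A" "emeasure m A > 0" and f: "f \<in> borel_measurable borel"
  shows "(\<integral>x. f x \<partial>uniform_measure m A) = (\<integral>x. f x * (indicator A x / measure m A) \<partial>m)"
    and "(\<lambda>x. indicator A x / measure m A) \<in> L2 m"
    and "(\<integral>x. indicator A x / measure m A \<partial>m) = 1"
    and "measure m A > 0"
proof -
  have Ab: "A \<in> sets borel" using compact_imp_closed[OF A(1)] by simp
  have fin: "emeasure m A < \<infinity>" by (rule emeasure_bounded[OF Ab compact_imp_bounded[OF A(1)]])
  then show pos: "measure m A > 0" using A(2) by (simp add: measure_def enn2real_positive_iff)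
  have mA: "emeasure m A = ennreal (measure m A)" using fin by (intro emeasure_eq_ennreal_measure) auto
  have "indicator A x / emeasure m A = ennreal (indicator A x / measure m A)" for x
    unfolding mA using pos divide_ennreal[of 1 "measure m A"] by (cases "x \<in> A") auto
  then have "uniform_measure m A = density m (\<lambda>x. ennreal (indicator A x / measure m A))"
    unfolding uniform_measure_def by simp
  then have "(\<integral>x. f x \<partial>uniform_measure m A) = (\<integral>x. (indicator A x / measure m A) *\<^sub>R f x \<partial>m)"
    using Ab f by (simp add: integral_density)
  then show "(\<integral>x. f x \<partial>uniform_measure m A) = (\<integral>x. f x * (indicator A x / measure m A) \<partial>m)"
    by (simp add: mult.commute)
  show "(\<lambda>x. indicator A x / measure m A) \<in> L2 m"
  proof (rule L2_bounded_support)
    show "\<bar>indicator A x / measure m A\<bar> \<le> 1 / measure m A" for x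
      using pos by (auto simp: indicator_def)
    show "bounded {x. indicator A x / measure m A \<noteq> 0}"
      by (rule bounded_subset[OF compact_imp_bounded[OF A(1)]]) (auto simp: indicator_def)
  qed (use Ab in auto)
  show "(\<integral>x. indicator A x / measure m A \<partial>m) = 1" using pos by simp
qed

text \<open>A measure dominated by C m has an essentially bounded density; being integrable as well,
  the density lies in L^2, the class against which weakly converging slopes are tested.\<close>

lemma (in boundedly_finite) RN_deriv_bounded:
  assumes \<nu>: "sets \<nu> = sets borel" "prob_space \<nu>" and C: "0 \<le> C"
    and le: "\<And>B. B \<in> sets borel \<Longrightarrow> emeasure \<nu> B \<le> ennreal C * emeasure m B"
  obtains h where "h \<in> borel_measurable borel" "\<And>x. 0 \<le> h x" "h \<in> L2 m" "integrable m h" "(\<integral>x. h x \<partial>m) = 1"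
    "density m (\<lambda>x. ennreal (h x)) = \<nu>"
proof -
  interpret sigma_finite_measure m by (rule sigma_finite)
  have ac: "absolutely_continuous m \<nu>"
    unfolding absolutely_continuous_def
  proof
    fix A assume "A \<in> null_sets m"
    then have "A \<in> sets borel" "emeasure m A = 0" by (auto simp: null_sets_def)
    then show "A \<in> null_sets \<nu>" using le[of A] \<nu>(1) by (auto simp: null_sets_def)
  qed
  define r where "r = RN_deriv m \<nu>"
  have dens: "density m r = \<nu>" unfolding r_def by (rule density_RN_deriv[OF ac]) (simp add: \<nu>)
  have rm: "r \<in> borel_measurable borel" using borel_measurable_RN_deriv[of m \<nu>] by (simp add: r_def)
  \<comment> \<open>The level C + 1 leaves a strict gap: a compact subset K of positive mass would
    give (C + 1) m(K) \<le> C m(K).\<close>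
  define B where "B = {x \<in> space borel. ennreal (C + 1) \<le> r x}"
  have Bm: "B \<in> sets borel" unfolding B_def using rm by measurable
  have "emeasure m B = 0"
  proof (rule ccontr)
    assume "emeasure m B \<noteq> 0"
    then have "emeasure m B > 0" by (simp add: zero_less_iff_neq_zero)
    then obtain K where K: "compact K" "K \<subseteq> B" "emeasure m K > 0" using compact_subset_positive[OF Bm] by blast
    have Kb: "K \<in> sets borel" using compact_imp_closed[OF K(1)] by simp
    have fin: "emeasure m K < \<infinity>" by (rule emeasure_bounded[OF Kb compact_imp_bounded[OF K(1)]])
    then have pos: "measure m K > 0" using K(3) by (simp add: measure_def enn2real_positive_iff)
    have mK: "emeasure m K = ennreal (measure m K)" using fin by (intro emeasure_eq_ennreal_measure) auto
    have "ennreal (C + 1) * emeasure m K = (\<integral>\<^sup>+x. ennreal (C + 1) * indicator K x \<partial>m)"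
      using Kb by (simp add: nn_integral_cmult_indicator)
    also have "\<dots> \<le> (\<integral>\<^sup>+x. r x * indicator K x \<partial>m)"
      using K(2) by (intro nn_integral_mono) (auto simp: B_def indicator_def)
    also have "\<dots> = emeasure \<nu> K" unfolding dens[symmetric] using Kb rm by (simp add: emeasure_density)
    also have "\<dots> \<le> ennreal C * emeasure m K" by (rule le[OF Kb])
    finally have "ennreal (C + 1) * ennreal (measure m K) \<le> ennreal C * ennreal (measure m K)" unfolding mK .
    moreover have "ennreal ((C + 1) * measure m K) = ennreal (C + 1) * ennreal (measure m K)"
      by (rule ennreal_mult) (use C in auto)
    moreover have "ennreal (C * measure m K) = ennreal C * ennreal (measure m K)"
      by (rule ennreal_mult) (use C in auto)
    ultimately have "ennreal ((C + 1) * measure m K) \<le> ennreal (C * measure m K)" by (simp only:)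
    then have "(C + 1) * measure m K \<le> C * measure m K" using C by (subst (asm) ennreal_le_iff) auto
    then show False using pos by simp
  qed
  then have "AE x in m. x \<notin> B" using Bm by (intro AE_not_in) (simp add: null_sets_def)
  then have rb: "AE x in m. r x < ennreal (C + 1)" by eventually_elim (simp add: B_def not_le)
  define h where "h x = enn2real (r x)" for x
  have hm: "h \<in> borel_measurable borel" unfolding h_def[abs_def] using rm by measurable
  have h0: "0 \<le> h x" for x by (simp add: h_def)
  have hr: "AE x in m. ennreal (h x) = r x"
    using rb
  proof eventually_elim
    case (elim x)
    then have "r x < top" using ennreal_less_top by (rule less_trans)
    then show ?case by (simp add: h_def)
  qed
  have dens': "density m (\<lambda>x. ennreal (h x)) = \<nu>"
    unfolding dens[symmetric] by (rule density_cong) (use hm rm hr in auto)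
  have hC: "AE x in m. h x \<le> C + 1"
    using rb
  proof eventually_elim
    case (elim x)
    have "enn2real (r x) \<le> enn2real (ennreal (C + 1))" using elim by (intro enn2real_mono) auto
    also have "enn2real (ennreal (C + 1)) = C + 1" by (rule enn2real_ennreal) (use C in simp)
    finally show ?case unfolding h_def .
  qed
  have nn1: "(\<integral>\<^sup>+x. ennreal (h x) \<partial>m) = 1"
  proof -
    have "(\<integral>\<^sup>+x. ennreal (h x) \<partial>m) = emeasure (density m (\<lambda>x. ennreal (h x))) (space m)"
      using hm by (simp add: emeasure_density)
    also have "\<dots> = 1" unfolding dens' using prob_space.emeasure_space_1[OF \<nu>(2)] sets_eq_imp_space_eq[OF \<nu>(1)] by simp
    finally show ?thesis .
  qed
  have hi: "integrable m h" using hm h0 nn1 by (intro integrableI_nonneg) auto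
  have "(\<integral>x. h x \<partial>m) = 1" using nn1 hm h0 by (simp add: integral_eq_nn_integral)
  moreover have "h \<in> L2 m"
  proof -
    have "integrable m (\<lambda>x. (h x)\<^sup>2)"
    proof (rule Bochner_Integration.integrable_bound)
      show "integrable m (\<lambda>x. (C + 1) * h x)" using hi by simp
      show "AE x in m. norm ((h x)\<^sup>2) \<le> norm ((C + 1) * h x)"
        using hC by eventually_elim (use h0 C in \<open>auto simp: power2_eq_square intro!: mult_right_mono\<close>)
    qed (use hm in auto)
    then show ?thesis using hm by (simp add: L2_def)
  qed
  ultimately show thesis using that hm h0 hi dens' by blast
qed

context qcd_space
begin

text \<open>The optimal geodesic plan between two uniform measures is a test plan: its time marginals have
  uniformly bounded density. Hence increments of Lipschitz functions between the two measures are
  controlled by their slopes integrated against a density in \<open>L\<^sup>2(m)\<close>, and this passes to weak limits.\<close>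

lemma test_plan_density:
  assumes A0: "compact A0" "emeasure m A0 > 0" and A1: "compact A1" "emeasure m A1 > 0"
    and D: "\<And>x y. x \<in> A0 \<Longrightarrow> y \<in> A1 \<Longrightarrow> dist x y \<le> D" "0 \<le> D"
    and W: "open W" "\<And>x z. x \<in> A0 \<Longrightarrow> dist x z \<le> D \<Longrightarrow> z \<in> W"
  obtains h where "h \<in> L2 m" "\<And>x. 0 \<le> h x" "integrable m h" "(\<integral>x. h x \<partial>m) = 1"
    "AE x in m. x \<notin> W \<longrightarrow> h x = 0"
    "\<And>g. g \<in> Lip_bs \<Longrightarrow> (\<integral>x. g x \<partial>uniform_measure m A1) - (\<integral>x. g x \<partial>uniform_measure m A0) \<le> D * (\<integral>x. slope g x * h x \<partial>m)"
proof -
  obtain c where c: "0 < c" "\<And>t \<theta>. 0 < t \<Longrightarrow> t < 1 \<Longrightarrow> 0 \<le> \<theta> \<Longrightarrow> \<theta> \<le> D \<Longrightarrow> ennreal (c * t) \<le> tau_coeff K N t \<theta>"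
    by (rule tau_coeff_ge[OF N_gt_1]) (rule that)
  obtain \<pi> where \<pi>: "\<pi> \<in> OptGeo (uniform_measure m A0) (uniform_measure m A1)"
    "prob_space \<pi>" "sets \<pi> = sets borel" "AE \<gamma> in \<pi>. \<gamma> \<in> Geo \<and> ev 0 \<gamma> \<in> A0 \<and> ev 1 \<gamma> \<in> A1"
    "distr \<pi> borel (ev 0) = uniform_measure m A0" "distr \<pi> borel (ev 1) = uniform_measure m A1"
    "\<And>t. 0 \<le> t \<Longrightarrow> t \<le> 1 \<Longrightarrow> absolutely_continuous m (distr \<pi> borel (ev t))"
    by (rule optimal_plan_exists[OF A0 A1]) (rule that)
  have meas: "ev t \<in> measurable \<pi> borel" for t
    using borel_measurable_ev[of t] measurable_cong_sets[OF \<pi>(3) refl] by blast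
  \<comment> \<open>One constant for all times: the two density bounds at t = 1/2, which is their
    worst value on the halves where they are used, and the densities of the uniform measures for t =
    0 and t = 1.\<close>
  define C where "C = Max {(Q powr (- 1 / N) * (c * (1/2) * measure m A1 powr (1 / N))) powr (- N),
    (Q powr (- 1 / N) * (c * (1/2) * measure m A0 powr (1 / N))) powr (- N), 1 / measure m A0, 1 / measure m A1}"
  have C: "(Q powr (- 1 / N) * (c * (1/2) * measure m A1 powr (1 / N))) powr (- N) \<le> C"
    "(Q powr (- 1 / N) * (c * (1/2) * measure m A0 powr (1 / N))) powr (- N) \<le> C"
    "1 / measure m A0 \<le> C" "1 / measure m A1 \<le> C"
    unfolding C_def by (auto intro!: Max_ge)
  have pos: "measure m A0 > 0" "measure m A1 > 0"
    using uniform_measure_integral(4)[OF A0 borel_measurable_const[of 0]]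
      uniform_measure_integral(4)[OF A1 borel_measurable_const[of 0]] by auto
  have C0: "0 \<le> C" using C(3) pos by (meson divide_nonneg_pos order_trans zero_le_one)
  have Qpos: "Q powr (- 1 / N) > 0" using Q_ge_1 by simp
  have unif: "emeasure (uniform_measure m A) B \<le> ennreal C * emeasure m B"
    if A: "compact A" "measure m A > 0" "1 / measure m A \<le> C" and B: "B \<in> sets borel" for A B
  proof -
    have Ab: "A \<in> sets borel" using compact_imp_closed[OF A(1)] by simp
    have mA: "emeasure m A = ennreal (measure m A)"
      using emeasure_bounded[OF Ab compact_imp_bounded[OF A(1)]] by (intro emeasure_eq_ennreal_measure) auto
    have "emeasure (uniform_measure m A) B = emeasure m (A \<inter> B) / ennreal (measure m A)"
      using Ab B by (simp add: mA)
    also have "\<dots> = ennreal (1 / measure m A) * emeasure m (A \<inter> B)"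
      using A(2) by (simp add: divide_ennreal_def inverse_ennreal mult.commute divide_inverse)
    also have "\<dots> \<le> ennreal C * emeasure m B"
      using A(3) Ab B by (intro mult_mono ennreal_leI emeasure_mono) auto
    finally show ?thesis .
  qed
  have marg: "emeasure (distr \<pi> borel (ev t)) B \<le> ennreal C * emeasure m B"
    if t: "0 \<le> t" "t \<le> 1" and B: "B \<in> sets borel" for t B
  proof -
    consider "t = 0" | "t = 1" | "1/2 \<le> t" "t < 1" | "0 < t" "t < 1/2" using t by linarith
    then show ?thesis
    proof cases
      case 1 then show ?thesis using unif[OF A0(1) pos(1) C(3) B] \<pi>(5) by simp
    next
      case 2 then show ?thesis using unif[OF A1(1) pos(2) C(4) B] \<pi>(6) by simp
    next
      case 3
      then have t': "0 < t" by simp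
      have "emeasure (distr \<pi> borel (ev t)) B \<le>
          ennreal ((Q powr (- 1 / N) * (c * t * measure m A1 powr (1 / N))) powr (- N)) * emeasure m B"
        by (rule density_bound(1)[OF A0 A1 D(1) c \<pi>(1-6) \<pi>(7)[OF t] t' 3(2) B]) auto
      also have "(Q powr (- 1 / N) * (c * t * measure m A1 powr (1 / N))) powr (- N) \<le>
          (Q powr (- 1 / N) * (c * (1/2) * measure m A1 powr (1 / N))) powr (- N)"
      proof (rule powr_mono2')
        show "- N \<le> 0" using N_gt_1 by simp
        show "0 < Q powr (- 1 / N) * (c * (1/2) * measure m A1 powr (1 / N))" using Qpos c(1) pos by simp
        show "Q powr (- 1 / N) * (c * (1/2) * measure m A1 powr (1 / N)) \<le> Q powr (- 1 / N) * (c * t * measure m A1 powr (1 / N))"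
          using 3 c(1) by (intro mult_left_mono mult_right_mono) auto
      qed
      also note C(1)
      finally show ?thesis by (simp add: mult_right_mono ennreal_leI)
    next
      case 4
      then have t': "t < 1" by simp
      have "emeasure (distr \<pi> borel (ev t)) B \<le>
          ennreal ((Q powr (- 1 / N) * (c * (1 - t) * measure m A0 powr (1 / N))) powr (- N)) * emeasure m B"
        by (rule density_bound(2)[OF A0 A1 D(1) c \<pi>(1-6) \<pi>(7)[OF t] 4(1) t' B]) auto
      also have "(Q powr (- 1 / N) * (c * (1 - t) * measure m A0 powr (1 / N))) powr (- N) \<le>
          (Q powr (- 1 / N) * (c * (1/2) * measure m A0 powr (1 / N))) powr (- N)"
      proof (rule powr_mono2')
        show "- N \<le> 0" using N_gt_1 by simp
        show "0 < Q powr (- 1 / N) * (c * (1/2) * measure m A0 powr (1 / N))" using Qpos c(1) pos by simp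
        show "Q powr (- 1 / N) * (c * (1/2) * measure m A0 powr (1 / N)) \<le> Q powr (- 1 / N) * (c * (1 - t) * measure m A0 powr (1 / N))"
          using 4 c(1) by (intro mult_left_mono mult_right_mono) auto
      qed
      also note C(2)
      finally show ?thesis by (simp add: mult_right_mono ennreal_leI)
    qed
  qed
  \<comment> \<open>Time is made random: \<nu> is the law of the position at an independent uniform
    time, and h will be its density, the time average of the densities of the marginals.\<close>
  define U where "U = uniform_measure lborel {0..1::real}"
  have U: "prob_space U" unfolding U_def by (intro prob_space_uniform_measure) auto
  have setsU: "sets U = sets borel" by (simp add: U_def)
  interpret U: prob_space U by (rule U)
  interpret \<pi>: prob_space \<pi> by (rule \<pi>(2))
  interpret P: pair_prob_space U \<pi> ..
  define E where "E z = ev (clamp01 (fst z)) (snd z)" for z :: "real \<times> 'a curve"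
  \<comment> \<open>Joint measurability: for time rounded down to a grid, the position depends on
    time through a countable index and each single evaluation is measurable; continuity of the
    curves gives the limit.\<close>
  have E: "E \<in> measurable (U \<Otimes>\<^sub>M \<pi>) borel"
  proof (rule borel_measurable_LIMSEQ_metric)
    show "(\<lambda>z. ev (clamp01 (of_int \<lfloor>real (Suc n) * fst z\<rfloor> / real (Suc n))) (snd z)) \<in> measurable (U \<Otimes>\<^sub>M \<pi>) borel" for n
    proof (rule measurable_compose_countable[where f = "\<lambda>i z. ev (clamp01 (of_int i / real (Suc n))) (snd z)"
          and g = "\<lambda>z. \<lfloor>real (Suc n) * fst z\<rfloor>"])
      show "(\<lambda>z. ev (clamp01 (of_int i / real (Suc n))) (snd z)) \<in> measurable (U \<Otimes>\<^sub>M \<pi>) borel" for i :: int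
        by (rule measurable_compose[OF measurable_snd meas])
      have "fst \<in> measurable (U \<Otimes>\<^sub>M \<pi>) borel"
        using measurable_fst[of U \<pi>] measurable_cong_sets[OF refl setsU] by blast
      then show "(\<lambda>z. \<lfloor>real (Suc n) * fst z\<rfloor>) \<in> measurable (U \<Otimes>\<^sub>M \<pi>) (count_space UNIV)"
        by measurable
    qed
    fix z :: "real \<times> 'a curve"
    have "(\<lambda>n. of_int \<lfloor>real (Suc n) * fst z\<rfloor> / real (Suc n)) \<longlonglongrightarrow> fst z"
    proof (rule tendsto_sandwich)
      have "(\<lambda>n. fst z - inverse (real (Suc n))) \<longlonglongrightarrow> fst z - 0"
        by (intro tendsto_diff tendsto_const LIMSEQ_inverse_real_of_nat)
      then show "(\<lambda>n. fst z - inverse (real (Suc n))) \<longlonglongrightarrow> fst z" by simp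
      show "\<forall>\<^sub>F n in sequentially. fst z - inverse (real (Suc n)) \<le> of_int \<lfloor>real (Suc n) * fst z\<rfloor> / real (Suc n)"
      proof (intro always_eventually allI)
        fix n
        have "real (Suc n) * fst z - 1 \<le> of_int \<lfloor>real (Suc n) * fst z\<rfloor>" by linarith
        then have "(real (Suc n) * fst z - 1) / real (Suc n) \<le> of_int \<lfloor>real (Suc n) * fst z\<rfloor> / real (Suc n)"
          by (rule divide_right_mono) simp
        moreover have "(real (Suc n) * fst z - 1) / real (Suc n) = fst z - inverse (real (Suc n))"
          by (simp add: field_simps)
        ultimately show "fst z - inverse (real (Suc n)) \<le> of_int \<lfloor>real (Suc n) * fst z\<rfloor> / real (Suc n)" by simp
      qed
      show "\<forall>\<^sub>F n in sequentially. of_int \<lfloor>real (Suc n) * fst z\<rfloor> / real (Suc n) \<le> fst z"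
      proof (intro always_eventually allI)
        fix n
        have "of_int \<lfloor>real (Suc n) * fst z\<rfloor> / real (Suc n) \<le> real (Suc n) * fst z / real (Suc n)"
          by (rule divide_right_mono) (auto simp: of_int_floor_le simp del: of_nat_Suc)
        then show "of_int \<lfloor>real (Suc n) * fst z\<rfloor> / real (Suc n) \<le> fst z" by simp
      qed
    qed auto
    then show "(\<lambda>n. ev (clamp01 (of_int \<lfloor>real (Suc n) * fst z\<rfloor> / real (Suc n))) (snd z)) \<longlonglongrightarrow> E z"
      unfolding E_def
      using continuous_on_ev_clamp01[of "snd z"]
      by (intro isCont_tendsto_compose[where g = "\<lambda>t. ev (clamp01 t) (snd z)"])
        (auto simp: continuous_on_eq_continuous_at)
  qed
  define \<nu> where "\<nu> = distr (U \<Otimes>\<^sub>M \<pi>) borel E"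
  have \<nu>: "sets \<nu> = sets borel" "prob_space \<nu>"
    unfolding \<nu>_def using P.prob_space_distr[OF E] by auto
  have nn\<nu>: "(\<integral>\<^sup>+x. f x \<partial>\<nu>) = (\<integral>\<^sup>+t. \<integral>\<^sup>+\<gamma>. f (ev (clamp01 t) \<gamma>) \<partial>\<pi> \<partial>U)"
    and nn\<nu>': "(\<integral>\<^sup>+x. f x \<partial>\<nu>) = (\<integral>\<^sup>+\<gamma>. \<integral>\<^sup>+t. f (ev (clamp01 t) \<gamma>) \<partial>U \<partial>\<pi>)"
    if f: "f \<in> borel_measurable borel" for f :: "'a \<Rightarrow> ennreal"
  proof -
    have fE: "(\<lambda>z. f (E z)) \<in> borel_measurable (U \<Otimes>\<^sub>M \<pi>)" by (rule measurable_compose[OF E f])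
    have eq: "(\<integral>\<^sup>+x. f x \<partial>\<nu>) = (\<integral>\<^sup>+z. f (E z) \<partial>(U \<Otimes>\<^sub>M \<pi>))"
      unfolding \<nu>_def by (rule nn_integral_distr[OF E]) (use f in simp)
    show "(\<integral>\<^sup>+x. f x \<partial>\<nu>) = (\<integral>\<^sup>+t. \<integral>\<^sup>+\<gamma>. f (ev (clamp01 t) \<gamma>) \<partial>\<pi> \<partial>U)"
      unfolding eq using \<pi>.nn_integral_fst[OF fE] by (simp add: E_def)
    show "(\<integral>\<^sup>+x. f x \<partial>\<nu>) = (\<integral>\<^sup>+\<gamma>. \<integral>\<^sup>+t. f (ev (clamp01 t) \<gamma>) \<partial>U \<partial>\<pi>)"
      unfolding eq using P.nn_integral_snd[OF fE] by (simp add: E_def)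
  qed
  have \<nu>C: "emeasure \<nu> B \<le> ennreal C * emeasure m B" if B: "B \<in> sets borel" for B
  proof -
    have "emeasure \<nu> B = (\<integral>\<^sup>+x. indicator B x \<partial>\<nu>)" using B \<nu>(1) by simp
    also have "\<dots> = (\<integral>\<^sup>+t. \<integral>\<^sup>+\<gamma>. indicator B (ev (clamp01 t) \<gamma>) \<partial>\<pi> \<partial>U)" by (rule nn\<nu>) (use B in simp)
    also have "\<dots> = (\<integral>\<^sup>+t. emeasure (distr \<pi> borel (ev (clamp01 t))) B \<partial>U)"
    proof (rule nn_integral_cong)
      fix t
      show "(\<integral>\<^sup>+\<gamma>. indicator B (ev (clamp01 t) \<gamma>) \<partial>\<pi>) = emeasure (distr \<pi> borel (ev (clamp01 t))) B"
        using nn_integral_distr[OF meas, of "indicator B" "clamp01 t"] B by simp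
    qed
    also have "\<dots> \<le> (\<integral>\<^sup>+t. ennreal C * emeasure m B \<partial>U)" by (intro nn_integral_mono marg B) auto
    also have "\<dots> = ennreal C * emeasure m B" using U.emeasure_space_1 by simp
    finally show ?thesis .
  qed
  obtain h where h: "h \<in> borel_measurable borel" "\<And>x. 0 \<le> h x" "h \<in> L2 m" "integrable m h" "(\<integral>x. h x \<partial>m) = 1"
    "density m (\<lambda>x. ennreal (h x)) = \<nu>"
    by (rule RN_deriv_bounded[OF \<nu> C0 \<nu>C]) (assumption | rule that)+
  \<comment> \<open>Almost every curve starts in A0, has length at most D and hence never leaves W,
    so \<nu> gives no mass to the complement of W.\<close>
  have hW: "AE x in m. x \<notin> W \<longrightarrow> h x = 0"
  proof -
    have Wb: "- W \<in> sets borel" using W(1) by simp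
    have "(\<integral>\<^sup>+x. ennreal (h x) * indicator (- W) x \<partial>m) = emeasure \<nu> (- W)"
      unfolding h(6)[symmetric] using Wb h(1) by (simp add: emeasure_density)
    also have "\<dots> = (\<integral>\<^sup>+x. indicator (- W) x \<partial>\<nu>)" using Wb \<nu>(1) by simp
    also have "\<dots> = (\<integral>\<^sup>+\<gamma>. \<integral>\<^sup>+t. indicator (- W) (ev (clamp01 t) \<gamma>) \<partial>U \<partial>\<pi>)" by (rule nn\<nu>') (use Wb in simp)
    also have "\<dots> = (\<integral>\<^sup>+\<gamma>. 0 \<partial>\<pi>)"
    proof (rule nn_integral_cong_AE)
      show "AE \<gamma> in \<pi>. (\<integral>\<^sup>+t. indicator (- W) (ev (clamp01 t) \<gamma>) \<partial>U) = 0"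
        using \<pi>(4)
      proof eventually_elim
        case (elim \<gamma>)
        have "ev (clamp01 t) \<gamma> \<in> W" for t
        proof (rule W(2))
          show "ev 0 \<gamma> \<in> A0" using elim by simp
          have "dist (ev 0 \<gamma>) (ev (clamp01 t) \<gamma>) = clamp01 t * dist (ev 0 \<gamma>) (ev 1 \<gamma>)"
            using Geo_dist[of \<gamma> 0 "clamp01 t"] elim by simp
          also have "\<dots> \<le> 1 * D" using elim D by (intro mult_mono) auto
          finally show "dist (ev 0 \<gamma>) (ev (clamp01 t) \<gamma>) \<le> D" by simp
        qed
        then show ?case by simp
      qed
    qed
    finally have "AE x in m. ennreal (h x) * indicator (- W) x = 0"
      using Wb h(1) by (subst nn_integral_0_iff_AE[symmetric]) auto
    then show ?thesis
    proof eventually_elim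
      case (elim x)
      then show ?case using h(2)[of x] by (auto simp: indicator_def ennreal_eq_0_iff)
    qed
  qed
  \<comment> \<open>The increment bound along single geodesics is integrated over the plan;
    exchanging time and plan turns the right-hand side into an integral against \<nu>.\<close>
  have main: "(\<integral>x. g x \<partial>uniform_measure m A1) - (\<integral>x. g x \<partial>uniform_measure m A0) \<le> D * (\<integral>x. slope g x * h x \<partial>m)"
    if g: "g \<in> Lip_bs" for g
  proof -
    obtain L where L: "L-lipschitz_on UNIV g" using g by (rule Lip_bsE)
    obtain M where M: "\<And>x. \<bar>g x\<bar> \<le> M" using g by (rule Lip_bs_bounded) blast
    have gm: "g \<in> borel_measurable borel" by (rule L2_borel[OF Lip_bs_L2[OF g]])
    have sm: "slope g \<in> borel_measurable borel" by (rule borel_measurable_slope_Lip_bs[OF g])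
    have gi: "integrable \<pi> (\<lambda>\<gamma>. g (ev t \<gamma>))" for t
      using measurable_compose[OF meas gm] M by (intro \<pi>.integrable_const_bound[of _ M]) auto
    have geq: "(\<integral>x. g x \<partial>distr \<pi> borel (ev t)) = (\<integral>\<gamma>. g (ev t \<gamma>) \<partial>\<pi>)" for t
      by (rule integral_distr[OF meas gm])
    have "(\<integral>x. g x \<partial>uniform_measure m A1) - (\<integral>x. g x \<partial>uniform_measure m A0) = (\<integral>\<gamma>. g (ev 1 \<gamma>) - g (ev 0 \<gamma>) \<partial>\<pi>)"
      unfolding \<pi>(5,6)[symmetric] geq using gi by simp
    then have "ennreal ((\<integral>x. g x \<partial>uniform_measure m A1) - (\<integral>x. g x \<partial>uniform_measure m A0)) \<le>
        (\<integral>\<^sup>+\<gamma>. ennreal (g (ev 1 \<gamma>) - g (ev 0 \<gamma>)) \<partial>\<pi>)"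
      using ennreal_integral_le_nn_integral[of \<pi> "\<lambda>\<gamma>. g (ev 1 \<gamma>) - g (ev 0 \<gamma>)"] gi by simp
    also have "\<dots> \<le> (\<integral>\<^sup>+\<gamma>. ennreal D * (\<integral>\<^sup>+t. ennreal (slope g (ev (clamp01 t) \<gamma>)) \<partial>U) \<partial>\<pi>)"
    proof (rule nn_integral_mono_AE)
      show "AE \<gamma> in \<pi>. ennreal (g (ev 1 \<gamma>) - g (ev 0 \<gamma>)) \<le> ennreal D * (\<integral>\<^sup>+t. ennreal (slope g (ev (clamp01 t) \<gamma>)) \<partial>U)"
        using \<pi>(4)
      proof eventually_elim
        case (elim \<gamma>)
        have tm: "(\<lambda>t. ennreal (slope g (ev (clamp01 t) \<gamma>))) \<in> borel_measurable borel"
          using measurable_compose[OF borel_measurable_continuous_onI[OF continuous_on_ev_clamp01] sm] by measurable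
        have "ennreal (g (ev 1 \<gamma>) - g (ev 0 \<gamma>)) \<le>
            (\<integral>\<^sup>+t. ennreal (dist (ev 0 \<gamma>) (ev 1 \<gamma>) * slope g (ev (clamp01 t) \<gamma>)) * indicator {0<..<1} t \<partial>lborel)"
          using elim by (intro geodesic_increment_le[OF L]) simp
        also have "\<dots> \<le> (\<integral>\<^sup>+t. ennreal D * (ennreal (slope g (ev (clamp01 t) \<gamma>)) * indicator {0..1} t) \<partial>lborel)"
        proof (rule nn_integral_mono)
          fix t :: real
          have "ennreal (dist (ev 0 \<gamma>) (ev 1 \<gamma>) * slope g (ev (clamp01 t) \<gamma>)) \<le> ennreal (D * slope g (ev (clamp01 t) \<gamma>))"
            using elim D by (intro ennreal_leI mult_right_mono) auto
          then show "ennreal (dist (ev 0 \<gamma>) (ev 1 \<gamma>) * slope g (ev (clamp01 t) \<gamma>)) * indicator {0<..<1} t \<le>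
              ennreal D * (ennreal (slope g (ev (clamp01 t) \<gamma>)) * indicator {0..1} t)"
            using D(2) by (auto simp: indicator_def ennreal_mult)
        qed
        also have "\<dots> = ennreal D * (\<integral>\<^sup>+t. ennreal (slope g (ev (clamp01 t) \<gamma>)) * indicator {0..1} t \<partial>lborel)"
          using tm by (intro nn_integral_cmult borel_measurable_times_ennreal borel_measurable_indicator) simp_all
        also have "(\<integral>\<^sup>+t. ennreal (slope g (ev (clamp01 t) \<gamma>)) * indicator {0..1} t \<partial>lborel) =
            (\<integral>\<^sup>+t. ennreal (slope g (ev (clamp01 t) \<gamma>)) \<partial>U)"
          unfolding U_def using tm by (subst nn_integral_uniform_measure) (auto simp: divide_ennreal_def)
        finally show ?case .
      qed
    qed
    also have "\<dots> = ennreal D * (\<integral>\<^sup>+\<gamma>. \<integral>\<^sup>+t. ennreal (slope g (ev (clamp01 t) \<gamma>)) \<partial>U \<partial>\<pi>)"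
    proof (rule nn_integral_cmult)
      have "(\<lambda>z. ennreal (slope g (E z))) \<in> borel_measurable (U \<Otimes>\<^sub>M \<pi>)"
        using measurable_compose[OF E sm] by measurable
      then have "(\<lambda>(\<gamma>, t). ennreal (slope g (E (t, \<gamma>)))) \<in> borel_measurable (\<pi> \<Otimes>\<^sub>M U)"
        by (rule measurable_pair_swap)
      from U.borel_measurable_nn_integral_fst[OF this]
      show "(\<lambda>\<gamma>. \<integral>\<^sup>+t. ennreal (slope g (ev (clamp01 t) \<gamma>)) \<partial>U) \<in> borel_measurable \<pi>" by (simp add: E_def)
    qed
    also have "(\<integral>\<^sup>+\<gamma>. \<integral>\<^sup>+t. ennreal (slope g (ev (clamp01 t) \<gamma>)) \<partial>U \<partial>\<pi>) = (\<integral>\<^sup>+x. ennreal (slope g x) \<partial>\<nu>)"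
      by (rule nn\<nu>'[symmetric]) (use sm in measurable)
    also have "\<dots> = (\<integral>\<^sup>+x. ennreal (slope g x * h x) \<partial>m)"
      unfolding h(6)[symmetric] using h(1,2) sm by (subst nn_integral_density) (auto simp: ennreal_mult mult.commute)
    also have "\<dots> = ennreal (\<integral>x. slope g x * h x \<partial>m)"
      using h(2) L2_mult_integrable[OF slope_L2[OF g] h(3)] by (intro nn_integral_eq_integral) auto
    also have "ennreal D * \<dots> = ennreal (D * (\<integral>x. slope g x * h x \<partial>m))"
      using D(2) h(2) by (intro ennreal_mult[symmetric] integral_nonneg_AE) auto
    finally show ?thesis
      using D(2) h(2) by (subst (asm) ennreal_le_iff) (auto intro!: mult_nonneg_nonneg integral_nonneg_AE)
  qed
  show thesis by (rule that[OF h(3,2,4,5) hW main])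
qed

text \<open>Everything happens within distance d(x, y) + 4 of x, so that a Sobolev function agreeing
  with f on G is enough. The test density h is concentrated where the weak gradient is at most 1,
  and its mass 1 leaves just the length bound D.\<close>

lemma sobolev_to_lipschitz:
  assumes u: "u \<in> W12 m" and f: "continuous_on UNIV f"
    and G: "\<And>z. dist x z \<le> dist x y + 4 \<Longrightarrow> z \<in> G" and fu: "AE z in m. z \<in> G \<longrightarrow> f z = u z"
    and w: "AE z in m. z \<in> G \<longrightarrow> weak_grad m u z \<le> 1"
  shows "f y - f x \<le> dist x y"
proof (rule field_le_epsilon)
  fix e' :: real assume "e' > 0"
  \<comment> \<open>The final error is 4 e: 2 e from the length bound D and e from each of the two
    averages. The bound by 1 keeps all sets within the slack of 4.\<close>
  define e where "e = min 1 (e' / 4)"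
  have e: "0 < e" "e \<le> 1" "4 * e \<le> e'" using \<open>e' > 0\<close> by (auto simp: e_def)
  have near: "\<exists>A. compact A \<and> emeasure m A > 0 \<and> (\<forall>a\<in>A. dist z a < e \<and> \<bar>f a - f z\<bar> < e)" for z
  proof -
    have "open (ball z e \<inter> {a. \<bar>f a - f z\<bar> < e})"
      by (intro open_Int open_ball open_Collect_less continuous_intros f)
    moreover have "z \<in> ball z e \<inter> {a. \<bar>f a - f z\<bar> < e}" using e by simp
    then have "ball z e \<inter> {a. \<bar>f a - f z\<bar> < e} \<noteq> {}" by blast
    ultimately have "emeasure m (ball z e \<inter> {a. \<bar>f a - f z\<bar> < e}) > 0" "ball z e \<inter> {a. \<bar>f a - f z\<bar> < e} \<in> sets borel"
      by (auto intro!: emeasure_open_pos borel_open)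
    then obtain A where "compact A" "A \<subseteq> ball z e \<inter> {a. \<bar>f a - f z\<bar> < e}" "emeasure m A > 0"
      using compact_subset_positive by metis
    then show ?thesis by (intro exI[of _ A]) auto
  qed
  obtain A0 where A0: "compact A0" "emeasure m A0 > 0" "\<And>a. a \<in> A0 \<Longrightarrow> dist x a < e \<and> \<bar>f a - f x\<bar> < e"
    using near[of x] by blast
  obtain A1 where A1: "compact A1" "emeasure m A1 > 0" "\<And>a. a \<in> A1 \<Longrightarrow> dist y a < e \<and> \<bar>f a - f y\<bar> < e"
    using near[of y] by blast
  define D where "D = dist x y + 2 * e"
  have D: "dist a b \<le> D" if "a \<in> A0" "b \<in> A1" for a b
    using A0(3)[OF that(1)] A1(3)[OF that(2)] dist_triangle[of a b x] dist_triangle[of x b y]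
    by (simp add: D_def dist_commute)
  have D0: "0 \<le> D" using e by (simp add: D_def)
  define W where "W = ball x (dist x y + 4)"
  have WG: "z \<in> G" if "z \<in> W" for z using G that by (simp add: W_def)
  have W: "z \<in> W" if "a \<in> A0" "dist a z \<le> D" for a z
    using A0(3)[OF that(1)] that(2) dist_triangle[of x z a] e by (simp add: W_def D_def)
  have "open W" by (simp add: W_def)
  obtain h where h: "h \<in> L2 m" "\<And>x. 0 \<le> h x" "integrable m h" "(\<integral>x. h x \<partial>m) = 1"
    "AE x in m. x \<notin> W \<longrightarrow> h x = 0"
    "\<And>g. g \<in> Lip_bs \<Longrightarrow> (\<integral>x. g x \<partial>uniform_measure m A1) - (\<integral>x. g x \<partial>uniform_measure m A0) \<le> D * (\<integral>x. slope g x * h x \<partial>m)"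
    by (rule test_plan_density[OF A0(1,2) A1(1,2) D D0 \<open>open W\<close> W]) (assumption | rule that)+
  define k where "k A x = indicator A x / measure m A" for A and x :: 'a
  have kL: "k A \<in> L2 m" "(\<integral>x. k A x \<partial>m) = 1" "measure m A > 0" if "compact A" "emeasure m A > 0" for A
    using uniform_measure_integral(2-4)[OF that borel_measurable_const[of 0]] unfolding k_def[abs_def] by auto
  have "weak_grad m u \<in> relaxed_slopes m u" by (rule weak_grad_relaxed(1)[OF u])
  then obtain F where F: "\<And>n. F n \<in> Lip_bs" "L2_conv m F u" "L2_weak_conv m (\<lambda>n. slope (F n)) (weak_grad m u)"
    by (auto simp: relaxed_slopes_def)
  have lim: "(\<lambda>n. \<integral>x. F n x * k A x \<partial>m) \<longlonglongrightarrow> (\<integral>x. u x * k A x \<partial>m)" if "compact A" "emeasure m A > 0" for A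
    by (rule L2_conv_inner[OF F(2) L2_conv_const[OF kL(1)[OF that]]])
  have ineq: "(\<integral>x. F n x * k A1 x \<partial>m) - (\<integral>x. F n x * k A0 x \<partial>m) \<le> D * (\<integral>x. slope (F n) x * h x \<partial>m)" for n
    using h(6)[OF F(1)[of n]] uniform_measure_integral(1)[OF A0(1,2) L2_borel[OF Lip_bs_L2[OF F(1)[of n]]]]
      uniform_measure_integral(1)[OF A1(1,2) L2_borel[OF Lip_bs_L2[OF F(1)[of n]]]]
    by (simp add: k_def)
  \<comment> \<open>The averages over A0 and A1 converge by strong convergence of the approximants,
    the right-hand side by weak convergence of their slopes against the fixed h.\<close>
  have "(\<integral>x. u x * k A1 x \<partial>m) - (\<integral>x. u x * k A0 x \<partial>m) \<le> D * (\<integral>x. weak_grad m u x * h x \<partial>m)"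
  proof (rule LIMSEQ_le)
    show "(\<lambda>n. (\<integral>x. F n x * k A1 x \<partial>m) - (\<integral>x. F n x * k A0 x \<partial>m)) \<longlonglongrightarrow> (\<integral>x. u x * k A1 x \<partial>m) - (\<integral>x. u x * k A0 x \<partial>m)"
      by (intro tendsto_diff lim A0 A1)
    show "(\<lambda>n. D * (\<integral>x. slope (F n) x * h x \<partial>m)) \<longlonglongrightarrow> D * (\<integral>x. weak_grad m u x * h x \<partial>m)"
      using F(3) h(1) by (intro tendsto_mult tendsto_const) (simp add: L2_weak_conv_def)
  qed (use ineq in blast)
  also have "(\<integral>x. weak_grad m u x * h x \<partial>m) \<le> (\<integral>x. h x \<partial>m)"
  proof (rule integral_mono_AE)
    show "integrable m (\<lambda>x. weak_grad m u x * h x)" by (rule L2_mult_integrable[OF weak_grad_L2[OF u] h(1)])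
    show "AE x in m. weak_grad m u x * h x \<le> h x"
      using w h(5)
    proof eventually_elim
      case (elim z)
      show ?case
      proof (cases "z \<in> W")
        case True
        then show ?thesis using elim WG h(2)[of z] mult_right_mono[of "weak_grad m u z" 1 "h z"] by simp
      qed (use elim in simp)
    qed
  qed (rule h(3))
  finally have 1: "(\<integral>x. u x * k A1 x \<partial>m) - (\<integral>x. u x * k A0 x \<partial>m) \<le> D"
    using D0 h(4) by (simp add: mult_left_mono)
  have 2: "\<bar>(\<integral>x. u x * k A x \<partial>m) - f z\<bar> \<le> e"
    if A: "compact A" "emeasure m A > 0" "\<And>a. a \<in> A \<Longrightarrow> dist z a < e \<and> \<bar>f a - f z\<bar> < e" "\<And>a. a \<in> A \<Longrightarrow> a \<in> G" for A z
  proof -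
    have uki: "integrable m (\<lambda>x. u x * k A x)" by (rule L2_mult_integrable[OF W12_L2[OF u] kL(1)[OF A(1,2)]])
    \<comment> \<open>A function that is not integrable has integral 0 by convention, so the value 1
      certifies integrability.\<close>
    have ki: "integrable m (k A)" using kL(2)[OF A(1,2)] not_integrable_integral_eq by fastforce
    have "(\<integral>x. u x * k A x \<partial>m) - f z = (\<integral>x. u x * k A x - f z * k A x \<partial>m)"
      using uki ki kL(2)[OF A(1,2)] by simp
    also have "\<bar>\<dots>\<bar> \<le> (\<integral>x. e * k A x \<partial>m)"
    proof (rule order_trans[OF integral_abs_bound], rule integral_mono_AE)
      show "AE x in m. \<bar>u x * k A x - f z * k A x\<bar> \<le> e * k A x"
        using fu
      proof eventually_elim
        case (elim a)
        show ?case
        proof (cases "a \<in> A")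
          case True
          then have ua: "\<bar>u a - f z\<bar> \<le> e" using elim A(3,4)[OF True] by simp
          have k0: "0 \<le> k A a" using kL(3)[OF A(1,2)] by (simp add: k_def)
          have "\<bar>u a * k A a - f z * k A a\<bar> = \<bar>u a - f z\<bar> * k A a"
            using k0 by (simp add: abs_mult flip: left_diff_distrib)
          also have "\<dots> \<le> e * k A a" by (intro mult_right_mono ua k0)
          finally show ?thesis .
        qed (simp add: k_def)
      qed
    qed (use uki ki in auto)
    also have "\<dots> = e" using kL(2)[OF A(1,2)] by simp
    finally show ?thesis .
  qed
  have A0G: "a \<in> G" if "a \<in> A0" for a
  proof (rule G)
    show "dist x a \<le> dist x y + 4" using A0(3)[OF that] e zero_le_dist[of x y] by linarith
  qed
  have A1G: "a \<in> G" if "a \<in> A1" for a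
  proof (rule G)
    show "dist x a \<le> dist x y + 4" using A1(3)[OF that] e dist_triangle[of x a y] by linarith
  qed
  show "f y - f x \<le> dist x y + e'"
    using 1 2[OF A0 A0G] 2[OF A1 A1G] e unfolding D_def by linarith
qed

end

theorem theorem4p8:
  fixes m :: "'a::polish_space measure"
  assumes "RQCD m"
  shows "dirichlet_form m (Ch_form m) (W12 m) \<and>
    regular_form m (Ch_form m) (W12 m) \<and>
    strongly_local_form m (Ch_form m) (W12 m) \<and>
    (\<forall>x y. ereal (dist x y) =
        (SUP f\<in>{f \<in> W12_loc m. continuous_on UNIV f \<and> (AE z in m. (weak_grad_loc m f z)\<^sup>2 \<le> 1)}.
           ereal (f x - f y)) \<and>
      ereal (dist x y) =
        (SUP f\<in>{f \<in> W12 m \<inter> Cc. AE z in m. (weak_grad m f z)\<^sup>2 \<le> 1}. ereal (f x - f y)))"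
proof -
  obtain Q K N where QKN: "1 \<le> Q" "1 < N" "QCD Q K N m" using assms by (auto simp: RQCD_def)
  have monge: "monge_space m" and H: "infinitesimally_Hilbertian m" using assms by (auto simp: RQCD_def)
  interpret qcd_space m Q K N
    using monge QKN by unfold_locales (auto simp: monge_space_def metric_measure_space_def)
  define S1 where "S1 = {f \<in> W12_loc m. continuous_on UNIV f \<and> (AE z in m. (weak_grad_loc m f z)\<^sup>2 \<le> 1)}"
  define S2 where "S2 = {f \<in> W12 m \<inter> Cc. AE z in m. (weak_grad m f z)\<^sup>2 \<le> 1}"
  \<comment> \<open>The two families are nested once the local weak gradient is identified with the
    global one on every ball.\<close>
  have sub: "S2 \<subseteq> S1"
  proof
    fix f assume "f \<in> S2"
    then have f: "f \<in> W12 m" "continuous_on UNIV f" "AE z in m. (weak_grad m f z)\<^sup>2 \<le> 1"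
      by (auto simp: S2_def Cc_def)
    have loc: "f \<in> W12_loc m" using f(1) L2_measurable[OF W12_L2[OF f(1)]] by (auto simp: W12_loc_def)
    obtain x0 :: 'a where True by simp
    have "AE z in m. z \<in> ball x0 (real n) \<longrightarrow> weak_grad_loc m f z = weak_grad m f z" for n :: nat
      by (rule weak_grad_loc_spec[OF proper loc _ proper f(1)]) auto
    then have "AE z in m. \<forall>n::nat. z \<in> ball x0 (real n) \<longrightarrow> weak_grad_loc m f z = weak_grad m f z"
      unfolding AE_all_countable by blast
    then have "AE z in m. weak_grad_loc m f z = weak_grad m f z"
    proof eventually_elim
      case (elim z)
      obtain n :: nat where "dist x0 z < n" using reals_Archimedean2 by blast
      then show ?case using elim by auto
    qed
    then have "AE z in m. (weak_grad_loc m f z)\<^sup>2 \<le> 1" using f(3) by eventually_elim simp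
    then show "f \<in> S1" using f loc by (simp add: S1_def)
  qed
  have upper: "f x - f y \<le> dist x y" if f: "f \<in> S1" for f x y
  proof -
    have f': "f \<in> W12_loc m" "continuous_on UNIV f" "AE z in m. (weak_grad_loc m f z)\<^sup>2 \<le> 1"
      using f by (auto simp: S1_def)
    \<comment> \<open>The radius d(y, x) + 5 makes room for the closed ball of radius d(y, x) + 4
      needed around y, and properness makes G relatively compact.\<close>
    define G where "G = ball y (dist y x + 5)"
    have G: "open G" "compact (closure G)" unfolding G_def by (auto intro: proper)
    then obtain u where u: "u \<in> W12 m" "AE z in m. z \<in> G \<longrightarrow> f z = u z" using f'(1) unfolding W12_loc_def by blast
    have "AE z in m. z \<in> G \<longrightarrow> weak_grad_loc m f z = weak_grad m u z"
      by (rule weak_grad_loc_spec[OF _ f'(1) G u]) (rule proper)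
    then have "AE z in m. z \<in> G \<longrightarrow> weak_grad m u z \<le> 1"
      using f'(3)
    proof eventually_elim
      case (elim z)
      then show ?case by (auto simp: abs_square_le_1 abs_le_iff)
    qed
    then have "f x - f y \<le> dist y x"
      by (intro sobolev_to_lipschitz[OF u(1) f'(2) _ u(2)]) (auto simp: G_def)
    then show ?thesis by (simp add: dist_commute)
  qed
  have lower: "\<exists>f\<in>S2. f x - f y = dist x y" for x y
  proof -
    \<comment> \<open>Takes the value d(x, y) at x and 0 at y, so the supremum is attained; the
      truncation bounds the support.\<close>
    define f where "f z = max 0 (dist x y - dist x z)" for z
    have L: "1-lipschitz_on UNIV f"
    proof (rule lipschitz_onI_real)
      fix a b
      have "\<bar>f a - f b\<bar> \<le> \<bar>dist x a - dist x b\<bar>" unfolding f_def by linarith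
      also have "\<dots> \<le> dist a b" using abs_dist_diff_le[of a x b] by (simp add: dist_commute)
      finally show "\<bar>f a - f b\<bar> \<le> 1 * dist a b" by simp
    qed simp
    have "{z. f z \<noteq> 0} \<subseteq> cball x (dist x y)" by (auto simp: f_def)
    then have b: "bounded {z. f z \<noteq> 0}" by (rule bounded_subset[rotated]) simp
    have fL: "f \<in> Lip_bs" using L b by (auto simp: Lip_bs_def)
    have fW: "f \<in> W12 m" by (rule Lip_bs_W12(1)[OF fL])
    have "AE z in m. (weak_grad m f z)\<^sup>2 \<le> 1"
      using weak_grad_le_slope[OF fL] weak_grad_nonneg[OF fW]
    proof eventually_elim
      case (elim z)
      then have "weak_grad m f z \<le> 1" using slope_le_lipschitz[OF L, of z] by linarith
      then show ?case using elim by (simp add: abs_square_le_1)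
    qed
    moreover have "f \<in> Cc" using Lip_bs_continuous[OF fL] proper[OF b] by (simp add: Cc_def)
    ultimately have "f \<in> S2" using fW by (simp add: S2_def)
    moreover have "f x - f y = dist x y" by (simp add: f_def)
    ultimately show ?thesis by blast
  qed
  \<comment> \<open>Any family between \<open>S2\<close> and \<open>S1\<close> has supremum d(x, y),
    attained already in the smaller one and never exceeded in the larger one; the two formulas are
    the extreme cases.\<close>
  have sup: "ereal (dist x y) = (SUP f\<in>S. ereal (f x - f y))" if S: "S2 \<subseteq> S" "S \<subseteq> S1" for S x y
  proof (rule antisym)
    obtain f where "f \<in> S2" "f x - f y = dist x y" using lower by blast
    then show "ereal (dist x y) \<le> (SUP f\<in>S. ereal (f x - f y))" using S by (intro SUP_upper2[of f]) auto
    show "(SUP f\<in>S. ereal (f x - f y)) \<le> ereal (dist x y)" using S upper by (intro SUP_least) auto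
  qed
  have reg: "regular_form m (Ch_form m) (W12 m)"
    by (rule regular_form_Ch[OF H]) (rule proper)
  show ?thesis
    using dirichlet_form_Ch[OF H] reg strongly_local_form_Ch
      sup[OF sub order_refl] sup[OF order_refl sub] unfolding S1_def S2_def by blast
qed

end
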